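(* Consider the distributed Gaussian white noise model with $m\le n^{\delta}$ for some $\delta\in(0,1)$, let $0<s_1<s_2$ be arbitrary, let $L>0$, and fix self-similarity parameters $\varepsilon>0$, $j_0\in\mathbb{N}$, $\rho>1$. Assume that $f_0\in B^s_{\infty,\infty}(L)$ for some $s\in[s_1,s_2]$. Then there exists a distributed estimator $\hat f$ whose numbers of transmitted bits satisfy $\hat B^{(i)}\le (n/\log n)^{1/(1+2s_1)}\log n$ for all $i=1,\dots,m$, and $$\max_{i\in\{1,\dots,m\}}\ \sup_{s\in[s_1,s_2]}\ \sup_{f_0\in S^s_\infty(L,\varepsilon,j_0,\rho)}\frac{E^{(i)}_{f_0}\hat B^{(i)}}{n^{\frac{1}{1+2s}}(\log n)^{\frac{2s}{1+2s}}}\lesssim 1$$ and $$\sup_{s\in[s_1,s_2]}\ \sup_{f_0\in S^s_\infty(L,\varepsilon,j_0,\rho)}\frac{E_{f_0}\|\hat f-f_0\|_\infty}{(n/\log n)^{-\frac{s}{1+2s}}}\lesssim 1.$$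
   Context: Model (distributed Gaussian white noise): there are $m=m_n$ machines; machine $i\in\{1,\dots,m\}$ observes the process $X^{(i)}$ with $dX^{(i)}_t=f_0(t)\,dt+\sqrt{m/n}\,dW^{(i)}_t$, $t\in[0,1]$, where $W^{(1)},\dots,W^{(m)}$ are independent standard Wiener processes and $f_0\in L_2[0,1]$ is unknown. $E_{f_0}$ denotes expectation under the joint law of all data (and any randomization), $E^{(i)}_{f_0}$ expectation under the law of $X^{(i)}$ (and the local randomization of machine $i$). Distributed estimator: independently of each other, each machine $i$ produces from its own data $X^{(i)}$ (possibly with additional local randomization independent of everything else) a random finite binary string $Y^{(i)}$ of length $\hat B^{(i)}$ (number of transmitted bits), and $\hat f$ is a measurable function of $(Y^{(1)},\dots,Y^{(m)})$ only. Statements concern sequences of such procedures indexed by $n$; the procedure does not depend on the particular $s\in[s_1,s_2]$. Besov balls: let $\{\psi_{jk}: j\ge 0,\ 1\le k\le 2^j\}$ be a compactly supported orthonormal $N$-regular Cohen–Daubechies–Vial wavelet basis of $L_2[0,1]$, with $N$ larger than all regularities considered, and $f_{jk}=\langle f,\psi_{jk}\rangle$. Then $\|f\|_{B^s_{\infty,\infty}}=\sup_{j\ge 0,\,k}2^{j(s+1/2)}|f_{jk}|$ and $B^s_{\infty,\infty}(L)=\{f\in L_2[0,1]:\|f\|_{B^s_{\infty,\infty}}<L\}$. Self-similar class: for $j_1\le j_2$ put $f_{[j_1,j_2]}=\sum_{j_1\le j\le j_2}\sum_{k=1}^{2^j}f_{jk}\psi_{jk}$ (sum over integers $j$). For $\rho>1$,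 $S^s_\infty(L,\varepsilon,j_0,\rho)$ is the set of $f\in B^s_{\infty,\infty}(L)$ with $\|f_{[j,\rho j]}\|_{B^s_{\infty,\infty}}\ge\varepsilon L$ for all integers $j\ge j_0$. $\log$ is the base-2 logarithm. $a_n\lesssim b_n$ means $a_n\le C b_n$ for all sufficiently large $n$, with $C>0$ not depending on $n$, $i$, $f_0$ or $s\in[s_1,s_2]$ (it may depend on the fixed parameters $s_1,s_2,L,\delta,\varepsilon,j_0,\rho$). *)

theory Defs
  imports "HOL-Probability.Probability"
begin

section \<open>The space \<open>L\<^sub>2[0,1]\<close>\<close>

text \<open>Elements of \<open>L\<^sub>2[0,1]\<close> are represented by functions; all notions below depend only on the
  almost-everywhere class of the restriction to \<open>[0,1]\<close>.\<close>

definition L2_unit :: "(real \<Rightarrow> real) set" where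
  "L2_unit = {f. f \<in> borel_measurable (lebesgue_on {0..1}) \<and>
                 integrable (lebesgue_on {0..1}) (\<lambda>x. (f x)\<^sup>2)}"

definition L2_inner :: "(real \<Rightarrow> real) \<Rightarrow> (real \<Rightarrow> real) \<Rightarrow> real" where
  "L2_inner f g = (LINT x|lebesgue_on {0..1}. f x * g x)"

definition Linf_norm :: "(real \<Rightarrow> real) \<Rightarrow> ennreal" where
  "Linf_norm f = esssup (lebesgue_on {0..1}) (\<lambda>x. ennreal \<bar>f x\<bar>)"


section \<open>Cohen--Daubechies--Vial wavelet bases\<close>

text \<open>The mother wavelet of a scaling function \<open>\<phi>\<close> with finite filter \<open>h\<close> supported in
  \<open>{1-N..N}\<close>.\<close>

definition mother_wavelet :: "nat \<Rightarrow> (int \<Rightarrow> real) \<Rightarrow> (real \<Rightarrow> real) \<Rightarrow> real \<Rightarrow> real" where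
  "mother_wavelet N h \<phi> x =
     sqrt 2 * (\<Sum>k\<in>{1 - int N..int N}. (- 1) powi k * h (1 - k) * \<phi> (2 * x - of_int k))"

text \<open>Daubechies' orthonormal scaling function with \<open>N\<close> vanishing moments, shifted so that \<open>\<phi>\<close> and
  the mother wavelet are both supported in \<open>[1-N,N]\<close>. A filter of the minimal length \<open>2N\<close> is not
  unique, so the extremal-phase and the least-asymmetric choices are both covered;
  \<open>N = 1\<close> gives the Haar functions.\<close>

definition daubechies_scaling :: "nat \<Rightarrow> (int \<Rightarrow> real) \<Rightarrow> (real \<Rightarrow> real) \<Rightarrow> bool" where
  "daubechies_scaling N h \<phi> \<longleftrightarrow>
     N \<ge> 1 \<and>
     \<phi> \<in> borel_measurable borel \<and> bounded (range \<phi>) \<and>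
     (\<forall>x. x \<notin> {1 - real N..real N} \<longrightarrow> \<phi> x = 0) \<and>
     (LINT x|lborel. \<phi> x) = 1 \<and>
     (\<forall>k::int. (LINT x|lborel. \<phi> x * \<phi> (x - of_int k)) = (if k = 0 then 1 else 0)) \<and>
     (\<forall>x. \<phi> x = sqrt 2 * (\<Sum>k\<in>{1 - int N..int N}. h k * \<phi> (2 * x - of_int k))) \<and>
     (\<forall>a<N. (LINT x|lborel. x ^ a * mother_wavelet N h \<phi> x) = 0)"

text \<open>The multiresolution space \<open>V\<^sub>j\<close> on \<open>[0,1]\<close> (for \<open>2\<^sup>j \<ge> 2N\<close>) of Cohen, Daubechies and Vial. It is
  spanned by the interior scaling functions \<open>\<phi>(2\<^sup>j x - k)\<close>, \<open>N \<le> k < 2\<^sup>j - N\<close>, by \<open>N\<close> left edge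
  functions, which are the combinations of the remaining integer translates meeting \<open>[0,1]\<close>
  on the left with coefficients polynomial in the translate of degree \<open>< N\<close>, and by \<open>N\<close> right edge
  functions obtained in the same way from \<open>k = 2\<^sup>j - 1 - l\<close>. Thus \<open>V\<^sub>j\<close> has dimension \<open>2\<^sup>j\<close> and
  contains all polynomials of degree \<open>< N\<close>.\<close>

definition cdv_space :: "nat \<Rightarrow> (real \<Rightarrow> real) \<Rightarrow> nat \<Rightarrow> (real \<Rightarrow> real) set" where
  "cdv_space N \<phi> j = {f. \<exists>c d e. \<forall>x\<in>{0..1}.
     f x = (\<Sum>k\<in>{N..<2 ^ j - N}. c k * \<phi> (2 ^ j * x - real k))
         + (\<Sum>a<N. d a * (\<Sum>l\<in>{1 - int N..int N - 1}. of_int l ^ a * \<phi> (2 ^ j * x - of_int l)))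
         + (\<Sum>a<N. e a * (\<Sum>l\<in>{1 - int N..int N - 1}.
               of_int l ^ a * \<phi> (2 ^ j * x - of_int (2 ^ j - 1 - l))))}"

text \<open>Wavelets are written \<open>\<psi> j k\<close> with \<open>j \<ge> 0\<close> and \<open>1 \<le> k \<le> 2\<^sup>j\<close>. From the coarsest level \<open>J\<close> on these
  are the wavelets spanning \<open>V\<^sub>j\<^sub>+\<^sub>1 \<ominus> V\<^sub>j\<close>; the \<open>2\<^sup>J\<close> coarse (scaling) functions spanning \<open>V\<^sub>J\<close> take up
  the \<open>2\<^sup>J - 1\<close> indices below level \<open>J\<close>. This leaves exactly one function without an index, and
  it is put at level \<open>0\<close> with \<open>k = 0\<close>; without it the system would not be complete.\<close>

definition wavelet_index :: "nat \<Rightarrow> nat set" where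
  "wavelet_index j = (if j = 0 then {0, 1} else {1..2 ^ j})"

definition orthonormal_basis_L2 :: "(nat \<Rightarrow> nat \<Rightarrow> real \<Rightarrow> real) \<Rightarrow> bool" where
  "orthonormal_basis_L2 \<psi> \<longleftrightarrow>
     (\<forall>j. \<forall>k\<in>wavelet_index j. \<psi> j k \<in> L2_unit) \<and>
     (\<forall>j. \<forall>k\<in>wavelet_index j. \<forall>j'. \<forall>k'\<in>wavelet_index j'.
        L2_inner (\<psi> j k) (\<psi> j' k') = (if j = j' \<and> k = k' then 1 else 0)) \<and>
     (\<forall>f\<in>L2_unit. (\<forall>j. \<forall>k\<in>wavelet_index j. L2_inner f (\<psi> j k) = 0) \<longrightarrow>
        (AE x in lebesgue_on {0..1}. f x = 0))"

text \<open>At each level \<open>j \<ge> J\<close> the wavelets are, from left to right, \<open>N\<close> left edge wavelets (dilates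
  of \<open>\<psi>l a\<close>), the interior translates of the mother wavelet, and \<open>N\<close> right edge wavelets
  (reflected dilates of \<open>\<psi>r a\<close>). \<open>N\<close>-regularity is understood as \<open>N\<close> vanishing moments for bounded,
  compactly supported functions; no differentiability of \<open>\<phi>\<close> is required.\<close>

definition cdv_wavelet_basis :: "nat \<Rightarrow> (nat \<Rightarrow> nat \<Rightarrow> real \<Rightarrow> real) \<Rightarrow> bool" where
  "cdv_wavelet_basis N \<psi> \<longleftrightarrow>
     orthonormal_basis_L2 \<psi> \<and>
     (\<exists>h \<phi> J \<psi>l \<psi>r.
        daubechies_scaling N h \<phi> \<and> 2 * N \<le> 2 ^ J \<and>
        (\<forall>j<J. \<forall>k\<in>wavelet_index j. \<psi> j k \<in> cdv_space N \<phi> J) \<and>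
        (\<forall>j\<ge>J. \<forall>k\<in>{1..2 ^ j}. \<psi> j k \<in> cdv_space N \<phi> (Suc j) \<and>
           (\<forall>g\<in>cdv_space N \<phi> j. L2_inner (\<psi> j k) g = 0)) \<and>
        (\<forall>a<N. \<forall>y>2 * real N - 1. \<psi>l a y = 0 \<and> \<psi>r a y = 0) \<and>
        (\<forall>j\<ge>J. \<forall>x\<in>{0..1}.
           (\<forall>a<N. \<psi> j (a + 1) x = 2 powr (real j / 2) * \<psi>l a (2 ^ j * x)) \<and>
           (\<forall>k\<in>{N..<2 ^ j - N}.
              \<psi> j (k + 1) x = 2 powr (real j / 2) * mother_wavelet N h \<phi> (2 ^ j * x - real k)) \<and>
           (\<forall>a<N. \<psi> j (2 ^ j - a) x = 2 powr (real j / 2) * \<psi>r a (2 ^ j * (1 - x)))))"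


section \<open>Besov balls and self-similar functions\<close>

definition besov_norm :: "(nat \<Rightarrow> nat \<Rightarrow> real \<Rightarrow> real) \<Rightarrow> real \<Rightarrow> (real \<Rightarrow> real) \<Rightarrow> ennreal" where
  "besov_norm \<psi> s f =
     (SUP j. SUP k\<in>wavelet_index j. ennreal (2 powr (real j * (s + 1/2)) * \<bar>L2_inner f (\<psi> j k)\<bar>))"

definition besov_ball :: "(nat \<Rightarrow> nat \<Rightarrow> real \<Rightarrow> real) \<Rightarrow> real \<Rightarrow> real \<Rightarrow> (real \<Rightarrow> real) set" where
  "besov_ball \<psi> s L = {f \<in> L2_unit. besov_norm \<psi> s f < ennreal L}"

definition wavelet_block ::
  "(nat \<Rightarrow> nat \<Rightarrow> real \<Rightarrow> real) \<Rightarrow> real \<Rightarrow> real \<Rightarrow> (real \<Rightarrow> real) \<Rightarrow> real \<Rightarrow> real" where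
  "wavelet_block \<psi> a b f x =
     (\<Sum>j\<in>{j::nat. a \<le> real j \<and> real j \<le> b}. \<Sum>k\<in>wavelet_index j. L2_inner f (\<psi> j k) * \<psi> j k x)"

definition self_similar ::
  "(nat \<Rightarrow> nat \<Rightarrow> real \<Rightarrow> real) \<Rightarrow> real \<Rightarrow> real \<Rightarrow> real \<Rightarrow> nat \<Rightarrow> real \<Rightarrow> (real \<Rightarrow> real) set" where
  "self_similar \<psi> s L \<epsilon> j0 \<rho> =
     {f \<in> besov_ball \<psi> s L.
        \<forall>j\<ge>j0. besov_norm \<psi> s (wavelet_block \<psi> (real j) (\<rho> * real j) f) \<ge> ennreal (\<epsilon> * L)}"


section \<open>Distributed Gaussian white noise\<close>

definition path_space :: "(real \<Rightarrow> real) measure" where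
  "path_space = (\<Pi>\<^sub>M t\<in>{0..1}. borel)"

definition wiener_process :: "'w measure \<Rightarrow> (real \<Rightarrow> 'w \<Rightarrow> real) \<Rightarrow> bool" where
  "wiener_process M W \<longleftrightarrow>
     prob_space M \<and>
     (\<forall>t\<in>{0..1}. W t \<in> borel_measurable M) \<and>
     (AE \<omega> in M. W 0 \<omega> = 0) \<and>
     (\<forall>r. \<forall>\<tau>::nat \<Rightarrow> real. mono_on {..r} \<tau> \<and> \<tau> ` {..r} \<subseteq> {0..1} \<longrightarrow>
        prob_space.indep_vars M (\<lambda>_. borel) (\<lambda>k \<omega>. W (\<tau> (Suc k)) \<omega> - W (\<tau> k) \<omega>) {..<r}) \<and>
     (\<forall>s t. 0 \<le> s \<and> s < t \<and> t \<le> 1 \<longrightarrow>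
        distributed M lborel (\<lambda>\<omega>. W t \<omega> - W s \<omega>) (normal_density 0 (sqrt (t - s)))) \<and>
     (AE \<omega> in M. continuous_on {0..1} (\<lambda>t. W t \<omega>))"

definition independent_wiener :: "'w measure \<Rightarrow> nat \<Rightarrow> (nat \<Rightarrow> real \<Rightarrow> 'w \<Rightarrow> real) \<Rightarrow> bool" where
  "independent_wiener M m W \<longleftrightarrow>
     prob_space M \<and>
     (\<forall>i\<in>{1..m}. wiener_process M (W i)) \<and>
     prob_space.indep_vars M (\<lambda>_. path_space) (\<lambda>i \<omega>. \<lambda>t\<in>{0..1}. W i t \<omega>) {1..m}"

text \<open>\<open>dX\<^sub>t = f(t) dt + \<surd>(m/n) dW\<^sub>t\<close> with \<open>X\<^sub>0 = 0\<close>. As the noise level is constant, no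
  stochastic integral is needed. The argument \<open>W\<close> is the driving process of one machine.\<close>

definition observation ::
  "nat \<Rightarrow> nat \<Rightarrow> (real \<Rightarrow> real) \<Rightarrow> (real \<Rightarrow> 'w \<Rightarrow> real) \<Rightarrow> 'w \<Rightarrow> real \<Rightarrow> real" where
  "observation n m f W \<omega> =
     (\<lambda>t\<in>{0..1}. (LINT x|lebesgue_on {0..t}. f x) + sqrt (real m / real n) * W t \<omega>)"


section \<open>Distributed estimators\<close>

text \<open>Machine \<open>i\<close> encodes its observed path and a private random seed into a bit string; the decoder
  sees the bit strings only. Real-valued seeds lose no generality, since every Markov kernel into
  a countable set is realized by a uniform seed.\<close>

record dist_estimator =
  seed :: "nat \<Rightarrow> real measure"
  encode :: "nat \<Rightarrow> (real \<Rightarrow> real) \<times> real \<Rightarrow> bool list"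
  decode :: "(nat \<Rightarrow> bool list) \<Rightarrow> real \<Rightarrow> real"

text \<open>No measurability of \<open>decode\<close> in the bit strings is demanded: on the countable discrete space of
  \<open>m\<close>-tuples of finite strings every map is measurable.\<close>

definition distributed_estimator :: "nat \<Rightarrow> dist_estimator \<Rightarrow> bool" where
  "distributed_estimator m e \<longleftrightarrow>
     (\<forall>i\<in>{1..m}. prob_space (seed e i) \<and> sets (seed e i) = sets borel \<and>
        encode e i \<in> path_space \<Otimes>\<^sub>M seed e i \<rightarrow>\<^sub>M count_space UNIV) \<and>
     (\<forall>y. decode e y \<in> L2_unit)"

text \<open>Noise together with all private seeds. The product makes the seeds independent of each other
  and of the data.\<close>

definition joint_space :: "'w measure \<Rightarrow> nat \<Rightarrow> dist_estimator \<Rightarrow> ('w \<times> (nat \<Rightarrow> real)) measure" where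
  "joint_space M m e = M \<Otimes>\<^sub>M (\<Pi>\<^sub>M i\<in>{1..m}. seed e i)"

definition message ::
  "nat \<Rightarrow> nat \<Rightarrow> (nat \<Rightarrow> real \<Rightarrow> 'w \<Rightarrow> real) \<Rightarrow> dist_estimator \<Rightarrow> (real \<Rightarrow> real) \<Rightarrow>
     nat \<Rightarrow> 'w \<Rightarrow> real \<Rightarrow> bool list" where
  "message n m W e f i \<omega> u = encode e i (observation n m f (W i) \<omega>, u)"

definition bits ::
  "nat \<Rightarrow> nat \<Rightarrow> (nat \<Rightarrow> real \<Rightarrow> 'w \<Rightarrow> real) \<Rightarrow> dist_estimator \<Rightarrow> (real \<Rightarrow> real) \<Rightarrow>
     nat \<Rightarrow> 'w \<Rightarrow> real \<Rightarrow> nat" where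
  "bits n m W e f i \<omega> u = length (message n m W e f i \<omega> u)"

definition estimate ::
  "nat \<Rightarrow> nat \<Rightarrow> (nat \<Rightarrow> real \<Rightarrow> 'w \<Rightarrow> real) \<Rightarrow> dist_estimator \<Rightarrow> (real \<Rightarrow> real) \<Rightarrow>
     'w \<times> (nat \<Rightarrow> real) \<Rightarrow> real \<Rightarrow> real" where
  "estimate n m W e f z = decode e (\<lambda>i\<in>{1..m}. message n m W e f i (fst z) (snd z i))"

text \<open>\<open>E\<^sup>(\<^sup>i\<^sup>)\<^sub>f B\<^sup>(\<^sup>i\<^sup>)\<close> and \<open>E\<^sub>f \<parallel>estimate - f\<parallel>\<^sub>\<infinity>\<close>, as extended nonnegative integrals.\<close>

definition expected_bits ::
  "nat \<Rightarrow> nat \<Rightarrow> 'w measure \<Rightarrow> (nat \<Rightarrow> real \<Rightarrow> 'w \<Rightarrow> real) \<Rightarrow> dist_estimator \<Rightarrow>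
     (real \<Rightarrow> real) \<Rightarrow> nat \<Rightarrow> ennreal" where
  "expected_bits n m M W e f i =
     (\<integral>\<^sup>+ (\<omega>, u). ennreal (real (bits n m W e f i \<omega> u)) \<partial>(M \<Otimes>\<^sub>M seed e i))"

definition sup_risk ::
  "nat \<Rightarrow> nat \<Rightarrow> 'w measure \<Rightarrow> (nat \<Rightarrow> real \<Rightarrow> 'w \<Rightarrow> real) \<Rightarrow> dist_estimator \<Rightarrow>
     (real \<Rightarrow> real) \<Rightarrow> ennreal" where
  "sup_risk n m M W e f =
     (\<integral>\<^sup>+ z. Linf_norm (\<lambda>x. estimate n m W e f z x - f x) \<partial>(joint_space M m e))"

end

theory Submission
  imports Defs "HOL-Library.Discrete_Functions" "HOL-Real_Asymp.Real_Asymp"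
begin

text \<open>Each machine estimates its wavelet coefficients by finite linear combinations of increments of
  its path, obtained from \<open>L\<^sub>2\<close>-approximation of the wavelets by step functions, so no stochastic
  integral is needed. Its local noise level \<open>\<surd>(m/n)\<close> is polynomially small, hence on levels of order
  \<open>\<kappa> log n\<close> with small \<open>\<kappa>\<close> the coefficients are known up to an error that is negligible against
  \<open>2\<^sup>-\<^sup>j\<^sup>(\<^sup>s\<^sup>+\<^sup>1\<^sup>/\<^sup>2\<^sup>)\<close>. By self-similarity some coefficient on these levels is at least of that size,
  which determines \<open>s\<close> up to \<open>O(1 / log n)\<close>, that is, the optimal resolution level up to \<open>O(1)\<close>.
  The machine sends its coefficients up to the level so found, each quantized to \<open>O(log n)\<close> bits; the decoder
  averages them up to the smallest level used by any machine. Averaging restores the noise level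
  \<open>1/\<surd>n\<close>, Gaussian tail bounds control all coefficients simultaneously outside an event of
  probability at most \<open>1/n\<close>, and on that event the quantization keeps the loss below \<open>O(\<surd>n)\<close>.\<close>

section \<open>Subgaussian variables\<close>

text \<open>Why the block of levels must be of order log n: a coefficient at level j that is known
  up to a constant factor determines s only up to O(1/j). The target level A / (1 + 2 s), with A =
  log (n / log n), then moves by O(1) only if j is proportional to log n. On the other hand the
  block reaches up to level \<rho> \<kappa> log n, where the coefficient to be detected may be as
  small as a constant times n^(-\<rho> \<kappa> (s2 + 1/2)). So \<kappa> has to be small enough for
  this to exceed the local noise, which is n^(-(1 - \<delta>)/2) up to a logarithm; this is where
  \<delta> < 1 enters. A second constraint shapes the code: the bit budget must hold surely and with
  constant 1, whereas the quantized coefficients cost a constant times log n bits each. Hence the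
  selected level is capped by the level belonging to s1, and each machine sends a constant number c0
  of levels less than it selected. The price is a constant factor in the bias.\<close>

definition subgaussian :: "'a measure \<Rightarrow> real \<Rightarrow> ('a \<Rightarrow> real) \<Rightarrow> bool" where
  "subgaussian M v X \<longleftrightarrow> X \<in> borel_measurable M \<and>
     (\<forall>l::real. (\<integral>\<^sup>+\<omega>. ennreal (exp (l * X \<omega>)) \<partial>M) \<le> ennreal (exp (l\<^sup>2 * v / 2)))"

lemma subgaussian_measurable: "subgaussian M v X \<Longrightarrow> X \<in> borel_measurable M"
  by (simp add: subgaussian_def)

lemma subgaussian_mono:
  assumes "subgaussian M v X" "v \<le> w"
  shows "subgaussian M w X"
proof -
  have "ennreal (exp (l\<^sup>2 * v / 2)) \<le> ennreal (exp (l\<^sup>2 * w / 2))" for l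
    using assms(2) by (intro ennreal_leI) (simp add: mult_left_mono)
  then show ?thesis
    using assms(1) unfolding subgaussian_def by (meson order_trans)
qed

lemma subgaussian_scale:
  assumes "subgaussian M v X"
  shows "subgaussian M (c\<^sup>2 * v) (\<lambda>\<omega>. c * X \<omega>)"
proof -
  have "(\<integral>\<^sup>+\<omega>. ennreal (exp (l * (c * X \<omega>))) \<partial>M) \<le> ennreal (exp (l\<^sup>2 * (c\<^sup>2 * v) / 2))" for l
  proof -
    have "(\<integral>\<^sup>+\<omega>. ennreal (exp ((l * c) * X \<omega>)) \<partial>M) \<le> ennreal (exp ((l * c)\<^sup>2 * v / 2))"
      using assms unfolding subgaussian_def by blast
    then show ?thesis by (simp add: mult.assoc power_mult_distrib)
  qed
  then show ?thesis
    using assms unfolding subgaussian_def by auto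
qed

lemma (in prob_space) subgaussian_sum:
  assumes "finite I" and ind: "indep_vars (\<lambda>_. borel) X I"
    and sub: "\<And>i. i \<in> I \<Longrightarrow> subgaussian M (v i) (X i)"
  shows "subgaussian M (\<Sum>i\<in>I. v i) (\<lambda>\<omega>. \<Sum>i\<in>I. X i \<omega>)"
  unfolding subgaussian_def
proof (intro conjI allI)
  show "(\<lambda>\<omega>. \<Sum>i\<in>I. X i \<omega>) \<in> borel_measurable M"
    using sub by (intro borel_measurable_sum) (auto dest: subgaussian_measurable)
  fix l :: real
  have ind': "indep_vars (\<lambda>_. borel) (\<lambda>i \<omega>. ennreal (exp (l * X i \<omega>))) I"
    by (rule indep_vars_compose2[OF ind]) measurable
  have "(\<integral>\<^sup>+\<omega>. ennreal (exp (l * (\<Sum>i\<in>I. X i \<omega>))) \<partial>M) =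
      (\<integral>\<^sup>+\<omega>. (\<Prod>i\<in>I. ennreal (exp (l * X i \<omega>))) \<partial>M)"
    by (simp add: sum_distrib_left exp_sum[OF assms(1)] prod_ennreal)
  also have "\<dots> = (\<Prod>i\<in>I. \<integral>\<^sup>+\<omega>. ennreal (exp (l * X i \<omega>)) \<partial>M)"
    by (rule indep_vars_nn_integral[OF assms(1) ind']) simp
  also have "\<dots> \<le> (\<Prod>i\<in>I. ennreal (exp (l\<^sup>2 * v i / 2)))"
    using sub by (intro prod_mono_ennreal) (simp add: subgaussian_def)
  also have "\<dots> = ennreal (exp (\<Sum>i\<in>I. l\<^sup>2 * v i / 2))"
    by (simp add: prod_ennreal exp_sum[OF assms(1)])
  also have "(\<Sum>i\<in>I. l\<^sup>2 * v i / 2) = l\<^sup>2 * (\<Sum>i\<in>I. v i) / 2"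
    by (simp add: sum_distrib_left sum_divide_distrib)
  finally show "(\<integral>\<^sup>+\<omega>. ennreal (exp (l * (\<Sum>i\<in>I. X i \<omega>))) \<partial>M)
      \<le> ennreal (exp (l\<^sup>2 * (\<Sum>i\<in>I. v i) / 2))" .
qed

lemma subgaussian_normal:
  assumes D: "distributed M lborel X (normal_density 0 \<sigma>)" and \<sigma>: "\<sigma> > 0"
  shows "subgaussian M (\<sigma>\<^sup>2) X"
  unfolding subgaussian_def
proof (intro conjI allI)
  show "X \<in> borel_measurable M"
    using distributed_measurable[OF D] by simp
  fix l :: real
  \<comment> \<open>Exponential tilting: completing the square turns the weighted density into a
    multiple of the normal density with shifted mean, which integrates to 1.\<close>
  have shift: "normal_density 0 \<sigma> x * exp (l * x) = exp (l\<^sup>2 * \<sigma>\<^sup>2 / 2) * normal_density (l * \<sigma>\<^sup>2) \<sigma> x" for x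
  proof -
    have "- (x\<^sup>2 / (2 * \<sigma>\<^sup>2)) + l * x = l\<^sup>2 * \<sigma>\<^sup>2 / 2 + (- ((x - l * \<sigma>\<^sup>2)\<^sup>2 / (2 * \<sigma>\<^sup>2)))"
      using \<sigma> by (simp add: field_simps power2_eq_square)
    then show ?thesis
      by (simp add: normal_density_def mult_exp_exp[symmetric] exp_add[symmetric])
  qed
  have "(\<integral>\<^sup>+\<omega>. ennreal (exp (l * X \<omega>)) \<partial>M) =
      (\<integral>\<^sup>+x. ennreal (normal_density 0 \<sigma> x) * ennreal (exp (l * x)) \<partial>lborel)"
    by (rule distributed_nn_integral[OF D, symmetric]) simp
  also have "\<dots> = (\<integral>\<^sup>+x. ennreal (exp (l\<^sup>2 * \<sigma>\<^sup>2 / 2)) * ennreal (normal_density (l * \<sigma>\<^sup>2) \<sigma> x) \<partial>lborel)"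
    by (intro nn_integral_cong) (simp add: ennreal_mult[symmetric] shift)
  also have "\<dots> = ennreal (exp (l\<^sup>2 * \<sigma>\<^sup>2 / 2)) * (\<integral>\<^sup>+x. ennreal (normal_density (l * \<sigma>\<^sup>2) \<sigma> x) \<partial>lborel)"
    by (rule nn_integral_cmult) simp
  also have "(\<integral>\<^sup>+x. ennreal (normal_density (l * \<sigma>\<^sup>2) \<sigma> x) \<partial>lborel) = 1"
    using \<sigma> by (subst nn_integral_eq_integral) auto
  finally show "(\<integral>\<^sup>+\<omega>. ennreal (exp (l * X \<omega>)) \<partial>M) \<le> ennreal (exp (l\<^sup>2 * \<sigma>\<^sup>2 / 2))"
    by simp
qed

lemma subgaussian_upper_tail:
  assumes X: "subgaussian M v X" and "v > 0" "t \<ge> 0"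
  shows "emeasure M {\<omega>\<in>space M. t \<le> X \<omega>} \<le> ennreal (exp (- t\<^sup>2 / (2 * v)))"
proof -
  have [measurable]: "X \<in> borel_measurable M"
    using X by (rule subgaussian_measurable)
  \<comment> \<open>Chernoff bound; this \<open>l\<close> minimizes the exponent
    \<open>- l * t + l\<^sup>2 * v / 2\<close>.\<close>
  define l where "l = t / v"
  have l: "l \<ge> 0" using assms by (simp add: l_def)
  have *: "1 \<le> ennreal (exp (- l * t)) * ennreal (exp (l * X \<omega>))" if "t \<le> X \<omega>" for \<omega>
  proof -
    have "0 \<le> - l * t + l * X \<omega>"
      using mult_left_mono[OF that l] by simp
    then have "1 \<le> exp (- l * t) * exp (l * X \<omega>)"
      by (simp add: exp_add[symmetric])
    then show ?thesis
      by (metis ennreal_1 ennreal_leI ennreal_mult exp_ge_zero)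
  qed
  have "emeasure M {\<omega>\<in>space M. t \<le> X \<omega>}
      \<le> emeasure M {\<omega>\<in>space M. 1 \<le> ennreal (exp (- l * t)) * ennreal (exp (l * X \<omega>))}"
    using * by (intro emeasure_mono) auto
  also have "\<dots> \<le> ennreal (exp (- l * t)) * (\<integral>\<^sup>+\<omega>. ennreal (exp (l * X \<omega>)) * indicator (space M) \<omega> \<partial>M)"
    by (rule nn_integral_Markov_inequality) auto
  also have "(\<integral>\<^sup>+\<omega>. ennreal (exp (l * X \<omega>)) * indicator (space M) \<omega> \<partial>M) = (\<integral>\<^sup>+\<omega>. ennreal (exp (l * X \<omega>)) \<partial>M)"
    by (intro nn_integral_cong) simp
  also have "ennreal (exp (- l * t)) * \<dots> \<le> ennreal (exp (- l * t)) * ennreal (exp (l\<^sup>2 * v / 2))"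
    using X by (intro mult_left_mono) (auto simp: subgaussian_def)
  also have "\<dots> = ennreal (exp (- l * t + l\<^sup>2 * v / 2))"
    by (simp add: ennreal_mult[symmetric] exp_add[symmetric])
  also have "- l * t + l\<^sup>2 * v / 2 = - t\<^sup>2 / (2 * v)"
    using assms by (simp add: l_def field_simps power2_eq_square)
  finally show ?thesis .
qed

lemma subgaussian_tail:
  assumes X: "subgaussian M v X" and "v > 0" "t \<ge> 0"
  shows "emeasure M {\<omega>\<in>space M. t \<le> \<bar>X \<omega>\<bar>} \<le> ennreal (2 * exp (- t\<^sup>2 / (2 * v)))"
proof -
  have [measurable]: "X \<in> borel_measurable M"
    using X by (rule subgaussian_measurable)
  have X': "subgaussian M v (\<lambda>\<omega>. - X \<omega>)"
    using subgaussian_scale[OF X, of "-1"] by simp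
  have "{\<omega>\<in>space M. t \<le> \<bar>X \<omega>\<bar>} = {\<omega>\<in>space M. t \<le> X \<omega>} \<union> {\<omega>\<in>space M. t \<le> - X \<omega>}"
    by auto
  then have "emeasure M {\<omega>\<in>space M. t \<le> \<bar>X \<omega>\<bar>} \<le>
      emeasure M {\<omega>\<in>space M. t \<le> X \<omega>} + emeasure M {\<omega>\<in>space M. t \<le> - X \<omega>}"
    by (simp add: emeasure_subadditive)
  also have "\<dots> \<le> ennreal (exp (- t\<^sup>2 / (2 * v))) + ennreal (exp (- t\<^sup>2 / (2 * v)))"
    using subgaussian_upper_tail[OF X assms(2,3)] subgaussian_upper_tail[OF X' assms(2,3)]
    by (rule add_mono)
  also have "\<dots> = ennreal (2 * exp (- t\<^sup>2 / (2 * v)))"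
    by (simp flip: ennreal_plus)
  finally show ?thesis .
qed

text \<open>The Wiener integral of the step function with values \<open>c l\<close> against the path
  \<open>x\<close>. As a finite combination of path values it is defined for every path and
  measurable on \<open>path_space\<close>.\<close>

definition step_functional :: "nat \<Rightarrow> (nat \<Rightarrow> real) \<Rightarrow> (real \<Rightarrow> real) \<Rightarrow> real" where
  "step_functional D c x = (\<Sum>l<D. c l * (x (real (Suc l) / real D) - x (real l / real D)))"

text \<open>The increments over the grid are independent with variance 1/D, so the variances add up
  to the squared L2 norm of the step function, as in the Ito isometry.\<close>

lemma subgaussian_step_functional:
  assumes W: "wiener_process M W" and D: "D > 0"
  shows "subgaussian M ((\<Sum>l<D. (c l)\<^sup>2) / real D) (\<lambda>\<omega>. step_functional D c (\<lambda>t. W t \<omega>))"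
proof -
  interpret prob_space M using W by (simp add: wiener_process_def)
  define \<tau> where "\<tau> l = min 1 (real l / real D)" for l
  have \<tau>: "\<tau> l = real l / real D" if "l \<le> D" for l
    using that D by (simp add: \<tau>_def min_def divide_simps)
  have mono: "mono_on {..D} \<tau>" "\<tau> ` {..D} \<subseteq> {0..1}"
    using D by (auto simp: \<tau>_def mono_on_def divide_right_mono min.coboundedI2)
  have "indep_vars (\<lambda>_. borel) (\<lambda>k \<omega>. W (\<tau> (Suc k)) \<omega> - W (\<tau> k) \<omega>) {..<D}"
    using W mono unfolding wiener_process_def by blast
  then have ind: "indep_vars (\<lambda>_. borel) (\<lambda>k \<omega>. c k * (W (\<tau> (Suc k)) \<omega> - W (\<tau> k) \<omega>)) {..<D}"
    by (rule indep_vars_compose2) simp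
  have sub: "subgaussian M ((c k)\<^sup>2 * (1 / real D)) (\<lambda>\<omega>. c k * (W (\<tau> (Suc k)) \<omega> - W (\<tau> k) \<omega>))"
    if "k \<in> {..<D}" for k
  proof (rule subgaussian_scale)
    have "0 \<le> \<tau> k" "\<tau> k < \<tau> (Suc k)" "\<tau> (Suc k) \<le> 1"
      using that D by (auto simp: \<tau> divide_simps)
    then have "distributed M lborel (\<lambda>\<omega>. W (\<tau> (Suc k)) \<omega> - W (\<tau> k) \<omega>)
        (normal_density 0 (sqrt (\<tau> (Suc k) - \<tau> k)))"
      using W unfolding wiener_process_def by blast
    moreover have "\<tau> (Suc k) - \<tau> k = 1 / real D"
      using that D by (simp add: \<tau> field_simps)
    ultimately show "subgaussian M (1 / real D) (\<lambda>\<omega>. W (\<tau> (Suc k)) \<omega> - W (\<tau> k) \<omega>)"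
      using subgaussian_normal[of M "\<lambda>\<omega>. W (\<tau> (Suc k)) \<omega> - W (\<tau> k) \<omega>" "sqrt (1 / real D)"] D
      by simp
  qed
  have "(\<lambda>\<omega>. step_functional D c (\<lambda>t. W t \<omega>)) =
      (\<lambda>\<omega>. \<Sum>k<D. c k * (W (\<tau> (Suc k)) \<omega> - W (\<tau> k) \<omega>))"
    by (intro ext) (auto simp: step_functional_def \<tau> intro!: sum.cong)
  moreover have "(\<Sum>l<D. (c l)\<^sup>2) / real D = (\<Sum>l<D. (c l)\<^sup>2 * (1 / real D))"
    by (simp add: sum_divide_distrib)
  ultimately show ?thesis
    using subgaussian_sum[OF _ ind sub] by simp
qed

lemma step_functional_measurable:
  assumes "D > 0"
  shows "step_functional D c \<in> borel_measurable path_space"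
proof -
  have "(\<lambda>x. x t) \<in> borel_measurable path_space" if "t \<in> {0..1}" for t
    unfolding path_space_def using that by measurable
  then show ?thesis
    unfolding step_functional_def using assms
    by (intro borel_measurable_sum borel_measurable_times borel_measurable_diff borel_measurable_const)
       (auto simp: divide_simps)
qed

lemma step_functional_restrict:
  assumes "D > 0"
  shows "step_functional D c (\<lambda>t\<in>{0..1}. x t) = step_functional D c x"
  unfolding step_functional_def using assms by (intro sum.cong) (auto simp: divide_simps)

lemma step_functional_linear:
  "step_functional D c (\<lambda>t. x t + a * y t) = step_functional D c x + a * step_functional D c y"
  unfolding step_functional_def by (simp add: sum.distrib sum_distrib_left algebra_simps sum_subtractf)

text \<open>The gain from distribution: the factor 1/m cancels the factor m in the local noise
  variance m/n. Independence is assumed for the paths restricted to [0,1]; it passes to the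
  functionals because these read the path only at times in [0,1].\<close>

lemma subgaussian_average:
  assumes iw: "independent_wiener M m W" and "m > 0" "D > 0"
  shows "subgaussian M ((\<Sum>l<D. (c l)\<^sup>2) / real D / real m)
     (\<lambda>\<omega>. (\<Sum>i\<in>{1..m}. step_functional D c (\<lambda>t. W i t \<omega>)) / real m)"
proof -
  interpret prob_space M using iw by (simp add: independent_wiener_def)
  let ?v = "(\<Sum>l<D. (c l)\<^sup>2) / real D"
  have "indep_vars (\<lambda>_. path_space) (\<lambda>i \<omega>. \<lambda>t\<in>{0..1}. W i t \<omega>) {1..m}"
    using iw by (simp add: independent_wiener_def)
  then have "indep_vars (\<lambda>_. borel) (\<lambda>i \<omega>. step_functional D c (\<lambda>t\<in>{0..1}. W i t \<omega>)) {1..m}"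
    by (rule indep_vars_compose2) (rule step_functional_measurable[OF assms(3)])
  then have ind: "indep_vars (\<lambda>_. borel) (\<lambda>i \<omega>. step_functional D c (\<lambda>t. W i t \<omega>)) {1..m}"
    by (simp add: step_functional_restrict assms)
  have "subgaussian M (\<Sum>i\<in>{1..m}. ?v) (\<lambda>\<omega>. \<Sum>i\<in>{1..m}. step_functional D c (\<lambda>t. W i t \<omega>))"
    using iw by (intro subgaussian_sum ind subgaussian_step_functional assms)
      (auto simp: independent_wiener_def)
  from subgaussian_scale[OF this, of "1 / real m"] show ?thesis
    using assms(2) by (simp add: power2_eq_square field_simps)
qed

section \<open>Approximation by step functions\<close>

abbreviation unit_lebesgue :: "real measure" where
  "unit_lebesgue \<equiv> lebesgue_on {0..1}"

interpretation unit_lebesgue: prob_space unit_lebesgue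
  by (rule prob_spaceI) (simp add: emeasure_restrict_space)

lemma unit_lebesgue_prob [simp]: "measure unit_lebesgue {0..1} = 1"
  using unit_lebesgue.prob_space by simp

lemma L2_unit_integrable:
  assumes "f \<in> L2_unit"
  shows "integrable unit_lebesgue f"
proof (rule Bochner_Integration.integrable_bound)
  show "integrable unit_lebesgue (\<lambda>x. 1 + (f x)\<^sup>2)"
    using assms by (auto simp: L2_unit_def)
  show "f \<in> borel_measurable unit_lebesgue"
    using assms by (simp add: L2_unit_def)
  have "\<bar>y\<bar> \<le> 1 + y\<^sup>2" for y :: real
    using zero_le_power2[of "\<bar>y\<bar> - 1"] by (simp add: power2_eq_square algebra_simps)
  then show "AE x in unit_lebesgue. norm (f x) \<le> norm (1 + (f x)\<^sup>2)"
    by (auto simp: add_nonneg_nonneg)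
qed

lemma integrable_unit_bounded:
  fixes f :: "real \<Rightarrow> real"
  assumes "f \<in> borel_measurable unit_lebesgue" "\<And>x. x \<in> {0..1} \<Longrightarrow> \<bar>f x\<bar> \<le> B"
  shows "integrable unit_lebesgue f"
  using assms by (intro unit_lebesgue.integrable_const_bound[of _ B]) auto

text \<open>Left-open cells, matching the increments in \<open>step_functional\<close>. The point 0
  lies in no cell and gets the value 0; as a null set it has to be treated separately or discarded
  below.\<close>

definition step_fun :: "nat \<Rightarrow> (nat \<Rightarrow> real) \<Rightarrow> real \<Rightarrow> real" where
  "step_fun D c x = (\<Sum>l<D. c l * indicator {real l / real D<..real (Suc l) / real D} x)"

lemma step_cell:
  assumes "D > 0" "0 < x" "x \<le> 1"
  obtains l where "l < D" "real l / real D < x" "x \<le> real (Suc l) / real D"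
proof -
  define k where "k = nat \<lceil>x * real D\<rceil>"
  have "x * real D > 0" using assms by simp
  then have k: "real k - 1 < x * real D" "x * real D \<le> real k" "k > 0"
    unfolding k_def by linarith+
  have "x * real D \<le> 1 * real D" using assms(3) by (rule mult_right_mono) simp
  then have "k \<le> D" unfolding k_def by (simp add: ceiling_le_iff nat_le_iff)
  then have "k - 1 < D" using k(3) by simp
  moreover have "real (k - 1) / real D < x"
    using k assms(1) by (simp add: pos_divide_less_eq of_nat_diff)
  moreover have "x \<le> real (Suc (k - 1)) / real D"
    using k assms(1) by (simp add: pos_le_divide_eq)
  ultimately show ?thesis by (rule that)
qed

lemma step_cell_unique:
  assumes "D > 0" "real l / real D < x" "x \<le> real (Suc l) / real D"
    "real k / real D < x" "x \<le> real (Suc k) / real D"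
  shows "k = l"
proof -
  have "real l < real (Suc k)" "real k < real (Suc l)"
    using assms less_le_trans[OF assms(2) assms(5)] less_le_trans[OF assms(4) assms(3)]
    by (simp_all only: divide_less_cancel)
  then show ?thesis by linarith
qed

lemma step_fun_cell:
  assumes "D > 0" "l < D" "real l / real D < x" "x \<le> real (Suc l) / real D"
  shows "step_fun D c x = c l"
proof -
  have "step_fun D c x = (\<Sum>k<D. if k = l then c k else 0)"
    unfolding step_fun_def
  proof (intro sum.cong refl)
    fix k
    have "x \<in> {real k / real D<..real (Suc k) / real D} \<longleftrightarrow> k = l"
      using assms(3,4) step_cell_unique[OF assms(1,3,4), of k]
      unfolding greaterThanAtMost_iff by blast
    then show "c k * indicator {real k / real D<..real (Suc k) / real D} x = (if k = l then c k else 0)"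
      by (simp only: indicator_def split: if_split) simp
  qed
  also have "\<dots> = c l" using assms(2) by simp
  finally show ?thesis .
qed

lemma step_fun_zero: "step_fun D c 0 = 0"
  unfolding step_fun_def
proof (rule sum.neutral, rule ballI)
  fix l
  have "\<not> real l / real D < 0" by (simp add: not_less)
  then show "c l * indicator {real l / real D<..real (Suc l) / real D} 0 = 0" by simp
qed

lemma borel_measurable_step_fun [measurable]: "step_fun D c \<in> borel_measurable borel"
  unfolding step_fun_def by measurable

lemma borel_unit_measurable:
  assumes "f \<in> borel_measurable borel"
  shows "f \<in> borel_measurable unit_lebesgue"
  using assms by (intro measurable_restrict_space1 measurable_completion) simp

lemma step_fun_unit_measurable: "step_fun D c \<in> borel_measurable unit_lebesgue"
  by (rule borel_unit_measurable) measurable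

lemma square_bound: "\<bar>y\<bar> \<le> K \<Longrightarrow> \<bar>y\<^sup>2\<bar> \<le> K\<^sup>2" for y K :: real
  by (metis abs_ge_zero abs_power2 power2_abs power_mono)

text \<open>A measurable function is an almost everywhere limit of continuous ones. Clipping these
  to [-B, B] does not disturb the limit, because \<psi> itself is bounded by B, and it supplies the
  constant that dominates in the convergence theorem.\<close>

lemma continuous_L2_approx:
  assumes meas: "\<psi> \<in> borel_measurable unit_lebesgue"
    and bd: "\<And>x. x \<in> {0..1} \<Longrightarrow> \<bar>\<psi> x\<bar> \<le> B" and "\<eta> > 0"
  obtains h :: "real \<Rightarrow> real" where "continuous_on UNIV h" "\<And>x. \<bar>h x\<bar> \<le> B"
    "(LINT x|unit_lebesgue. (h x - \<psi> x)\<^sup>2) < \<eta>"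
proof -
  have B: "B \<ge> 0" using bd[of 0] by simp
  define u where "u x = (if x \<in> {0..1} then \<psi> x else 0)" for x
  have u: "u \<in> borel_measurable lebesgue"
  proof -
    have "(\<lambda>x. indicator {0..1} x *\<^sub>R \<psi> x) \<in> borel_measurable lebesgue"
      using meas by (subst borel_measurable_restrict_space_iff[symmetric]) auto
    moreover have "(\<lambda>x. indicator {0..1} x *\<^sub>R \<psi> x) = u"
      by (auto simp: u_def indicator_def)
    ultimately show ?thesis by simp
  qed
  then have "u measurable_on UNIV"
    by (rule lebesgue_measurable_imp_measurable_on) simp
  then obtain Nn g where N: "negligible Nn" and g: "\<And>n::nat. continuous_on UNIV (g n)"
    and lim: "\<And>x. x \<notin> Nn \<Longrightarrow> (\<lambda>n. g n x) \<longlonglongrightarrow> u x"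
    unfolding measurable_on_def by auto
  define h where "h n x = max (- B) (min B (g n x))" for n x
  have hc: "continuous_on UNIV (h n)" for n
    unfolding h_def by (intro continuous_intros g)
  have hb: "\<bar>h n x\<bar> \<le> B" for n x
    using B by (auto simp: h_def)
  have hlim: "(\<lambda>n. h n x) \<longlonglongrightarrow> u x" if "x \<notin> Nn" for x
  proof -
    have "(\<lambda>n. h n x) \<longlonglongrightarrow> max (- B) (min B (u x))"
      unfolding h_def by (intro tendsto_intros lim that)
    moreover have "max (- B) (min B (u x)) = u x"
      using bd[of x] B by (auto simp: u_def abs_le_iff)
    ultimately show ?thesis by simp
  qed
  have hm: "h n \<in> borel_measurable unit_lebesgue" for n
    by (intro borel_unit_measurable borel_measurable_continuous_onI hc)
  have "(\<lambda>n. LINT x|unit_lebesgue. (h n x - \<psi> x)\<^sup>2) \<longlonglongrightarrow> (LINT x|unit_lebesgue. 0)"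
  proof (rule integral_dominated_convergence[where w = "\<lambda>_. (2 * B)\<^sup>2"])
    show "(\<lambda>x. (h n x - \<psi> x)\<^sup>2) \<in> borel_measurable unit_lebesgue" for n
      using hm meas by measurable
    have "AE x in lebesgue. x \<notin> Nn"
      using N by (simp add: AE_not_in negligible_iff_null_sets)
    then have "AE x in unit_lebesgue. x \<notin> Nn \<and> x \<in> {0..1}"
      by (subst AE_restrict_space_iff) auto
    then show "AE x in unit_lebesgue. (\<lambda>n. (h n x - \<psi> x)\<^sup>2) \<longlonglongrightarrow> 0"
    proof eventually_elim
      case (elim x)
      have "(\<lambda>n. (h n x - \<psi> x)\<^sup>2) \<longlonglongrightarrow> (u x - \<psi> x)\<^sup>2"
        using elim by (intro tendsto_intros hlim) auto
      then show ?case using elim by (simp add: u_def)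
    qed
    show "AE x in unit_lebesgue. norm ((h n x - \<psi> x)\<^sup>2) \<le> (2 * B)\<^sup>2" for n
    proof (intro AE_I2)
      fix x assume "x \<in> space unit_lebesgue"
      then have "\<bar>h n x - \<psi> x\<bar> \<le> 2 * B"
        using hb[of n x] bd[of x] by (auto simp: abs_le_iff)
      then show "norm ((h n x - \<psi> x)\<^sup>2) \<le> (2 * B)\<^sup>2"
        unfolding real_norm_def by (rule square_bound)
    qed
  qed auto
  then have "\<forall>\<^sub>F n in sequentially. (LINT x|unit_lebesgue. (h n x - \<psi> x)\<^sup>2) < \<eta>"
    using assms(3) by (intro order_tendstoD(2)[of _ 0]) simp_all
  then obtain n where "(LINT x|unit_lebesgue. (h n x - \<psi> x)\<^sup>2) < \<eta>"
    by (auto simp: eventually_sequentially)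
  then show thesis using that[OF hc hb] by blast
qed

lemma step_L2_approx:
  assumes meas: "\<psi> \<in> borel_measurable unit_lebesgue"
    and bd: "\<And>x. x \<in> {0..1} \<Longrightarrow> \<bar>\<psi> x\<bar> \<le> B" and \<eta>: "\<eta> > 0"
  obtains D c where "D > 0" "\<And>x. x \<in> {0..1} \<Longrightarrow> \<bar>step_fun D c x\<bar> \<le> B"
    "(LINT x|unit_lebesgue. (step_fun D c x - \<psi> x)\<^sup>2) \<le> \<eta>"
proof -
  have B: "B \<ge> 0" using bd[of 0] by simp
  \<comment> \<open>Error budget: (a - b)^2 <= 2 (a - r)^2 + 2 (r - b)^2 with r = h x. The
    continuous approximation contributes 2 * \<eta>/4, and the step function, uniformly within sqrt
    \<eta> / 2 of h, contributes 2 * \<eta>/4.\<close>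
  obtain h where hc: "continuous_on UNIV h" and hb: "\<And>x. \<bar>h x\<bar> \<le> B"
    and hi: "(LINT x|unit_lebesgue. (h x - \<psi> x)\<^sup>2) < \<eta> / 4"
    using continuous_L2_approx[OF meas bd, of "\<eta> / 4"] \<eta> by auto
  have hm: "h \<in> borel_measurable unit_lebesgue"
    by (intro borel_unit_measurable borel_measurable_continuous_onI hc)
  have "uniformly_continuous_on {0..1} h"
    by (intro compact_uniformly_continuous continuous_on_subset[OF hc]) auto
  moreover have "sqrt \<eta> / 2 > 0" using \<eta> by simp
  ultimately obtain d where d: "d > 0"
    "\<And>x y. x \<in> {0..1} \<Longrightarrow> y \<in> {0..1} \<Longrightarrow> dist y x < d \<Longrightarrow> dist (h y) (h x) < sqrt \<eta> / 2"
    unfolding uniformly_continuous_on_def by meson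
  obtain D where D: "inverse (real (Suc D)) < d" using reals_Archimedean[OF d(1)] by blast
  define E where "E = Suc D"
  define c where "c l = h (real l / real E)" for l
  have E: "E > 0" "1 / real E < d" using D by (auto simp: E_def field_simps)
  have close: "\<bar>step_fun E c x - h x\<bar> \<le> sqrt \<eta> / 2" "\<bar>step_fun E c x\<bar> \<le> B" if x01: "0 < x" "x \<le> 1" for x
  proof -
    obtain l where l: "l < E" "real l / real E < x" "x \<le> real (Suc l) / real E"
      using step_cell[OF E(1) x01] by blast
    have "dist (real l / real E) x < d"
      using l E by (simp add: dist_real_def abs_less_iff add_divide_distrib)
    then have "dist (h (real l / real E)) (h x) < sqrt \<eta> / 2"
      using x01 l by (intro d(2)) auto
    then show "\<bar>step_fun E c x - h x\<bar> \<le> sqrt \<eta> / 2" "\<bar>step_fun E c x\<bar> \<le> B"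
      using step_fun_cell[OF E(1) l, of c] hb by (auto simp: c_def dist_real_def)
  qed
  have stb: "\<bar>step_fun E c x\<bar> \<le> B" if "x \<in> {0..1}" for x
    using close(2)[of x] that B step_fun_zero[of E c] by (cases "x = 0") auto
  have ae: "AE x in unit_lebesgue. 0 < x \<and> x \<le> 1"
  proof -
    have "AE x in lebesgue. x \<noteq> (0::real)"
      by (rule AE_I'[of "{0}"]) (auto simp: negligible_iff_null_sets[symmetric])
    then show ?thesis by (subst AE_restrict_space_iff) auto
  qed
  note stm = step_fun_unit_measurable[of E c]
  have int1: "integrable unit_lebesgue (\<lambda>x. (step_fun E c x - \<psi> x)\<^sup>2)"
  proof (rule integrable_unit_bounded[where B = "(2 * B)\<^sup>2"])
    fix x :: real assume "x \<in> {0..1}"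
    then have "\<bar>step_fun E c x - \<psi> x\<bar> \<le> 2 * B"
      using stb[of x] bd[of x] by linarith
    then show "\<bar>(step_fun E c x - \<psi> x)\<^sup>2\<bar> \<le> (2 * B)\<^sup>2"
      by (rule square_bound)
  qed (use stm meas in measurable)
  have int2: "integrable unit_lebesgue (\<lambda>x. (h x - \<psi> x)\<^sup>2)"
  proof (rule integrable_unit_bounded[where B = "(2 * B)\<^sup>2"])
    fix x :: real assume "x \<in> {0..1}"
    then have "\<bar>h x - \<psi> x\<bar> \<le> 2 * B"
      using hb[of x] bd[of x] by linarith
    then show "\<bar>(h x - \<psi> x)\<^sup>2\<bar> \<le> (2 * B)\<^sup>2"
      by (rule square_bound)
  qed (use hm meas in measurable)
  have "(LINT x|unit_lebesgue. (step_fun E c x - \<psi> x)\<^sup>2) \<le> (LINT x|unit_lebesgue. \<eta> / 2 + 2 * (h x - \<psi> x)\<^sup>2)"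
  proof (rule integral_mono_AE)
    show "AE x in unit_lebesgue. (step_fun E c x - \<psi> x)\<^sup>2 \<le> \<eta> / 2 + 2 * (h x - \<psi> x)\<^sup>2"
      using ae
    proof eventually_elim
      case (elim x)
      have "(step_fun E c x - h x)\<^sup>2 \<le> (sqrt \<eta> / 2)\<^sup>2"
        using square_bound[OF close(1)[of x]] elim by simp
      then have 1: "(step_fun E c x - h x)\<^sup>2 \<le> \<eta> / 4"
        using \<eta> by (simp add: power_divide)
      have "(a - b)\<^sup>2 \<le> 2 * (a - r)\<^sup>2 + 2 * (r - b)\<^sup>2" for a b r :: real
        using zero_le_power2[of "a - r - (r - b)"] by (simp add: power2_eq_square algebra_simps)
      from this[of "step_fun E c x" "\<psi> x" "h x"] 1 show ?case by linarith
    qed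
  qed (use int1 int2 in auto)
  also have "\<dots> = \<eta> / 2 + 2 * (LINT x|unit_lebesgue. (h x - \<psi> x)\<^sup>2)"
    using int2 by simp
  also have "\<dots> \<le> \<eta>" using hi by simp
  finally show thesis using that[OF E(1) stb] by blast
qed

section \<open>Drift of the observation: increments of a primitive as L2 pairings\<close>

lemma primitive_increment:
  fixes f :: "real \<Rightarrow> real"
  assumes "integrable unit_lebesgue f" "0 \<le> a" "a \<le> b" "b \<le> 1"
  shows "(LINT x|lebesgue_on {0..b}. f x) - (LINT x|lebesgue_on {0..a}. f x) =
    (LINT x|unit_lebesgue. f x * indicator {a<..b} x)"
proof -
  have int: "integrable lebesgue (\<lambda>x. indicator {0..1} x * f x)"
    using assms(1) integrable_restrict_space[of "{0..1}" lebesgue f] by simp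
  have sub: "integrable lebesgue (\<lambda>x. indicator {0..t} x * f x)" if "t \<le> 1" for t
  proof -
    have "integrable lebesgue (\<lambda>x. indicator {0..t} x *\<^sub>R (indicator {0..1} x * f x))"
      by (rule integrable_mult_indicator[OF _ int]) auto
    moreover have "(\<lambda>x. indicator {0..t} x *\<^sub>R (indicator {0..1} x * f x)) = (\<lambda>x. indicator {0..t} x * f x)"
      using that by (auto simp: indicator_def fun_eq_iff)
    ultimately show ?thesis by simp
  qed
  have "(LINT x|lebesgue_on {0..b}. f x) - (LINT x|lebesgue_on {0..a}. f x) =
     (LINT x|lebesgue. indicator {0..b} x * f x) - (LINT x|lebesgue. indicator {0..a} x * f x)"
    by (simp add: integral_restrict_space)
  also have "\<dots> = (LINT x|lebesgue. indicator {0..b} x * f x - indicator {0..a} x * f x)"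
    using assms by (subst Bochner_Integration.integral_diff) (auto intro: sub)
  also have "\<dots> = (LINT x|lebesgue. indicator {0..1} x * (f x * indicator {a<..b} x))"
    using assms by (intro Bochner_Integration.integral_cong) (auto simp: indicator_def)
  also have "\<dots> = (LINT x|unit_lebesgue. f x * indicator {a<..b} x)"
    by (simp add: integral_restrict_space)
  finally show ?thesis .
qed

lemma step_functional_primitive:
  assumes f: "integrable unit_lebesgue f" and D: "D > 0"
  shows "step_functional D c (\<lambda>t. LINT x|lebesgue_on {0..t}. f x) = L2_inner f (step_fun D c)"
proof -
  have "step_functional D c (\<lambda>t. LINT x|lebesgue_on {0..t}. f x) =
    (\<Sum>l<D. c l * (LINT x|unit_lebesgue. f x * indicator {real l / real D<..real (Suc l) / real D} x))"
    unfolding step_functional_def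
  proof (intro sum.cong refl)
    fix l assume "l \<in> {..<D}"
    then have "real l / real D \<le> real (Suc l) / real D" "real (Suc l) / real D \<le> 1"
      using D by (auto simp: divide_right_mono pos_divide_le_eq simp del: of_nat_Suc)
    then show "c l * ((LINT x|lebesgue_on {0..real (Suc l) / real D}. f x) - (LINT x|lebesgue_on {0..real l / real D}. f x)) =
      c l * (LINT x|unit_lebesgue. f x * indicator {real l / real D<..real (Suc l) / real D} x)"
      by (subst primitive_increment[OF f]) auto
  qed
  also have "\<dots> = (LINT x|unit_lebesgue. (\<Sum>l<D. c l * (f x * indicator {real l / real D<..real (Suc l) / real D} x)))"
  proof -
    have "integrable unit_lebesgue (\<lambda>x. f x * indicator {a<..b} x)" for a b
    proof -
      have "{a<..b} \<inter> {0..1} \<in> sets unit_lebesgue"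
        by (intro sets_restrict_space_iff[THEN iffD2]) auto
      then have "integrable unit_lebesgue (\<lambda>x. f x * indicator ({a<..b} \<inter> {0..1}) x)"
        by (rule integrable_real_mult_indicator[OF _ f])
      moreover have "integrable unit_lebesgue (\<lambda>x. f x * indicator ({a<..b} \<inter> {0..1}) x) =
          integrable unit_lebesgue (\<lambda>x. f x * indicator {a<..b} x)"
        by (intro Bochner_Integration.integrable_cong refl) (simp add: indicator_def)
      ultimately show ?thesis by simp
    qed
    then show ?thesis by (subst Bochner_Integration.integral_sum) auto
  qed
  also have "\<dots> = L2_inner f (step_fun D c)"
    unfolding L2_inner_def step_fun_def
    by (intro Bochner_Integration.integral_cong refl)
      (subst sum_distrib_left, intro sum.cong refl mult.left_commute)
  finally show ?thesis .
qed

text \<open>The cells are disjoint, so squaring a step function squares its coefficients; pairing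
  the result with the constant 1 through \<open>step_functional_primitive\<close> evaluates the
  integral. The value is the variance in \<open>subgaussian_step_functional\<close>.\<close>

lemma step_fun_L2_norm:
  assumes D: "D > 0"
  shows "(LINT x|unit_lebesgue. (step_fun D c x)\<^sup>2) = (\<Sum>l<D. (c l)\<^sup>2) / real D"
proof -
  have "(LINT x|unit_lebesgue. (step_fun D c x)\<^sup>2) = (LINT x|unit_lebesgue. 1 * step_fun D (\<lambda>l. (c l)\<^sup>2) x)"
  proof (intro Bochner_Integration.integral_cong refl)
    fix x assume "x \<in> space unit_lebesgue"
    then consider "x = 0" | "0 < x" "x \<le> 1" by force
    then show "(step_fun D c x)\<^sup>2 = 1 * step_fun D (\<lambda>l. (c l)\<^sup>2) x"
    proof cases
      case 1
      then show ?thesis by (simp add: step_fun_zero)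
    next
      case 2
      then show ?thesis using step_cell[OF D 2] step_fun_cell[OF D] by (metis mult_1)
    qed
  qed
  also have "\<dots> = step_functional D (\<lambda>l. (c l)\<^sup>2) (\<lambda>t. LINT x|lebesgue_on {0..t}. 1)"
    using D by (subst step_functional_primitive) (auto simp: L2_inner_def)
  also have "\<dots> = (\<Sum>l<D. (c l)\<^sup>2 * (1 / real D))"
    unfolding step_functional_def
    by (intro sum.cong refl) (simp add: measure_restrict_space field_simps)
  finally show ?thesis by (simp add: sum_divide_distrib)
qed

text \<open>The bias is at most the sup norm of f times the L1 distance between step function and
  wavelet. Therefore one pair D, c, chosen before f, serves all bounded f. The variance bound 4
  comes from a^2 <= 2 b^2 + 2 (a - b)^2 with a unit vector b and an L2 error of at most 1.\<close>

lemma step_functional_approx: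
  assumes meas: "\<psi> \<in> borel_measurable unit_lebesgue"
    and bd: "\<And>x. x \<in> {0..1} \<Longrightarrow> \<bar>\<psi> x\<bar> \<le> B" and norm: "L2_inner \<psi> \<psi> = 1"
    and \<eta>: "0 < \<eta>" "\<eta> \<le> 1"
  obtains D c where "D > 0" "(\<Sum>l<D. (c l)\<^sup>2) / real D \<le> 4"
    "\<And>f K. f \<in> L2_unit \<Longrightarrow> AE x in unit_lebesgue. \<bar>f x\<bar> \<le> K \<Longrightarrow>
       \<bar>step_functional D c (\<lambda>t. LINT x|lebesgue_on {0..t}. f x) - L2_inner f \<psi>\<bar> \<le> K * \<eta>"
proof -
  obtain D c where D: "D > 0" and sb: "\<And>x. x \<in> {0..1} \<Longrightarrow> \<bar>step_fun D c x\<bar> \<le> B"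
    and L2: "(LINT x|unit_lebesgue. (step_fun D c x - \<psi> x)\<^sup>2) \<le> \<eta>\<^sup>2"
    using step_L2_approx[OF meas bd, of "\<eta>\<^sup>2"] \<eta> by auto
  have B: "B \<ge> 0" using bd[of 0] by simp
  note sm = step_fun_unit_measurable[of D c]
  have i1: "integrable unit_lebesgue (\<lambda>x. (\<psi> x)\<^sup>2)"
    using meas by (intro integrable_unit_bounded[where B = "B\<^sup>2"] square_bound bd) auto
  have i2: "integrable unit_lebesgue (\<lambda>x. (step_fun D c x)\<^sup>2)"
    using sm by (intro integrable_unit_bounded[where B = "B\<^sup>2"] square_bound sb) auto
  have db: "\<bar>step_fun D c x - \<psi> x\<bar> \<le> 2 * B" if "x \<in> {0..1}" for x
    using sb[OF that] bd[OF that] by linarith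
  have i3: "integrable unit_lebesgue (\<lambda>x. (step_fun D c x - \<psi> x)\<^sup>2)"
    using sm meas by (intro integrable_unit_bounded[where B = "(2*B)\<^sup>2"] square_bound db) auto
  have i4: "integrable unit_lebesgue (\<lambda>x. \<bar>step_fun D c x - \<psi> x\<bar>)"
    using sm meas db by (intro integrable_unit_bounded[where B = "2*B"]) auto
  have "(\<Sum>l<D. (c l)\<^sup>2) / real D = (LINT x|unit_lebesgue. (step_fun D c x)\<^sup>2)"
    by (simp add: step_fun_L2_norm[OF D])
  also have "\<dots> \<le> (LINT x|unit_lebesgue. 2 * (\<psi> x)\<^sup>2 + 2 * (step_fun D c x - \<psi> x)\<^sup>2)"
  proof (rule integral_mono)
    have "a\<^sup>2 \<le> 2 * b\<^sup>2 + 2 * (a - b)\<^sup>2" for a b :: real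
      using zero_le_power2[of "a - b - b"] by (simp add: power2_eq_square algebra_simps)
    then show "(step_fun D c x)\<^sup>2 \<le> 2 * (\<psi> x)\<^sup>2 + 2 * (step_fun D c x - \<psi> x)\<^sup>2" for x .
  qed (use i1 i2 i3 in auto)
  also have "\<dots> = 2 * L2_inner \<psi> \<psi> + 2 * (LINT x|unit_lebesgue. (step_fun D c x - \<psi> x)\<^sup>2)"
    using i1 i3 by (simp add: L2_inner_def power2_eq_square)
  also have "\<dots> \<le> 2 + 2 * \<eta>\<^sup>2" using L2 norm by simp
  also have "\<dots> \<le> 4" using \<eta> by (simp add: power_le_one)
  finally have var: "(\<Sum>l<D. (c l)\<^sup>2) / real D \<le> 4" .
  \<comment> \<open>The pointwise inequality |a| <= a^2 / (2 \<eta>) + \<eta>/2 takes the place of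
    Cauchy-Schwarz; with squared L2 error \<eta>^2 it yields exactly \<eta>.\<close>
  have "(LINT x|unit_lebesgue. \<bar>step_fun D c x - \<psi> x\<bar>) \<le>
      (LINT x|unit_lebesgue. (step_fun D c x - \<psi> x)\<^sup>2 / (2 * \<eta>) + \<eta> / 2)"
  proof (rule integral_mono)
    have "\<bar>a\<bar> \<le> a\<^sup>2 / (2 * \<eta>) + \<eta> / 2" for a :: real
      using zero_le_power2[of "\<bar>a\<bar> - \<eta>"] \<eta> by (simp add: power2_eq_square field_simps)
    then show "\<bar>step_fun D c x - \<psi> x\<bar> \<le> (step_fun D c x - \<psi> x)\<^sup>2 / (2 * \<eta>) + \<eta> / 2" for x .
  qed (use i3 i4 in auto)
  also have "\<dots> = (LINT x|unit_lebesgue. (step_fun D c x - \<psi> x)\<^sup>2) / (2 * \<eta>) + \<eta> / 2"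
    using i3 by simp
  also have "\<dots> \<le> \<eta>\<^sup>2 / (2 * \<eta>) + \<eta> / 2"
    using L2 \<eta> by (intro add_right_mono divide_right_mono) auto
  also have "\<dots> = \<eta>" using \<eta> by (simp add: power2_eq_square)
  finally have L1: "(LINT x|unit_lebesgue. \<bar>step_fun D c x - \<psi> x\<bar>) \<le> \<eta>" .
  have "\<bar>step_functional D c (\<lambda>t. LINT x|lebesgue_on {0..t}. f x) - L2_inner f \<psi>\<bar> \<le> K * \<eta>"
    if f: "f \<in> L2_unit" and K: "AE x in unit_lebesgue. \<bar>f x\<bar> \<le> K" for f K
  proof -
    have fi: "integrable unit_lebesgue f" by (rule L2_unit_integrable[OF f])
    have fm: "f \<in> borel_measurable unit_lebesgue" using f by (simp add: L2_unit_def)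
    have K0: "K \<ge> 0"
    proof (rule ccontr)
      assume "\<not> K \<ge> 0"
      then have "AE x in unit_lebesgue. False"
        by (intro eventually_mono[OF K]) linarith
      then show False by (simp only: unit_lebesgue.AE_False)
    qed
    have p: "integrable unit_lebesgue (\<lambda>x. f x * g x)"
      if "g \<in> borel_measurable unit_lebesgue" "\<And>x. x \<in> {0..1} \<Longrightarrow> \<bar>g x\<bar> \<le> B'" for g :: "real \<Rightarrow> real" and B'
    proof (rule unit_lebesgue.integrable_const_bound[where B = "K * B'"])
      have "AE x in unit_lebesgue. x \<in> {0..1}" by (rule AE_I2) simp
      with K show "AE x in unit_lebesgue. norm (f x * g x) \<le> K * B'"
      proof eventually_elim
        case (elim x)
        then show ?case using that(2)[of x] K0 by (auto simp: abs_mult intro!: mult_mono)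
      qed
    qed (use fm that in measurable)
    have p1: "integrable unit_lebesgue (\<lambda>x. f x * step_fun D c x)"
      by (rule p[OF sm]) (rule sb)
    have p2: "integrable unit_lebesgue (\<lambda>x. f x * \<psi> x)"
      by (rule p[OF meas]) (rule bd)
    have "step_functional D c (\<lambda>t. LINT x|lebesgue_on {0..t}. f x) - L2_inner f \<psi>
      = (LINT x|unit_lebesgue. f x * step_fun D c x - f x * \<psi> x)"
      unfolding step_functional_primitive[OF fi D] L2_inner_def
      by (rule Bochner_Integration.integral_diff[symmetric, OF p1 p2])
    also have "\<bar>\<dots>\<bar> \<le> (LINT x|unit_lebesgue. \<bar>f x * step_fun D c x - f x * \<psi> x\<bar>)"
      by (rule integral_abs_bound)
    also have "\<dots> \<le> (LINT x|unit_lebesgue. K * \<bar>step_fun D c x - \<psi> x\<bar>)"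
    proof (rule integral_mono_AE)
      show "integrable unit_lebesgue (\<lambda>x. \<bar>f x * step_fun D c x - f x * \<psi> x\<bar>)"
        using p1 p2 by auto
      show "AE x in unit_lebesgue. \<bar>f x * step_fun D c x - f x * \<psi> x\<bar> \<le> K * \<bar>step_fun D c x - \<psi> x\<bar>"
        using K by eventually_elim (simp add: right_diff_distrib[symmetric] abs_mult mult_right_mono)
    qed (use i4 in auto)
    also have "\<dots> \<le> K * \<eta>" using L1 K0 by (simp add: mult_left_mono)
    finally show ?thesis .
  qed
  then show thesis using that[OF D var] by blast
qed

section \<open>Wavelet series\<close>

lemma finite_wavelet_index [simp]: "finite (wavelet_index j)"
  by (simp add: wavelet_index_def)

lemma wavelet_index_nonempty [simp]: "wavelet_index j \<noteq> {}"
  by (simp add: wavelet_index_def)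

section \<open>Pairings with bounded functions\<close>

lemma L2_inner_bounded_integrable:
  assumes "f \<in> L2_unit" "g \<in> borel_measurable unit_lebesgue" "\<And>x. x \<in> {0..1} \<Longrightarrow> \<bar>g x\<bar> \<le> B"
  shows "integrable unit_lebesgue (\<lambda>x. f x * g x)"
proof (rule Bochner_Integration.integrable_bound)
  show "integrable unit_lebesgue (\<lambda>x. f x * B)"
    using L2_unit_integrable[OF assms(1)] by simp
  show "(\<lambda>x. f x * g x) \<in> borel_measurable unit_lebesgue"
    using assms(1,2) by (auto simp: L2_unit_def)
  show "AE x in unit_lebesgue. norm (f x * g x) \<le> norm (f x * B)"
  proof (intro AE_I2)
    fix x assume "x \<in> space unit_lebesgue"
    then have "\<bar>g x\<bar> \<le> \<bar>B\<bar>" using assms(3)[of x] by fastforce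
    then show "norm (f x * g x) \<le> norm (f x * B)"
      by (simp add: abs_mult mult_left_mono)
  qed
qed

lemma L2_inner_diff_left:
  assumes "f \<in> L2_unit" "f' \<in> L2_unit" "g \<in> borel_measurable unit_lebesgue"
    "\<And>x. x \<in> {0..1} \<Longrightarrow> \<bar>g x\<bar> \<le> B"
  shows "L2_inner (\<lambda>x. f x - f' x) g = L2_inner f g - L2_inner f' g"
  unfolding L2_inner_def left_diff_distrib
  by (rule Bochner_Integration.integral_diff[OF L2_inner_bounded_integrable[OF assms(1,3,4)]
        L2_inner_bounded_integrable[OF assms(2,3,4)]])

lemma L2_inner_bound:
  assumes "f \<in> L2_unit" "g \<in> borel_measurable unit_lebesgue"
    "\<And>x. x \<in> {0..1} \<Longrightarrow> \<bar>f x\<bar> \<le> A" "\<And>x. x \<in> {0..1} \<Longrightarrow> \<bar>g x\<bar> \<le> B"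
  shows "\<bar>L2_inner f g\<bar> \<le> A * B"
proof -
  have "\<bar>L2_inner f g\<bar> \<le> (LINT x|unit_lebesgue. \<bar>f x * g x\<bar>)"
    unfolding L2_inner_def by (rule integral_abs_bound)
  also have "\<dots> \<le> (LINT x|unit_lebesgue. A * B)"
  proof (rule integral_mono)
    show "integrable unit_lebesgue (\<lambda>x. \<bar>f x * g x\<bar>)"
      using L2_inner_bounded_integrable[OF assms(1,2,4)] by simp
    fix x assume "x \<in> space unit_lebesgue"
    then have x: "x \<in> {0..1}" by simp
    show "\<bar>f x * g x\<bar> \<le> A * B"
      unfolding abs_mult using assms(3,4)[OF x] order_trans[OF abs_ge_zero assms(3)[OF x]]
      by (intro mult_mono) auto
  qed simp
  finally show ?thesis by simp
qed

lemma bounded_L2_unit: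
  assumes "g \<in> borel_measurable unit_lebesgue" "\<And>x. x \<in> {0..1} \<Longrightarrow> \<bar>g x\<bar> \<le> B"
  shows "g \<in> L2_unit"
  unfolding L2_unit_def
  using assms by (auto intro!: integrable_unit_bounded[where B = "B\<^sup>2"] square_bound)

lemma L2_unit_diff:
  assumes "f \<in> L2_unit" "g \<in> L2_unit"
  shows "(\<lambda>x. f x - g x) \<in> L2_unit"
proof -
  have m: "f \<in> borel_measurable unit_lebesgue" "g \<in> borel_measurable unit_lebesgue"
    using assms by (auto simp: L2_unit_def)
  have "integrable unit_lebesgue (\<lambda>x. (f x - g x)\<^sup>2)"
  proof (rule Bochner_Integration.integrable_bound)
    show "integrable unit_lebesgue (\<lambda>x. 2 * (f x)\<^sup>2 + 2 * (g x)\<^sup>2)"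
      using assms by (auto simp: L2_unit_def)
    have "(a - b)\<^sup>2 \<le> 2 * a\<^sup>2 + 2 * b\<^sup>2" for a b :: real
      using zero_le_power2[of "a + b"] by (simp add: power2_eq_square algebra_simps)
    then show "AE x in unit_lebesgue. norm ((f x - g x)\<^sup>2) \<le> norm (2 * (f x)\<^sup>2 + 2 * (g x)\<^sup>2)"
      by (intro AE_I2) (simp add: add_nonneg_nonneg)
  qed (use m in measurable)
  then show ?thesis using m by (auto simp: L2_unit_def)
qed

lemma geometric_tail:
  fixes g :: "nat \<Rightarrow> real"
  assumes g: "\<And>j. \<bar>g j\<bar> \<le> K * q ^ j" and q: "0 \<le> q" "q < 1"
  shows "summable g" "\<bar>suminf g - (\<Sum>j<T. g j)\<bar> \<le> K * q ^ T / (1 - q)"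
proof -
  have geo: "summable (\<lambda>j. K * q ^ j)"
    using q by (intro summable_mult summable_geometric) simp
  have sn: "summable (\<lambda>j. \<bar>g j\<bar>)"
    by (rule summable_comparison_test'[OF geo, of 0]) (use g in auto)
  show s: "summable g" by (rule summable_rabs_cancel[OF sn])
  have "suminf g - (\<Sum>j<T. g j) = (\<Sum>j. g (j + T))"
    using suminf_minus_initial_segment[OF s, of T] by simp
  also have "\<bar>\<dots>\<bar> \<le> (\<Sum>j. \<bar>g (j + T)\<bar>)"
    by (intro summable_rabs summable_ignore_initial_segment sn)
  also have "\<dots> \<le> (\<Sum>j. K * q ^ T * q ^ j)"
  proof (rule suminf_le)
    show "\<bar>g (j + T)\<bar> \<le> K * q ^ T * q ^ j" for j
      using g[of "j + T"] by (simp add: power_add mult_ac)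
    show "summable (\<lambda>j. \<bar>g (j + T)\<bar>)" by (intro summable_ignore_initial_segment sn)
    show "summable (\<lambda>j. K * q ^ T * q ^ j)"
      using q by (intro summable_mult summable_geometric) simp
  qed
  also have "\<dots> = K * q ^ T * (1 / (1 - q))"
    using q by (subst suminf_mult) (auto simp: summable_geometric suminf_geometric)
  finally show "\<bar>suminf g - (\<Sum>j<T. g j)\<bar> \<le> K * q ^ T / (1 - q)" by simp
qed

text \<open>The interface through which the estimator sees the basis. By \<open>localized\<close>,
  the sup norm of one level is at most its largest coefficient times C 2^(j/2), which converts
  coefficient bounds into sup-norm bounds without a factor for the number of coefficients.\<close>

locale wavelet_system =
  fixes \<psi> :: "nat \<Rightarrow> nat \<Rightarrow> real \<Rightarrow> real" and C :: real
  assumes onb: "orthonormal_basis_L2 \<psi>"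
    and C_pos: "C > 0"
    and localized: "\<And>j x. x \<in> {0..1} \<Longrightarrow> (\<Sum>k\<in>wavelet_index j. \<bar>\<psi> j k x\<bar>) \<le> C * 2 powr (real j / 2)"
begin

lemma psi_bound:
  assumes "k \<in> wavelet_index j" "x \<in> {0..1}"
  shows "\<bar>\<psi> j k x\<bar> \<le> C * 2 powr (real j / 2)"
  by (rule order_trans[OF member_le_sum localized]) (use assms in auto)

lemma psi_L2: "k \<in> wavelet_index j \<Longrightarrow> \<psi> j k \<in> L2_unit"
  using onb by (simp add: orthonormal_basis_L2_def)

lemma psi_measurable: "k \<in> wavelet_index j \<Longrightarrow> \<psi> j k \<in> borel_measurable unit_lebesgue"
  using psi_L2 by (simp add: L2_unit_def)

lemma psi_orthonormal:
  "k \<in> wavelet_index j \<Longrightarrow> k' \<in> wavelet_index j' \<Longrightarrow>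
    L2_inner (\<psi> j k) (\<psi> j' k') = (if j = j' \<and> k = k' then 1 else 0)"
  using onb unfolding orthonormal_basis_L2_def by blast

lemma psi_complete:
  assumes "f \<in> L2_unit" "\<And>j k. k \<in> wavelet_index j \<Longrightarrow> L2_inner f (\<psi> j k) = 0"
  shows "AE x in unit_lebesgue. f x = 0"
  using onb assms unfolding orthonormal_basis_L2_def by blast

definition level_sum :: "(nat \<Rightarrow> nat \<Rightarrow> real) \<Rightarrow> nat \<Rightarrow> real \<Rightarrow> real" where
  "level_sum a j x = (\<Sum>k\<in>wavelet_index j. a j k * \<psi> j k x)"

lemma level_sum_measurable: "level_sum a j \<in> borel_measurable unit_lebesgue"
  unfolding level_sum_def using psi_measurable by measurable

lemma level_sum_bound:
  assumes "\<And>k. k \<in> wavelet_index j \<Longrightarrow> \<bar>a j k\<bar> \<le> b" "x \<in> {0..1}"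
  shows "\<bar>level_sum a j x\<bar> \<le> b * (C * 2 powr (real j / 2))"
proof -
  have b: "b \<ge> 0"
    using assms(1) wavelet_index_nonempty[of j] by (meson abs_ge_zero ex_in_conv order_trans)
  have "\<bar>level_sum a j x\<bar> \<le> (\<Sum>k\<in>wavelet_index j. b * \<bar>\<psi> j k x\<bar>)"
    unfolding level_sum_def
    by (rule order_trans[OF sum_abs sum_mono]) (use assms in \<open>auto simp: abs_mult intro!: mult_right_mono\<close>)
  also have "\<dots> \<le> b * (C * 2 powr (real j / 2))"
    unfolding sum_distrib_left[symmetric] using b localized[OF assms(2)] by (rule mult_left_mono[rotated])
  finally show ?thesis .
qed

lemma level_sums_L2: "finite A \<Longrightarrow> (\<lambda>x. \<Sum>j\<in>A. level_sum a j x) \<in> L2_unit"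
proof (rule bounded_L2_unit)
  fix x :: real assume x: "x \<in> {0..1}"
  have "\<bar>level_sum a j x\<bar> \<le> (Max ((\<lambda>k. \<bar>a j k\<bar>) ` wavelet_index j)) * (C * 2 powr (real j / 2))" for j
    by (rule level_sum_bound[OF _ x]) simp
  then show "\<bar>\<Sum>j\<in>A. level_sum a j x\<bar> \<le>
      (\<Sum>j\<in>A. (Max ((\<lambda>k. \<bar>a j k\<bar>) ` wavelet_index j)) * (C * 2 powr (real j / 2)))"
    by (intro order_trans[OF sum_abs sum_mono])
qed (intro borel_measurable_sum level_sum_measurable)

lemma inner_level_sums:
  assumes "finite A" and k: "k \<in> wavelet_index j"
  shows "L2_inner (\<lambda>x. \<Sum>i\<in>A. level_sum a i x) (\<psi> j k) = (if j \<in> A then a j k else 0)"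
proof -
  have int: "integrable unit_lebesgue (\<lambda>x. \<psi> i l x * \<psi> j k x)" if "l \<in> wavelet_index i" for i l
    by (rule L2_inner_bounded_integrable[OF psi_L2[OF that] psi_measurable[OF k] psi_bound[OF k]])
  have "L2_inner (\<lambda>x. \<Sum>i\<in>A. level_sum a i x) (\<psi> j k) =
      (LINT x|unit_lebesgue. (\<Sum>i\<in>A. \<Sum>l\<in>wavelet_index i. a i l * (\<psi> i l x * \<psi> j k x)))"
    unfolding L2_inner_def level_sum_def
    by (intro Bochner_Integration.integral_cong refl) (simp add: sum_distrib_right mult.assoc)
  also have "\<dots> = (\<Sum>i\<in>A. \<Sum>l\<in>wavelet_index i. a i l * L2_inner (\<psi> i l) (\<psi> j k))"
    using int unfolding L2_inner_def
    by (subst Bochner_Integration.integral_sum)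
      (auto intro!: sum.cong simp: Bochner_Integration.integral_sum)
  also have "\<dots> = (\<Sum>i\<in>A. \<Sum>l\<in>wavelet_index i. if i = j then (if l = k then a i l else 0) else 0)"
    using k by (intro sum.cong refl) (simp add: psi_orthonormal)
  also have "\<dots> = (\<Sum>i\<in>A. if i = j then a j k else 0)"
    using k by (intro sum.cong refl) (auto simp: sum.delta)
  also have "\<dots> = (if j \<in> A then a j k else 0)"
    using assms(1) by (simp add: sum.delta)
  finally show ?thesis .
qed

lemma wavelet_block_eq:
  "wavelet_block \<psi> a b f = (\<lambda>x. \<Sum>j\<in>{j::nat. a \<le> real j \<and> real j \<le> b}. level_sum (\<lambda>j k. L2_inner f (\<psi> j k)) j x)"
  by (simp add: wavelet_block_def level_sum_def fun_eq_iff)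

lemma finite_levels: "finite {j::nat. a \<le> real j \<and> real j \<le> b}"
proof (rule finite_subset)
  show "{j::nat. a \<le> real j \<and> real j \<le> b} \<subseteq> {..nat \<lfloor>b\<rfloor>}"
    by (auto simp: le_nat_floor)
qed simp

text \<open>By orthonormality the block keeps the coefficients of f on its levels and has none
  elsewhere. If all of them stayed below the threshold, the Besov norm of the block would be at most
  \<epsilon> L / 2. The loss of the factor 2 avoids asking whether the supremum is attained.\<close>

lemma self_similar_large_coefficient:
  assumes f: "f \<in> self_similar \<psi> s L \<epsilon> j0 \<rho>" and "j0 \<le> i" "L > 0" "\<epsilon> > 0"
  obtains j k where "real i \<le> real j" "real j \<le> \<rho> * real i" "k \<in> wavelet_index j"
    "\<epsilon> * L / 2 * 2 powr (- real j * (s + 1/2)) \<le> \<bar>L2_inner f (\<psi> j k)\<bar>"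
proof (rule ccontr)
  assume neg: "\<not> thesis"
  note large = that
  let ?g = "wavelet_block \<psi> (real i) (\<rho> * real i) f"
  have inner: "L2_inner ?g (\<psi> j k) = (if j \<in> {j. real i \<le> real j \<and> real j \<le> \<rho> * real i} then L2_inner f (\<psi> j k) else 0)"
    if k: "k \<in> wavelet_index j" for j k
    unfolding wavelet_block_eq by (rule inner_level_sums[OF finite_levels k])
  have small: "ennreal (2 powr (real j * (s + 1/2)) * \<bar>L2_inner ?g (\<psi> j k)\<bar>) \<le> ennreal (\<epsilon> * L / 2)"
    if k: "k \<in> wavelet_index j" for j k
  proof (rule ennreal_leI, cases "real i \<le> real j \<and> real j \<le> \<rho> * real i")
    case True
    have "\<bar>L2_inner f (\<psi> j k)\<bar> \<le> \<epsilon> * L / 2 * 2 powr (- real j * (s + 1/2))"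
    proof (rule ccontr)
      assume "\<not> ?thesis"
      then have "\<epsilon> * L / 2 * 2 powr (- real j * (s + 1/2)) \<le> \<bar>L2_inner f (\<psi> j k)\<bar>"
        by (simp only: not_le less_imp_le)
      from neg large[OF conjunct1[OF True] conjunct2[OF True] k this] show False by (rule notE)
    qed
    then have "2 powr (real j * (s + 1/2)) * \<bar>L2_inner f (\<psi> j k)\<bar> \<le>
        2 powr (real j * (s + 1/2)) * (\<epsilon> * L / 2 * 2 powr (- real j * (s + 1/2)))"
      by (rule mult_left_mono) simp
    also have "\<dots> = \<epsilon> * L / 2 * 2 powr (real j * (s + 1/2) + - real j * (s + 1/2))"
      by (simp only: powr_add mult_ac)
    also have "\<dots> = \<epsilon> * L / 2" by simp
    finally show "2 powr (real j * (s + 1/2)) * \<bar>L2_inner ?g (\<psi> j k)\<bar> \<le> \<epsilon> * L / 2"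
      using True by (simp add: inner[OF k])
  next
    case False
    then have "L2_inner ?g (\<psi> j k) = 0"
      using inner[OF k] by auto
    then show "2 powr (real j * (s + 1/2)) * \<bar>L2_inner ?g (\<psi> j k)\<bar> \<le> \<epsilon> * L / 2"
      using assms by simp
  qed
  have "besov_norm \<psi> s ?g \<le> ennreal (\<epsilon> * L / 2)"
    unfolding besov_norm_def by (intro SUP_least small)
  moreover have "ennreal (\<epsilon> * L) \<le> besov_norm \<psi> s ?g"
    using f \<open>j0 \<le> i\<close> by (simp add: self_similar_def)
  ultimately have "ennreal (\<epsilon> * L) \<le> ennreal (\<epsilon> * L / 2)" by (rule order_trans[rotated])
  then have "\<epsilon> * L \<le> \<epsilon> * L / 2"
    using assms by (subst (asm) ennreal_le_iff) auto
  then show False using mult_pos_pos[OF assms(4,3)] by linarith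
qed

lemma besov_ball_coefficient:
  assumes f: "f \<in> besov_ball \<psi> s L" and k: "k \<in> wavelet_index j" and L: "L > 0"
  shows "\<bar>L2_inner f (\<psi> j k)\<bar> \<le> L * 2 powr (- real j * (s + 1/2))"
proof -
  have "ennreal (2 powr (real j * (s + 1/2)) * \<bar>L2_inner f (\<psi> j k)\<bar>) \<le> besov_norm \<psi> s f"
    unfolding besov_norm_def by (rule SUP_upper2[of j]) (simp, rule SUP_upper[OF k])
  also have "\<dots> \<le> ennreal L" using f by (simp add: besov_ball_def less_imp_le)
  finally have "2 powr (real j * (s + 1/2)) * \<bar>L2_inner f (\<psi> j k)\<bar> \<le> L"
    using L by (subst (asm) ennreal_le_iff) auto
  then have "\<bar>L2_inner f (\<psi> j k)\<bar> \<le> L / 2 powr (real j * (s + 1/2))"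
    by (simp add: pos_le_divide_eq mult.commute)
  then show ?thesis by (simp add: powr_minus_divide)
qed

text \<open>The wavelet series of a function with the stated decay converges uniformly, so its sum has the
  same coefficients, and completeness identifies the two; no convergence in \<open>L\<^sub>2\<close> is needed.\<close>

lemma besov_truncation:
  assumes f: "f \<in> L2_unit" and s: "s > 0"
    and coef: "\<And>j k. k \<in> wavelet_index j \<Longrightarrow> \<bar>L2_inner f (\<psi> j k)\<bar> \<le> L * 2 powr (- real j * (s + 1/2))"
  shows "AE x in unit_lebesgue. \<forall>T. \<bar>f x - (\<Sum>j<T. level_sum (\<lambda>j k. L2_inner f (\<psi> j k)) j x)\<bar>
     \<le> L * C * 2 powr (- real T * s) / (1 - 2 powr (- s))"
proof -
  let ?a = "\<lambda>j k. L2_inner f (\<psi> j k)"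
  define q where "q = 2 powr (- s)"
  have q: "0 \<le> q" "q < 1" using s by (auto simp: q_def powr_less_one)
  have qp: "q ^ j = 2 powr (- real j * s)" for j
    unfolding q_def by (simp add: powr_realpow[symmetric] powr_powr mult.commute)
  have lev: "\<bar>level_sum ?a j x\<bar> \<le> L * C * q ^ j" if "x \<in> {0..1}" for j x
  proof -
    have "\<bar>level_sum ?a j x\<bar> \<le> L * 2 powr (- real j * (s + 1/2)) * (C * 2 powr (real j / 2))"
      by (intro level_sum_bound coef that)
    also have "\<dots> = L * C * 2 powr (- real j * (s + 1/2) + real j / 2)"
      by (simp only: powr_add mult_ac)
    also have "\<dots> = L * C * q ^ j" by (simp add: qp algebra_simps)
    finally show ?thesis .
  qed
  define F where "F x = (\<Sum>j. level_sum ?a j x)" for x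
  have tail: "\<bar>F x - (\<Sum>j<T. level_sum ?a j x)\<bar> \<le> L * C * q ^ T / (1 - q)" if "x \<in> {0..1}" for x T
    unfolding F_def by (rule geometric_tail(2)[OF lev[OF that] q])
  have Fm: "F \<in> borel_measurable unit_lebesgue"
    unfolding F_def by (intro borel_measurable_suminf level_sum_measurable)
  have Fb: "\<bar>F x\<bar> \<le> L * C / (1 - q)" if "x \<in> {0..1}" for x
    using tail[OF that, of 0] by simp
  have FL2: "F \<in> L2_unit" by (rule bounded_L2_unit[OF Fm Fb])
  have "L2_inner (\<lambda>x. f x - F x) (\<psi> j k) = 0" if k: "k \<in> wavelet_index j" for j k
  proof -
    let ?S = "\<lambda>T x. \<Sum>j<T. level_sum ?a j x"
    let ?B = "C * 2 powr (real j / 2)"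
    note ib = L2_inner_bounded_integrable[OF _ psi_measurable[OF k] psi_bound[OF k]]
    have SL2: "?S T \<in> L2_unit" for T by (rule level_sums_L2) simp
    have bound: "\<bar>L2_inner F (\<psi> j k) - ?a j k\<bar> \<le> L * C * q ^ T / (1 - q) * ?B" if "T > j" for T
    proof -
      have dL2: "(\<lambda>x. F x - ?S T x) \<in> L2_unit" by (rule L2_unit_diff[OF FL2 SL2])
      have "L2_inner F (\<psi> j k) - ?a j k = L2_inner F (\<psi> j k) - L2_inner (?S T) (\<psi> j k)"
        using that by (simp add: inner_level_sums[OF _ k])
      also have "\<dots> = L2_inner (\<lambda>x. F x - ?S T x) (\<psi> j k)"
        by (rule L2_inner_diff_left[OF FL2 SL2 psi_measurable[OF k] psi_bound[OF k], symmetric])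
      also have "\<bar>\<dots>\<bar> \<le> L * C * q ^ T / (1 - q) * ?B"
        by (rule L2_inner_bound[OF dL2 psi_measurable[OF k] tail psi_bound[OF k]])
      finally show ?thesis .
    qed
    have "(\<lambda>T. L * C * q ^ T / (1 - q) * ?B) \<longlonglongrightarrow> L * C * 0 / (1 - q) * ?B"
      using q by (intro tendsto_intros LIMSEQ_realpow_zero) auto
    then have "\<bar>L2_inner F (\<psi> j k) - ?a j k\<bar> \<le> L * C * 0 / (1 - q) * ?B"
      by (rule tendsto_lowerbound)
        (use bound in \<open>auto intro!: eventually_mono[OF eventually_gt_at_top[of j]]\<close>)
    then have "L2_inner F (\<psi> j k) = ?a j k" by simp
    moreover have "L2_inner (\<lambda>x. f x - F x) (\<psi> j k) = ?a j k - L2_inner F (\<psi> j k)"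
      by (rule L2_inner_diff_left[OF f FL2 psi_measurable[OF k] psi_bound[OF k]])
    ultimately show ?thesis by simp
  qed
  then have "AE x in unit_lebesgue. f x - F x = 0"
    by (intro psi_complete L2_unit_diff f FL2)
  moreover have "AE x in unit_lebesgue. x \<in> {0..1}" by (rule AE_I2) simp
  ultimately show ?thesis
  proof eventually_elim
    case (elim x)
    then show ?case using tail[of x, unfolded qp] by (simp add: q_def)
  qed
qed

lemma besov_bounded:
  assumes f: "f \<in> L2_unit" and s: "s > 0"
    and coef: "\<And>j k. k \<in> wavelet_index j \<Longrightarrow> \<bar>L2_inner f (\<psi> j k)\<bar> \<le> L * 2 powr (- real j * (s + 1/2))"
  shows "AE x in unit_lebesgue. \<bar>f x\<bar> \<le> L * C / (1 - 2 powr (- s))"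
  by (rule eventually_mono[OF besov_truncation[OF assms]]) (auto dest: spec[of _ 0])

end

section \<open>Localization of Cohen-Daubechies-Vial bases\<close>

lemma cdv_space_bounded:
  assumes \<phi>: "bounded (range \<phi>)" and f: "f \<in> cdv_space N \<phi> j"
  shows "\<exists>B. \<forall>x\<in>{0..1}. \<bar>f x\<bar> \<le> B"
proof -
  obtain b where b: "\<And>x. \<bar>\<phi> x\<bar> \<le> b"
    using \<phi> by (auto simp: bounded_iff)
  obtain c d e where cde: "\<And>x. x \<in> {0..1} \<Longrightarrow>
     f x = (\<Sum>k\<in>{N..<2 ^ j - N}. c k * \<phi> (2 ^ j * x - real k))
         + (\<Sum>a<N. d a * (\<Sum>l\<in>{1 - int N..int N - 1}. of_int l ^ a * \<phi> (2 ^ j * x - of_int l)))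
         + (\<Sum>a<N. e a * (\<Sum>l\<in>{1 - int N..int N - 1}.
               of_int l ^ a * \<phi> (2 ^ j * x - of_int (2 ^ j - 1 - l))))"
    using f unfolding cdv_space_def by blast
  let ?P = "\<lambda>a. \<Sum>l\<in>{1 - int N..int N - 1}. \<bar>of_int l ^ a\<bar> * b"
  let ?B = "(\<Sum>k\<in>{N..<2 ^ j - N}. \<bar>c k\<bar> * b) + (\<Sum>a<N. \<bar>d a\<bar> * ?P a) + (\<Sum>a<N. \<bar>e a\<bar> * ?P a)"
  have P: "\<bar>\<Sum>l\<in>{1 - int N..int N - 1}. of_int l ^ a * \<phi> (y l)\<bar> \<le> ?P a" for a and y :: "int \<Rightarrow> real"
    by (rule order_trans[OF sum_abs sum_mono]) (simp only: abs_mult, rule mult_left_mono[OF b abs_ge_zero])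
  have "\<bar>f x\<bar> \<le> ?B" if x: "x \<in> {0..1}" for x
    unfolding cde[OF x]
    by (intro order_trans[OF abs_triangle_ineq] add_mono order_trans[OF sum_abs] sum_mono;
        simp only: abs_mult; intro mult_left_mono[OF _ abs_ge_zero] b P)
  then show ?thesis by blast
qed

lemma card_near_translates: "card {k::nat. \<bar>y - real k\<bar> \<le> real N} \<le> 2 * N + 1"
proof -
  have "{k::nat. \<bar>y - real k\<bar> \<le> real N} \<subseteq> nat ` {\<lceil>y\<rceil> - int N..\<lfloor>y\<rfloor> + int N}"
  proof
    fix k assume "k \<in> {k::nat. \<bar>y - real k\<bar> \<le> real N}"
    then have "y - real N \<le> real k" "real k \<le> y + real N" by (auto simp: abs_le_iff)
    then have "\<lceil>y\<rceil> - int N \<le> int k" "int k \<le> \<lfloor>y\<rfloor> + int N" by linarith+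
    then show "k \<in> nat ` {\<lceil>y\<rceil> - int N..\<lfloor>y\<rfloor> + int N}"
      by (intro image_eqI[of _ _ "int k"]) auto
  qed
  then have "card {k::nat. \<bar>y - real k\<bar> \<le> real N} \<le> card (nat ` {\<lceil>y\<rceil> - int N..\<lfloor>y\<rfloor> + int N})"
    by (intro card_mono) auto
  also have "\<dots> \<le> card {\<lceil>y\<rceil> - int N..\<lfloor>y\<rfloor> + int N}" by (rule card_image_le) simp
  also have "\<dots> \<le> 2 * N + 1" by (simp add: nat_le_iff; linarith)
  finally show ?thesis .
qed

text \<open>Finite overlap: at any point at most 2N + 1 interior wavelets of a level can be nonzero,
  whatever the level. This is what keeps the localization constant independent of j.\<close>

lemma sum_near_translates_bound:
  fixes g :: "nat \<Rightarrow> real"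
  assumes "finite K" and g: "\<And>k. k \<in> K \<Longrightarrow> \<bar>g k\<bar> \<le> b"
    and z: "\<And>k. k \<in> K \<Longrightarrow> \<bar>y - real k\<bar> > real N \<Longrightarrow> g k = 0" and b: "b \<ge> 0"
  shows "(\<Sum>k\<in>K. \<bar>g k\<bar>) \<le> real (2 * N + 1) * b"
proof -
  let ?K = "{k\<in>K. \<bar>y - real k\<bar> \<le> real N}"
  have fin: "finite {k::nat. \<bar>y - real k\<bar> \<le> real N}"
    by (rule finite_subset[of _ "{..nat \<lfloor>y + real N\<rfloor>}"], intro subsetI, simp only: atMost_iff, rule le_nat_floor) (simp_all add: abs_le_iff)
  have "(\<Sum>k\<in>K. \<bar>g k\<bar>) = (\<Sum>k\<in>?K. \<bar>g k\<bar>)"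
    using assms(1) z by (intro sum.mono_neutral_right) (auto simp: not_le)
  also have "\<dots> \<le> (\<Sum>k\<in>?K. b)" by (intro sum_mono) (simp add: g)
  also have "\<dots> = real (card ?K) * b" by simp
  also have "\<dots> \<le> real (2 * N + 1) * b"
  proof (intro mult_right_mono b of_nat_mono)
    have "card ?K \<le> card {k::nat. \<bar>y - real k\<bar> \<le> real N}" by (intro card_mono fin) auto
    then show "card ?K \<le> 2 * N + 1" using card_near_translates[of y N] by linarith
  qed
  finally show ?thesis .
qed

lemma sum_abs_Un_le:
  fixes g :: "nat \<Rightarrow> real"
  assumes "finite A" "finite B"
  shows "(\<Sum>k\<in>A \<union> B. \<bar>g k\<bar>) \<le> (\<Sum>k\<in>A. \<bar>g k\<bar>) + (\<Sum>k\<in>B. \<bar>g k\<bar>)"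
  using sum.union_inter[OF assms, of "\<lambda>k. \<bar>g k\<bar>"] sum_nonneg[OF abs_ge_zero, of g "A \<inter> B"]
  by linarith

lemma mother_wavelet_bounded:
  assumes \<phi>: "bounded (range \<phi>)"
  obtains B where "B \<ge> 0" "\<And>x. \<bar>mother_wavelet N h \<phi> x\<bar> \<le> B"
proof -
  obtain b where b: "\<And>x. \<bar>\<phi> x\<bar> \<le> b"
    using \<phi> by (auto simp: bounded_iff)
  let ?B = "sqrt 2 * (\<Sum>k\<in>{1 - int N..int N}. \<bar>(- 1) powi k * h (1 - k)\<bar> * b)"
  have B: "\<bar>mother_wavelet N h \<phi> x\<bar> \<le> ?B" for x
    unfolding mother_wavelet_def abs_mult[of "sqrt 2"] abs_of_nonneg[OF real_sqrt_ge_zero[OF zero_le_numeral]]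
    by (intro mult_left_mono order_trans[OF sum_abs sum_mono])
      (simp_all only: abs_mult[of _ "\<phi> _"] mult_left_mono[OF b abs_ge_zero] real_sqrt_ge_zero zero_le_numeral)
  moreover have "?B \<ge> 0" using B[of 0] by (rule order_trans[OF abs_ge_zero])
  ultimately show thesis by (intro that)
qed

lemma mother_wavelet_support:
  assumes "\<And>x. x \<notin> {1 - real N..real N} \<Longrightarrow> \<phi> x = 0" "\<bar>x\<bar> > real N"
  shows "mother_wavelet N h \<phi> x = 0"
proof -
  have "\<phi> (2 * x - of_int k) = 0" if "k \<in> {1 - int N..int N}" for k
  proof (rule assms(1))
    have "1 - real N \<le> of_int k" "of_int k \<le> real N" using that by auto
    then show "2 * x - of_int k \<notin> {1 - real N..real N}"
      using assms(2) by (auto simp: abs_if split: if_splits)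
  qed
  then show ?thesis by (simp add: mother_wavelet_def)
qed

text \<open>The profile g is tied to an actual basis function only through one level J, that is, on
  [0, 2^J]. Since 2N - 1 < 2^J, g vanishes beyond that interval, so a bound for the single function
  f already bounds g on the half-line and hence its dilates at all levels.\<close>

lemma edge_wavelet_bounded:
  fixes g :: "real \<Rightarrow> real"
  assumes f: "\<And>x. x \<in> {0..1} \<Longrightarrow> \<bar>f x\<bar> \<le> B"
    and fg: "\<And>x. x \<in> {0..1} \<Longrightarrow> f x = 2 powr (real J / 2) * g (2 ^ J * x)"
    and far: "\<And>y. y > 2 * real N - 1 \<Longrightarrow> g y = 0" and N: "2 * N \<le> 2 ^ J"
    and y: "y \<ge> 0"
  shows "\<bar>g y\<bar> \<le> B"
proof (cases "y \<le> 2 ^ J")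
  case True
  have "B \<ge> 0" using f[of 0] by simp
  have x: "y / 2 ^ J \<in> {0..1}" using True y by simp
  have "\<bar>g y\<bar> \<le> 2 powr (real J / 2) * \<bar>g y\<bar>"
    using mult_right_mono[OF ge_one_powr_ge_zero[of 2 "real J / 2"], of "\<bar>g y\<bar>"] by simp
  also have "\<dots> = \<bar>f (y / 2 ^ J)\<bar>" using fg[OF x] by (simp add: abs_mult)
  also have "\<dots> \<le> B" by (rule f[OF x])
  finally show ?thesis .
next
  case False
  have "real (2 * N) \<le> real (2 ^ J)" using N by (rule of_nat_mono)
  then have "g y = 0" using False by (intro far) simp
  then show ?thesis using f[of 0] by simp
qed

lemma cdv_wavelet_system:
  assumes cdv: "cdv_wavelet_basis N \<psi>"
  obtains C where "wavelet_system \<psi> C"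
proof -
  obtain h \<phi> J \<psi>l \<psi>r where def: "daubechies_scaling N h \<phi> \<and> 2 * N \<le> 2 ^ J \<and>
        (\<forall>j<J. \<forall>k\<in>wavelet_index j. \<psi> j k \<in> cdv_space N \<phi> J) \<and>
        (\<forall>j\<ge>J. \<forall>k\<in>{1..2 ^ j}. \<psi> j k \<in> cdv_space N \<phi> (Suc j) \<and>
           (\<forall>g\<in>cdv_space N \<phi> j. L2_inner (\<psi> j k) g = 0)) \<and>
        (\<forall>a<N. \<forall>y>2 * real N - 1. \<psi>l a y = 0 \<and> \<psi>r a y = 0) \<and>
        (\<forall>j\<ge>J. \<forall>x\<in>{0..1}.
           (\<forall>a<N. \<psi> j (a + 1) x = 2 powr (real j / 2) * \<psi>l a (2 ^ j * x)) \<and>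
           (\<forall>k\<in>{N..<2 ^ j - N}.
              \<psi> j (k + 1) x = 2 powr (real j / 2) * mother_wavelet N h \<phi> (2 ^ j * x - real k)) \<and>
           (\<forall>a<N. \<psi> j (2 ^ j - a) x = 2 powr (real j / 2) * \<psi>r a (2 ^ j * (1 - x))))"
    using cdv unfolding cdv_wavelet_basis_def by blast
  note d = def[THEN conjunct1]
  note def1 = def[THEN conjunct2]
  note NJ = def1[THEN conjunct1]
  note def2 = def1[THEN conjunct2]
  note def3 = def2[THEN conjunct2]
  note def4 = def3[THEN conjunct2]
  note fine = def4[THEN conjunct2, THEN spec, THEN mp, THEN bspec]
  have low: "\<psi> j k \<in> cdv_space N \<phi> J" if "j < J" "k \<in> wavelet_index j" for j k
    using def2[THEN conjunct1] that by blast
  have high: "\<psi> j k \<in> cdv_space N \<phi> (Suc j)" if "J \<le> j" "k \<in> {1..2 ^ j}" for j k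
    using def3[THEN conjunct1] that by blast
  have edge: "\<psi>l a y = 0 \<and> \<psi>r a y = 0" if "a < N" "y > 2 * real N - 1" for a y
    using def4[THEN conjunct1] that by blast
  have left: "\<psi> j (a + 1) x = 2 powr (real j / 2) * \<psi>l a (2 ^ j * x)"
    if "J \<le> j" "x \<in> {0..1}" "a < N" for j x a
    by (rule fine[OF that(1,2), THEN conjunct1, THEN spec, THEN mp, OF that(3)])
  have mid: "\<psi> j (k + 1) x = 2 powr (real j / 2) * mother_wavelet N h \<phi> (2 ^ j * x - real k)"
    if "J \<le> j" "x \<in> {0..1}" "k \<in> {N..<2 ^ j - N}" for j x k
    by (rule fine[OF that(1,2), THEN conjunct2, THEN conjunct1, THEN bspec, OF that(3)])
  have right: "\<psi> j (2 ^ j - a) x = 2 powr (real j / 2) * \<psi>r a (2 ^ j * (1 - x))"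
    if "J \<le> j" "x \<in> {0..1}" "a < N" for j x a
    by (rule fine[OF that(1,2), THEN conjunct2, THEN conjunct2, THEN spec, THEN mp, OF that(3)])
  have \<phi>: "bounded (range \<phi>)"
    using d unfolding daubechies_scaling_def by (elim conjE)
  have N: "N \<ge> 1"
    using d unfolding daubechies_scaling_def by (elim conjE)
  have "\<forall>x. x \<notin> {1 - real N..real N} \<longrightarrow> \<phi> x = 0"
    using d unfolding daubechies_scaling_def by (elim conjE)
  then have supp: "\<phi> x = 0" if "x \<notin> {1 - real N..real N}" for x
    using that by blast
  \<comment> \<open>Keeps the extra index k = 0 out of the fine levels: from J on,
    \<open>wavelet_index j\<close> is \<open>{1..2 ^ j}\<close>.\<close>
  have "J \<noteq> 0" using NJ N by (intro notI) simp
  then have J: "J \<ge> 1" by simp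
  define Bd where "Bd j k = (SOME B. \<forall>x\<in>{0..1}. \<bar>\<psi> j k x\<bar> \<le> B)" for j k
  have Bd: "\<bar>\<psi> j k x\<bar> \<le> Bd j k"
    if "\<exists>B. \<forall>x\<in>{0..1}. \<bar>\<psi> j k x\<bar> \<le> B" "x \<in> {0..1}" for j k x
    using someI_ex[OF that(1)] that(2) unfolding Bd_def by (rule bspec)
  have Bl: "\<bar>\<psi> j k x\<bar> \<le> Bd j k" if "j < J" "k \<in> wavelet_index j" "x \<in> {0..1}" for j k x
    using cdv_space_bounded[OF \<phi> low[OF that(1,2)]] that(3) by (rule Bd)
  have Bh: "\<bar>\<psi> J k x\<bar> \<le> Bd J k" if "k \<in> {1..2 ^ J}" "x \<in> {0..1}" for k x
    using cdv_space_bounded[OF \<phi> high[OF order_refl that(1)]] that(2) by (rule Bd)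
  obtain Bm where Bm: "Bm \<ge> 0" "\<And>x. \<bar>mother_wavelet N h \<phi> x\<bar> \<le> Bm"
    using mother_wavelet_bounded[OF \<phi>] by blast
  have lb: "\<bar>\<psi>l a y\<bar> \<le> Bd J (a + 1)" if "a < N" "y \<ge> 0" for a y
  proof (rule edge_wavelet_bounded[OF Bh _ _ NJ that(2)])
    show "a + 1 \<in> {1..2 ^ J}" using that NJ by simp
  qed (use that left edge in auto)
  \<comment> \<open>The reflection x -> 1 - x reduces the right edge to the half-line situation of
    \<open>edge_wavelet_bounded\<close>.\<close>
  have rb: "\<bar>\<psi>r a y\<bar> \<le> Bd J (2 ^ J - a)" if "a < N" "y \<ge> 0" for a y
  proof (rule edge_wavelet_bounded[where f = "\<lambda>x. \<psi> J (2 ^ J - a) (1 - x)", OF _ _ _ NJ that(2)])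
    show "\<bar>\<psi> J (2 ^ J - a) (1 - x)\<bar> \<le> Bd J (2 ^ J - a)" if "x \<in> {0..1}" for x
      using that \<open>a < N\<close> NJ by (intro Bh) auto
    show "\<psi> J (2 ^ J - a) (1 - x) = 2 powr (real J / 2) * \<psi>r a (2 ^ J * x)" if "x \<in> {0..1}" for x
      using that right[of J "1 - x" a] \<open>a < N\<close> by auto
  qed (use that edge in auto)
  \<comment> \<open>\<open>CL\<close> collects the finitely many functions below level J.
    \<open>CH\<close> adds up the left edge, the overlapping interior translates and the right edge
    at one fine level, after removal of the factor 2^(j/2).\<close>
  define CL where "CL = (\<Sum>j<J. \<Sum>k\<in>wavelet_index j. \<bar>Bd j k\<bar>)"
  define CH where "CH = (\<Sum>a<N. Bd J (a + 1)) + real (2 * N + 1) * Bm + (\<Sum>a<N. Bd J (2 ^ J - a))"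
  define C where "C = CL + \<bar>CH\<bar> + 1"
  have CL: "CL \<ge> 0" unfolding CL_def by (intro sum_nonneg) simp
  have C: "C > 0" "CL \<le> C" "CH \<le> C" using CL unfolding C_def by linarith+
  have "(\<Sum>k\<in>wavelet_index j. \<bar>\<psi> j k x\<bar>) \<le> C * 2 powr (real j / 2)" if x: "x \<in> {0..1}" for j x
  proof (cases "j < J")
    case True
    have "(\<Sum>k\<in>wavelet_index j. \<bar>\<psi> j k x\<bar>) \<le> (\<Sum>k\<in>wavelet_index j. \<bar>Bd j k\<bar>)"
      by (intro sum_mono order_trans[OF Bl[OF True _ x] abs_ge_self])
    also have "\<dots> \<le> CL"
      unfolding CL_def using True
      by (intro member_le_sum[where f = "\<lambda>j. \<Sum>k\<in>wavelet_index j. \<bar>Bd j k\<bar>"]) (auto intro: sum_nonneg)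
    also have "\<dots> \<le> C * 1" using C by simp
    also have "\<dots> \<le> C * 2 powr (real j / 2)"
      using C by (intro mult_left_mono) (auto simp: ge_one_powr_ge_zero)
    finally show ?thesis .
  next
    case False
    then have j: "J \<le> j" "j \<noteq> 0" using J by auto
    have "2 ^ J \<le> (2 ^ j :: nat)" using j by (intro power_increasing) auto
    then have NJ': "2 * N \<le> 2 ^ j" using NJ by linarith
    let ?p = "2 powr (real j / 2)"
    let ?u = "\<lambda>k. \<bar>\<psi> j k x\<bar>"
    \<comment> \<open>For an upper bound of a sum of absolute values a covering by the three
      families is enough.\<close>
    have sub: "{1..2 ^ j} \<subseteq> (\<lambda>a. a + 1) ` {..<N} \<union> (\<lambda>k. k + 1) ` {N..<2 ^ j - N} \<union> (\<lambda>a. 2 ^ j - a) ` {..<N}"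
      (is "_ \<subseteq> ?S1 \<union> ?S2 \<union> ?S3")
    proof
      fix k assume k: "k \<in> {1..2 ^ j :: nat}"
      consider "k \<le> N" | "N < k" "k \<le> 2 ^ j - N" | "2 ^ j - N < k" by linarith
      then show "k \<in> ?S1 \<union> ?S2 \<union> ?S3"
      proof cases
        case 1
        then have "k \<in> ?S1" using k by (intro image_eqI[of _ _ "k - 1"]) auto
        then show ?thesis by blast
      next
        case 2
        then have "k \<in> ?S2" using k by (intro image_eqI[of _ _ "k - 1"]) auto
        then show ?thesis by blast
      next
        case 3
        then have "k \<in> ?S3" using k NJ' by (intro image_eqI[of _ _ "2 ^ j - k"]) auto
        then show ?thesis by blast
      qed
    qed
    have "(\<Sum>k\<in>wavelet_index j. ?u k) \<le> sum ?u (?S1 \<union> ?S2 \<union> ?S3)"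
      using sub j by (intro sum_mono2) (auto simp: wavelet_index_def)
    also have "\<dots> \<le> sum ?u (?S1 \<union> ?S2) + sum ?u ?S3"
      by (rule sum_abs_Un_le) simp_all
    also have "sum ?u (?S1 \<union> ?S2) \<le> sum ?u ?S1 + sum ?u ?S2"
      by (rule sum_abs_Un_le) simp_all
    also have "sum ?u ?S1 \<le> (\<Sum>a<N. Bd J (a + 1) * ?p)"
    proof -
      have "sum ?u ?S1 = (\<Sum>a<N. ?u (a + 1))" by (subst sum.reindex) (auto simp: inj_on_def)
      also have "\<dots> \<le> (\<Sum>a<N. Bd J (a + 1) * ?p)"
      proof (rule sum_mono)
        fix a assume "a \<in> {..<N}"
        then show "?u (a + 1) \<le> Bd J (a + 1) * ?p"
          using left[OF j(1) x, of a] lb[of a "2 ^ j * x"] x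
          by (simp add: abs_mult mult.commute mult_right_mono)
      qed
      finally show ?thesis .
    qed
    also have "sum ?u ?S2 \<le> real (2 * N + 1) * (Bm * ?p)"
    proof -
      have "sum ?u ?S2 = (\<Sum>k\<in>{N..<2 ^ j - N}. ?u (k + 1))"
        by (subst sum.reindex) (auto simp: inj_on_def)
      also have "\<dots> \<le> real (2 * N + 1) * (Bm * ?p)"
      proof (rule sum_near_translates_bound)
        fix k assume k: "k \<in> {N..<2 ^ j - N}"
        show "\<bar>\<psi> j (k + 1) x\<bar> \<le> Bm * ?p"
          using mid[OF j(1) x k] Bm(2)[of "2 ^ j * x - real k"]
          by (simp add: abs_mult mult.commute mult_right_mono)
        show "\<psi> j (k + 1) x = 0" if "\<bar>2 ^ j * x - real k\<bar> > real N"
          using mid[OF j(1) x k] mother_wavelet_support[OF supp that] by simp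
      qed (use Bm in auto)
      finally show ?thesis .
    qed
    also have "sum ?u ?S3 \<le> (\<Sum>a<N. Bd J (2 ^ J - a) * ?p)"
    proof -
      have "sum ?u ?S3 = (\<Sum>a<N. ?u (2 ^ j - a))"
        using NJ' by (subst sum.reindex) (auto simp: inj_on_def)
      also have "\<dots> \<le> (\<Sum>a<N. Bd J (2 ^ J - a) * ?p)"
      proof (rule sum_mono)
        fix a assume "a \<in> {..<N}"
        then show "?u (2 ^ j - a) \<le> Bd J (2 ^ J - a) * ?p"
          using right[OF j(1) x, of a] rb[of a "2 ^ j * (1 - x)"] x
          by (simp add: abs_mult mult.commute mult_right_mono)
      qed
      finally show ?thesis .
    qed
    finally have "(\<Sum>k\<in>wavelet_index j. ?u k) \<le> CH * ?p"
      unfolding CH_def distrib_right sum_distrib_right mult.assoc by simp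
    also have "\<dots> \<le> C * ?p" using C by (intro mult_right_mono) auto
    finally show ?thesis .
  qed
  then have "wavelet_system \<psi> C"
    using cdv C unfolding wavelet_system_def cdv_wavelet_basis_def by blast
  then show thesis by (rule that)
qed

section \<open>Quantization and level selection\<close>

text \<open>Heap numbering: level j >= 1 occupies 2^j, ..., 2^(j+1) - 1, and the two functions of
  level 0 get the slots 0 and 1. The levels below T thus fit into 2^T slots with nothing wasted when
  T >= 1.\<close>

definition coef_index :: "nat \<Rightarrow> nat \<Rightarrow> nat" where
  "coef_index j k = 2 ^ j + k - 1"

text \<open>Inverse of \<open>coef_index\<close> on valid indices; at slot 0 the convention
  \<open>floor_log 0 = 0\<close> yields the pair (0, 0).\<close>

definition coef_pos :: "nat \<Rightarrow> nat \<times> nat" where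
  "coef_pos t = (floor_log t, t + 1 - 2 ^ floor_log t)"

lemma floor_log_unique:
  assumes "2 ^ j \<le> t" "t < 2 ^ Suc j"
  shows "floor_log t = j"
proof -
  have t: "t > 0" using assms(1) by (metis gr0I le_zero_eq power_not_zero zero_neq_numeral)
  have "2 ^ floor_log t < (2::nat) ^ Suc j" "2 ^ j < (2::nat) ^ Suc (floor_log t)"
    using floor_log_exp2_le[OF t] floor_log_exp2_gt[of t] assms by (auto intro: le_less_trans)
  then have "floor_log t < Suc j" "j < Suc (floor_log t)"
    by (metis one_less_numeral_iff power_strict_increasing_iff semiring_norm(76))+
  then show ?thesis by simp
qed

lemma coef_pos_index:
  assumes "k \<in> wavelet_index j"
  shows "coef_pos (coef_index j k) = (j, k)"
proof (cases "k = 0")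
  case True
  then show ?thesis using assms by (auto simp: wavelet_index_def coef_pos_def coef_index_def split: if_splits)
next
  case False
  then have k: "1 \<le> k" "k \<le> 2 ^ j" using assms by (auto simp: wavelet_index_def split: if_splits)
  then have "floor_log (coef_index j k) = j"
    by (intro floor_log_unique) (auto simp: coef_index_def)
  then show ?thesis using k by (simp add: coef_pos_def coef_index_def)
qed

lemma coef_index_less:
  assumes "k \<in> wavelet_index j" "j < T"
  shows "coef_index j k < 2 ^ T"
proof -
  have "k \<le> 2 ^ j" using assms(1) by (auto simp: wavelet_index_def split: if_splits)
  moreover have "(0::nat) < 2 ^ j" by simp
  ultimately have "coef_index j k < 2 ^ j + 2 ^ j"
    unfolding coef_index_def by linarith
  also have "\<dots> = 2 ^ Suc j" by simp
  also have "\<dots> \<le> (2::nat) ^ T" using assms(2) by (intro power_increasing) auto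
  finally show ?thesis .
qed

text \<open>Every slot takes b consecutive bits and there is no header. A decoder that knows b reads
  T off the length \<open>b * 2 ^ T\<close>, so the number of transmitted levels costs no bits of
  its own.\<close>

definition pack :: "nat \<Rightarrow> nat \<Rightarrow> (nat \<Rightarrow> nat) \<Rightarrow> bool list" where
  "pack b T q = map (\<lambda>i. bit (q (i div b)) (i mod b)) [0..<b * 2 ^ T]"

definition unpack :: "nat \<Rightarrow> bool list \<Rightarrow> nat \<Rightarrow> nat" where
  "unpack b l t = horner_sum of_bool 2 (map (\<lambda>r. l ! (b * t + r)) [0..<b])"

lemma length_pack [simp]: "length (pack b T q) = b * 2 ^ T"
  by (simp add: pack_def)

lemma unpack_pack:
  assumes "t < 2 ^ T"
  shows "unpack b (pack b T q) t = take_bit b (q t)"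
proof -
  have "pack b T q ! (b * t + r) = bit (q t) r" if "r < b" for r
  proof -
    have "b * t + r < b * Suc t" using that by simp
    also have "\<dots> \<le> b * 2 ^ T" using assms by (intro mult_le_mono2) simp
    finally have "b * t + r < b * 2 ^ T" .
    then show ?thesis using that by (simp add: pack_def)
  qed
  then have "map (\<lambda>r. pack b T q ! (b * t + r)) [0..<b] = map (bit (q t)) [0..<b]"
    by (intro map_cong) auto
  then show ?thesis unfolding unpack_def by (simp only: horner_sum_bit_eq_take_bit)
qed

text \<open>Rounds down to a grid of mesh 2^(-p) on [-2^R, 2^R). This interval has 2^(R + 1 + p)
  cells, hence the word length R + 1 + p. Smaller values become 0 through \<open>nat\<close>; larger
  ones are wrapped around by \<open>take_bit\<close>.\<close>

definition quantize :: "nat \<Rightarrow> nat \<Rightarrow> real \<Rightarrow> nat" where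
  "quantize R p y = nat \<lfloor>(y + 2 ^ R) * 2 ^ p\<rfloor>"

definition dequantize :: "nat \<Rightarrow> nat \<Rightarrow> nat \<Rightarrow> real" where
  "dequantize R p q = real q / 2 ^ p - 2 ^ R"

text \<open>Valid for every q, including words produced by overflow. Whatever the noise does, a
  decoded coefficient stays bounded, and this caps the loss on the bad event.\<close>

lemma dequantize_bound: "\<bar>dequantize R p (take_bit (R + 1 + p) q)\<bar> \<le> 2 ^ R"
proof -
  have "take_bit (R + 1 + p) q < 2 ^ (R + 1 + p)" by (rule take_bit_nat_less_exp)
  then have "real (take_bit (R + 1 + p) q) \<le> real (2 ^ (R + 1 + p))"
    by (intro of_nat_mono less_imp_le)
  then have "real (take_bit (R + 1 + p) q) / 2 ^ p \<le> 2 * 2 ^ R"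
    by (simp add: pos_divide_le_eq power_add)
  moreover have "0 \<le> real (take_bit (R + 1 + p) q) / 2 ^ p" by simp
  ultimately show ?thesis unfolding dequantize_def abs_le_iff by linarith
qed

lemma dequantize_quantize:
  assumes "\<bar>y\<bar> < 2 ^ R"
  shows "\<bar>dequantize R p (take_bit (R + 1 + p) (quantize R p y)) - y\<bar> \<le> 1 / 2 ^ p"
proof -
  let ?z = "(y + 2 ^ R) * 2 ^ p"
  have y: "0 \<le> y + 2 ^ R" "y + 2 ^ R < 2 * 2 ^ R" using assms by (auto simp: abs_less_iff)
  have z: "0 \<le> ?z" using y by simp
  have "?z < 2 * 2 ^ R * 2 ^ p" using y(2) by (rule mult_strict_right_mono) simp
  then have "real (quantize R p y) < real (2 ^ (R + 1 + p))"
  proof -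
    have "real (quantize R p y) \<le> ?z" using z unfolding quantize_def by simp
    also have "?z < 2 * 2 ^ R * 2 ^ p" by fact
    also have "\<dots> = real (2 ^ (R + 1 + p))" by (simp add: power_add)
    finally show ?thesis .
  qed
  then have "quantize R p y < 2 ^ (R + 1 + p)" by (simp only: of_nat_less_iff)
  then have t: "take_bit (R + 1 + p) (quantize R p y) = quantize R p y"
    by (simp add: take_bit_nat_eq_self_iff)
  have "?z - 1 \<le> real (quantize R p y)" "real (quantize R p y) \<le> ?z"
    using z unfolding quantize_def by (simp_all; linarith)+
  then have "\<bar>real (quantize R p y) - ?z\<bar> \<le> 1" by linarith
  then have "\<bar>real (quantize R p y) - ?z\<bar> / 2 ^ p \<le> 1 / 2 ^ p"
    by (rule divide_right_mono) simp
  moreover have "\<bar>real (quantize R p y) - ?z\<bar> / 2 ^ p = \<bar>dequantize R p (quantize R p y) - y\<bar>"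
  proof -
    have "dequantize R p (quantize R p y) - y = (real (quantize R p y) - ?z) / 2 ^ p"
      unfolding dequantize_def by (simp add: field_simps)
    then show ?thesis by (simp add: abs_divide)
  qed
  ultimately show ?thesis unfolding t by simp
qed

lemma measurable_list_map [measurable (raw)]:
  assumes "\<And>i. i \<in> set xs \<Longrightarrow> (\<lambda>x. g i x) \<in> M \<rightarrow>\<^sub>M count_space (UNIV :: bool set)"
  shows "(\<lambda>x. map (\<lambda>i. g i x) xs) \<in> M \<rightarrow>\<^sub>M count_space UNIV"
  using assms
proof (induction xs)
  case (Cons a xs)
  have "(\<lambda>x. (g a x, map (\<lambda>i. g i x) xs)) \<in> M \<rightarrow>\<^sub>M count_space UNIV \<Otimes>\<^sub>M count_space UNIV"
    using Cons by (intro measurable_Pair) auto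
  then have "(\<lambda>x. (g a x, map (\<lambda>i. g i x) xs)) \<in> M \<rightarrow>\<^sub>M count_space UNIV"
    by (simp add: pair_measure_countable)
  then have "(\<lambda>x. (\<lambda>(a, l). a # l) (g a x, map (\<lambda>i. g i x) xs)) \<in> M \<rightarrow>\<^sub>M count_space UNIV"
    by (rule measurable_compose) simp
  then show ?case by simp
qed simp

lemma pack_measurable:
  assumes q: "\<And>t. (\<lambda>x. q x t) \<in> M \<rightarrow>\<^sub>M count_space UNIV" and T: "T \<in> M \<rightarrow>\<^sub>M count_space UNIV"
  shows "(\<lambda>x. pack b (T x) (q x)) \<in> M \<rightarrow>\<^sub>M count_space UNIV"
proof (rule measurable_compose_countable[where f = "\<lambda>T x. pack b T (q x)", OF _ T])
  fix i
  show "(\<lambda>x. pack b i (q x)) \<in> M \<rightarrow>\<^sub>M count_space UNIV"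
    unfolding pack_def
    by (intro measurable_list_map measurable_compose[OF q]) simp
qed

text \<open>The \<open>J\<close> at which the smoothness \<open>s\<close> with \<open>A = J (1 + 2 s)\<close> is compatible with the observed
  coefficients \<open>y\<close> of the levels in \<open>\<Delta>\<close>.\<close>

definition select_level :: "real \<Rightarrow> real \<Rightarrow> nat set \<Rightarrow> nat \<Rightarrow> (nat \<Rightarrow> nat \<Rightarrow> real) \<Rightarrow> nat" where
  "select_level A L \<Delta> Jm y = (LEAST J. 1 \<le> J \<and> (Jm \<le> J \<or>
     (\<forall>j\<in>\<Delta>. \<forall>k\<in>wavelet_index j. \<bar>y j k\<bar> \<le> 2 * L * 2 powr (- (real j * A / (2 * real J))))))"

section \<open>Two-sided control of the selected level\<close>

lemma select_level_props:
  fixes A L \<Delta> Jm y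
  assumes "1 \<le> Jm"
  defines "J \<equiv> select_level A L \<Delta> Jm y"
  shows "1 \<le> J" "J \<le> Jm"
    "Jm \<le> J \<or> (\<forall>j\<in>\<Delta>. \<forall>k\<in>wavelet_index j. \<bar>y j k\<bar> \<le> 2 * L * 2 powr (- (real j * A / (2 * real J))))"
proof -
  let ?P = "\<lambda>J. 1 \<le> J \<and> (Jm \<le> J \<or>
     (\<forall>j\<in>\<Delta>. \<forall>k\<in>wavelet_index j. \<bar>y j k\<bar> \<le> 2 * L * 2 powr (- (real j * A / (2 * real J)))))"
  have "?P Jm" using assms by simp
  then have "?P (LEAST J. ?P J)" "(LEAST J. ?P J) \<le> Jm" by (rule LeastI, rule Least_le)
  then show "1 \<le> J" "J \<le> Jm"
    "Jm \<le> J \<or> (\<forall>j\<in>\<Delta>. \<forall>k\<in>wavelet_index j. \<bar>y j k\<bar> \<le> 2 * L * 2 powr (- (real j * A / (2 * real J))))"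
    unfolding J_def select_level_def by blast+
qed

text \<open>The constant 2 L in the test leaves room for an observation error as large as the
  coefficient bound L 2^(-j (s + 1/2)). Since A / J <= 1 + 2 s, the threshold at J is at least twice
  that bound, so J passes the test.\<close>

lemma select_level_le:
  assumes s: "A \<le> (1 + 2 * s) * real J" "1 \<le> J" and L: "L > 0"
    and f: "\<And>j k. j \<in> \<Delta> \<Longrightarrow> k \<in> wavelet_index j \<Longrightarrow> \<bar>f j k\<bar> \<le> L * 2 powr (- real j * (s + 1/2))"
    and y: "\<And>j k. j \<in> \<Delta> \<Longrightarrow> k \<in> wavelet_index j \<Longrightarrow> \<bar>y j k - f j k\<bar> \<le> L * 2 powr (- real j * (s + 1/2))"
  shows "select_level A L \<Delta> Jm y \<le> J"
  unfolding select_level_def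
proof (rule Least_le, intro conjI disjI2 ballI)
  show "1 \<le> J" by fact
  fix j k assume jk: "j \<in> \<Delta>" "k \<in> wavelet_index j"
  have "A / real J \<le> 1 + 2 * s" using s by (simp add: pos_divide_le_eq)
  then have "real j * (A / real J) \<le> real j * (1 + 2 * s)" by (rule mult_left_mono) simp
  moreover have "real j * A / (2 * real J) = real j * (A / real J) / 2" by simp
  moreover have "real j * (s + 1/2) = real j * (1 + 2 * s) / 2" by (simp add: algebra_simps)
  ultimately have "- real j * (s + 1/2) \<le> - (real j * A / (2 * real J))"
    by (simp only: minus_mult_left[symmetric] neg_le_iff_le divide_right_mono zero_le_numeral)
  then have "2 powr (- real j * (s + 1/2)) \<le> 2 powr (- (real j * A / (2 * real J)))"
    by (intro powr_mono) auto
  then have "2 * L * 2 powr (- real j * (s + 1/2)) \<le> 2 * L * 2 powr (- (real j * A / (2 * real J)))"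
    using L by (intro mult_left_mono) auto
  then show "\<bar>y j k\<bar> \<le> 2 * L * 2 powr (- (real j * A / (2 * real J)))"
    using f[OF jk] y[OF jk] by linarith
qed

text \<open>If the selected J passes the test below the cap, the large coefficient gives \<epsilon>
  L / 4 * 2^(-j (s + 1/2)) <= 2 L * 2^(-j A / (2 J)). Logarithms turn this into j (A / J - (1 + 2
  s)) <= 2 log (8/\<epsilon>), where 8/\<epsilon> is the ratio of 2 L and \<epsilon> L / 4.\<close>

lemma select_level_ge:
  fixes A L \<Delta> Jm y
  assumes Jm: "1 \<le> Jm" and L: "L > 0" and \<epsilon>: "0 < \<epsilon>" "\<epsilon> \<le> 1"
    and j: "j \<in> \<Delta>" "k \<in> wavelet_index j" "real i \<le> real j" "1 \<le> i"
    and f: "\<epsilon> * L / 2 * 2 powr (- real j * (s + 1/2)) \<le> \<bar>f j k\<bar>"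
    and y: "\<bar>y j k - f j k\<bar> \<le> \<epsilon> * L / 4 * 2 powr (- real j * (s + 1/2))"
  defines "J \<equiv> select_level A L \<Delta> Jm y"
  shows "Jm \<le> J \<or> A \<le> real J * (1 + 2 * s) + 2 * log 2 (8 / \<epsilon>) * (real J / real i)"
proof (cases "Jm \<le> J")
  case False
  note P = select_level_props[OF Jm, of A L \<Delta> y, folded J_def]
  have J: "real J > 0" using P(1) by simp
  have "\<bar>y j k\<bar> \<le> 2 * L * 2 powr (- (real j * A / (2 * real J)))"
    using P(3) False j by blast
  moreover have "\<epsilon> * L / 4 * 2 powr (- real j * (s + 1/2)) \<le> \<bar>y j k\<bar>"
    using f y by linarith
  ultimately have "\<epsilon> * L / 4 * 2 powr (- real j * (s + 1/2)) \<le> 2 * L * 2 powr (- (real j * A / (2 * real J)))"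
    by linarith
  then have "L * (\<epsilon> / 8 * 2 powr (- real j * (s + 1/2))) \<le> L * 2 powr (- (real j * A / (2 * real J)))"
    by (simp add: algebra_simps)
  then have "\<epsilon> / 8 * 2 powr (- real j * (s + 1/2)) \<le> 2 powr (- (real j * A / (2 * real J)))"
    using L by (simp only: mult_le_cancel_left_pos)
  moreover have "\<epsilon> / 8 = 2 powr (- log 2 (8 / \<epsilon>))"
    using \<epsilon> by (simp add: powr_minus)
  ultimately have "2 powr (- log 2 (8 / \<epsilon>) + - real j * (s + 1/2)) \<le> 2 powr (- (real j * A / (2 * real J)))"
    by (simp only: powr_add)
  then have "- log 2 (8 / \<epsilon>) + - real j * (s + 1/2) \<le> - (real j * A / (2 * real J))"
    by (simp only: powr_le_cancel_iff one_less_numeral_iff semiring_norm)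
  then have 1: "real j * (A / real J - (1 + 2 * s)) \<le> 2 * log 2 (8 / \<epsilon>)"
    by (simp add: algebra_simps)
  have E: "log 2 (8 / \<epsilon>) \<ge> 0" using \<epsilon> by (simp add: zero_le_log_cancel_iff)
  \<comment> \<open>The exact level j of the large coefficient is unknown to the bound; only i <= j
    is kept. For a negative bracket the claim is trivial, because \<epsilon> <= 1 makes the
    logarithm nonnegative.\<close>
  have "real i * (A / real J - (1 + 2 * s)) \<le> 2 * log 2 (8 / \<epsilon>)"
  proof (cases "A / real J - (1 + 2 * s) \<ge> 0")
    case True
    then show ?thesis using mult_right_mono[OF j(3) True] 1 by linarith
  next
    case False
    then have "real i * (A / real J - (1 + 2 * s)) \<le> 0" by (intro mult_nonneg_nonpos) auto
    then show ?thesis using E by linarith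
  qed
  then have "A / real J - (1 + 2 * s) \<le> 2 * log 2 (8 / \<epsilon>) / real i"
    using j(4) by (simp add: pos_le_divide_eq mult.commute)
  then have "A / real J \<le> (1 + 2 * s) + 2 * log 2 (8 / \<epsilon>) / real i" by linarith
  then have "A \<le> ((1 + 2 * s) + 2 * log 2 (8 / \<epsilon>) / real i) * real J"
    using J by (simp only: pos_divide_le_eq)
  then show ?thesis by (simp add: algebra_simps)
qed simp

lemma select_level_measurable:
  assumes "finite \<Delta>" "\<And>j k. j \<in> \<Delta> \<Longrightarrow> k \<in> wavelet_index j \<Longrightarrow> (\<lambda>x. y x j k) \<in> borel_measurable M"
  shows "(\<lambda>x. select_level A L \<Delta> Jm (y x)) \<in> M \<rightarrow>\<^sub>M count_space UNIV"
  unfolding select_level_def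
proof (rule measurable_Least)
  fix J
  have "Measurable.pred M (\<lambda>x. \<bar>y x j k\<bar> \<le> B)" if "j \<in> \<Delta>" "k \<in> wavelet_index j" for j k B
    using assms(2)[OF that] by measurable
  then show "Measurable.pred M (\<lambda>x. 1 \<le> J \<and> (Jm \<le> J \<or>
     (\<forall>j\<in>\<Delta>. \<forall>k\<in>wavelet_index j. \<bar>y x j k\<bar> \<le> 2 * L * 2 powr (- (real j * A / (2 * real J))))))"
    using assms(1) by (intro pred_intros_logic pred_intros_finite) auto
qed

lemma sum_powr_half_le: "(\<Sum>j<T. 2 powr (real j / 2)) \<le> 4 * 2 powr (real T / 2)"
proof (induction T)
  case (Suc T)
  \<comment> \<open>The induction closes with a constant c as soon as c + 1 <= c * sqrt 2; for c = 4
    this is 5/4 <= sqrt 2.\<close>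
  have "(5::real) / 4 \<le> sqrt 2" by (rule real_le_rsqrt) (simp add: power2_eq_square)
  then have "5 * 2 powr (real T / 2) \<le> 4 * (sqrt 2 * 2 powr (real T / 2))" by simp
  also have "sqrt 2 * 2 powr (real T / 2) = 2 powr (real (Suc T) / 2)"
    by (simp add: add_divide_distrib powr_add powr_half_sqrt)
  finally show ?case using Suc by simp
qed simp

context wavelet_system
begin

lemma level_sums_bound:
  assumes "\<And>j k. j < T \<Longrightarrow> k \<in> wavelet_index j \<Longrightarrow> \<bar>a j k\<bar> \<le> b" "x \<in> {0..1}" "b \<ge> 0"
  shows "\<bar>\<Sum>j<T. level_sum a j x\<bar> \<le> 4 * b * C * 2 powr (real T / 2)"
proof -
  have "\<bar>\<Sum>j<T. level_sum a j x\<bar> \<le> (\<Sum>j<T. b * (C * 2 powr (real j / 2)))"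
    using assms by (intro order_trans[OF sum_abs sum_mono] level_sum_bound) auto
  also have "\<dots> = b * C * (\<Sum>j<T. 2 powr (real j / 2))"
    by (simp add: sum_distrib_left mult.assoc)
  also have "\<dots> \<le> b * C * (4 * 2 powr (real T / 2))"
    using assms(3) C_pos by (intro mult_left_mono sum_powr_half_le) auto
  finally show ?thesis by (simp add: mult_ac)
qed

text \<open>Split at level T: coefficient errors below T grow with 2^(T/2) by localization, and the
  omitted levels form the tail controlled by \<open>besov_truncation\<close>.\<close>

lemma Linf_norm_truncated_series:
  assumes f: "f \<in> L2_unit" and s: "s > 0"
    and coef: "\<And>j k. k \<in> wavelet_index j \<Longrightarrow> \<bar>L2_inner f (\<psi> j k)\<bar> \<le> L * 2 powr (- real j * (s + 1/2))"
    and a: "\<And>j k. j < T \<Longrightarrow> k \<in> wavelet_index j \<Longrightarrow> \<bar>a j k - L2_inner f (\<psi> j k)\<bar> \<le> b" and b: "b \<ge> 0"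
  shows "Linf_norm (\<lambda>x. (\<Sum>j<T. level_sum a j x) - f x) \<le>
    ennreal (4 * b * C * 2 powr (real T / 2) + L * C * 2 powr (- real T * s) / (1 - 2 powr (- s)))"
  unfolding Linf_norm_def
proof (rule esssup_I)
  have "(\<lambda>x. (\<Sum>j<T. level_sum a j x) - f x) \<in> borel_measurable unit_lebesgue"
    using L2_unit_diff[OF level_sums_L2 f] by (auto simp: L2_unit_def)
  then show "(\<lambda>x. ennreal \<bar>(\<Sum>j<T. level_sum a j x) - f x\<bar>) \<in> borel_measurable unit_lebesgue"
    by measurable
  have I: "AE x in unit_lebesgue. x \<in> {0..1}" by (rule AE_I2) simp
  have "AE x in unit_lebesgue. \<forall>T. \<bar>f x - (\<Sum>j<T. level_sum (\<lambda>j k. L2_inner f (\<psi> j k)) j x)\<bar>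
     \<le> L * C * 2 powr (- real T * s) / (1 - 2 powr (- s))"
    using f s coef by (rule besov_truncation)
  with I show "AE x in unit_lebesgue. ennreal \<bar>(\<Sum>j<T. level_sum a j x) - f x\<bar> \<le>
    ennreal (4 * b * C * 2 powr (real T / 2) + L * C * 2 powr (- real T * s) / (1 - 2 powr (- s)))"
  proof eventually_elim
    case (elim x)
    let ?g = "\<lambda>j k. L2_inner f (\<psi> j k)"
    have "(\<Sum>j<T. level_sum a j x) - (\<Sum>j<T. level_sum ?g j x) = (\<Sum>j<T. level_sum (\<lambda>j k. a j k - ?g j k) j x)"
      by (simp add: level_sum_def sum_subtractf left_diff_distrib)
    also have "\<bar>\<dots>\<bar> \<le> 4 * b * C * 2 powr (real T / 2)"
      using a b elim(1) by (intro level_sums_bound) auto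
    finally have "\<bar>(\<Sum>j<T. level_sum a j x) - (\<Sum>j<T. level_sum ?g j x)\<bar> \<le> 4 * b * C * 2 powr (real T / 2)" .
    moreover have "\<bar>f x - (\<Sum>j<T. level_sum ?g j x)\<bar> \<le> L * C * 2 powr (- real T * s) / (1 - 2 powr (- s))"
      using elim(2) by blast
    ultimately show ?case by (intro ennreal_leI) linarith
  qed
qed

end

section \<open>The estimator for a fixed sample size\<close>

lemma self_similar_mono:
  assumes "\<epsilon>' \<le> \<epsilon>" "L \<ge> 0"
  shows "self_similar \<psi> s L \<epsilon> j0 \<rho> \<subseteq> self_similar \<psi> s L \<epsilon>' j0 \<rho>"
proof -
  have "ennreal (\<epsilon>' * L) \<le> ennreal (\<epsilon> * L)"
    using assms by (intro ennreal_leI mult_right_mono)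
  then show ?thesis unfolding self_similar_def by (auto intro: order_trans)
qed

lemma sum_card_wavelet_index: "(\<Sum>j\<le>J. card (wavelet_index j)) = 2 ^ Suc J"
  by (induction J) (simp_all add: wavelet_index_def)

text \<open>\<open>Jm\<close> is the level for the roughest smoothness s1 and caps the selection.
  \<open>j1\<close> starts the block used for detection. \<open>Jn\<close> bounds both the
  transmitted and the detection levels; as it is at most log n, only 2n coefficients need control.
  \<open>p\<close> and \<open>R\<close> are the fractional and range bits of the quantizer.
  \<open>c0\<close> is the number of selected levels that are not sent: its first condition pays for
  the word length, its second keeps c0 below the ideal level of the smoothest class.
  \<open>Kf\<close> bounds the sup norm over all classes at once.\<close>

locale design = wavelet_system \<psi> C for \<psi> C +
  fixes n m j1 Jm Jn p R c0 :: nat and s1 s2 L \<epsilon> \<rho> \<kappa> :: real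
    and D :: "nat \<Rightarrow> nat \<Rightarrow> nat" and c :: "nat \<Rightarrow> nat \<Rightarrow> nat \<Rightarrow> real"
    and M :: "'w measure" and W :: "nat \<Rightarrow> real \<Rightarrow> 'w \<Rightarrow> real"
    and lg A u Kf :: real
  defines "lg \<equiv> log 2 (real n)" and "A \<equiv> log 2 (real n / log 2 (real n))"
    and "u \<equiv> sqrt (32 * ln (real n))" and "Kf \<equiv> L * C / (1 - 2 powr (- s1))"
  assumes iw: "independent_wiener M m W"
    and n: "8 \<le> n" and m: "1 \<le> m" "m \<le> n"
    and s: "0 < s1" "s1 < s2" and L: "0 < L" and \<epsilon>: "0 < \<epsilon>" "\<epsilon> \<le> 1" and \<rho>: "1 < \<rho>" and \<kappa>: "0 < \<kappa>"
    and Jm: "A / (1 + 2 * s1) \<le> real Jm" "real Jm \<le> A / (1 + 2 * s1) + 1" "Jm \<le> Jn" "real Jn \<le> lg"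
    and j1: "1 \<le> j1" "\<kappa> * lg \<le> 2 * real j1" "\<rho> * real j1 \<le> real Jn"
    and p: "real n \<le> 2 ^ p" "real p \<le> lg + 1"
    and R: "L + 2 \<le> 2 ^ R" and c0: "2 * (real R + 3) \<le> 2 ^ c0" "real c0 \<le> A / (1 + 2 * s2)"
    and noise: "1 / real n + sqrt (real m / real n) * u \<le> \<epsilon> / 4 * L * 2 powr (- \<rho> * real j1 * (s2 + 1/2))"
      "1 / real n + sqrt (real m / real n) * u \<le> 1"
    and D: "\<And>j k. 0 < D j k"
    and step_var: "\<And>j k. k \<in> wavelet_index j \<Longrightarrow> (\<Sum>l<D j k. (c j k l)\<^sup>2) / real (D j k) \<le> 4"
    and step_approx: "\<And>j k f. k \<in> wavelet_index j \<Longrightarrow> f \<in> L2_unit \<Longrightarrow> AE x in unit_lebesgue. \<bar>f x\<bar> \<le> Kf \<Longrightarrow>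
       \<bar>step_functional (D j k) (c j k) (\<lambda>t. LINT x|lebesgue_on {0..t}. f x) - L2_inner f (\<psi> j k)\<bar> \<le> 1 / real n"
begin

definition \<Delta> :: "nat set" where
  "\<Delta> = {j. real j1 \<le> real j \<and> real j \<le> \<rho> * real j1}"

definition coef :: "(real \<Rightarrow> real) \<Rightarrow> nat \<Rightarrow> nat \<Rightarrow> real" where
  "coef x j k = step_functional (D j k) (c j k) x"

definition sel :: "(real \<Rightarrow> real) \<Rightarrow> nat" where
  "sel x = select_level A L \<Delta> Jm (coef x)"

definition width :: nat where
  "width = R + 1 + p"

definition enc :: "(real \<Rightarrow> real) \<Rightarrow> bool list" where
  "enc x = pack width (sel x - c0) (\<lambda>t. quantize R p (coef x (fst (coef_pos t)) (snd (coef_pos t))))"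

definition dec_level :: "(nat \<Rightarrow> bool list) \<Rightarrow> nat" where
  "dec_level y = Min ((\<lambda>i. floor_log (length (y i) div width)) ` {1..m})"

definition dec_coef :: "(nat \<Rightarrow> bool list) \<Rightarrow> nat \<Rightarrow> nat \<Rightarrow> real" where
  "dec_coef y j k = (\<Sum>i\<in>{1..m}. dequantize R p (unpack width (y i) (coef_index j k))) / real m"

definition est :: dist_estimator where
  "est = \<lparr>seed = \<lambda>_. return borel 0, encode = \<lambda>_ z. enc (fst z),
     decode = \<lambda>y x. \<Sum>j<dec_level y. level_sum (dec_coef y) j x\<rparr>"

text \<open>Two kinds of deviation are excluded. The local one, at height u, serves level selection
  and the quantizer range of each machine; the averaged one, smaller by sqrt m, serves the accuracy
  of the decoder.\<close>

definition bad :: "'w set" where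
  "bad = (\<Union>(j, k)\<in>Sigma {..Jn} wavelet_index.
     (\<Union>i\<in>{1..m}. {\<omega>\<in>space M. u \<le> \<bar>coef (\<lambda>t. W i t \<omega>) j k\<bar>}) \<union>
     {\<omega>\<in>space M. u / sqrt (real m) \<le> \<bar>(\<Sum>i\<in>{1..m}. coef (\<lambda>t. W i t \<omega>) j k) / real m\<bar>})"

section \<open>Elementary bounds and measurability of the encoder\<close>

lemma lg_ge: "3 \<le> lg"
proof -
  have "log 2 8 \<le> lg" unfolding lg_def using n by (subst log_le_cancel_iff) auto
  moreover have "log 2 8 = (3::real)" using log_pow_cancel[of 2 3] by simp
  ultimately show ?thesis by simp
qed

lemma A_nonneg: "0 \<le> A"
  using c0(2) s by (smt (verit) divide_neg_pos of_nat_0_le_iff)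

lemma A_le_lg: "A \<le> lg"
proof -
  have "A = lg - log 2 lg"
    unfolding A_def lg_def using n lg_ge by (subst log_divide) (auto simp: lg_def)
  moreover have "0 \<le> log 2 lg" using lg_ge by (subst zero_le_log_cancel_iff) auto
  ultimately show ?thesis by simp
qed

lemma powr_A: "2 powr A = real n / lg"
  unfolding A_def lg_def using n lg_ge by (intro powr_log_cancel) (auto simp: lg_def)

lemma powr_lg: "2 powr lg = real n"
  unfolding lg_def using n by (intro powr_log_cancel) auto

lemma Jm_ge: "1 \<le> Jm"
proof (rule ccontr)
  assume "\<not> 1 \<le> Jm"
  then have "A / (1 + 2 * s1) \<le> 0" using Jm(1) by simp
  then have "A \<le> 0" using s by (simp add: divide_le_0_iff)
  then have "2 powr A \<le> 1" using A_nonneg by simp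
  then have "real n \<le> lg" using lg_ge by (simp add: powr_A pos_divide_le_eq)
  moreover have "lg < real n"
    unfolding lg_def using n by (intro log2_of_power_less) auto
  ultimately show False by simp
qed

lemma width_pos: "0 < width"
  by (simp add: width_def)

lemma finite_Delta: "finite \<Delta>"
  unfolding \<Delta>_def by (rule finite_levels)

lemma Delta_le: "j \<in> \<Delta> \<Longrightarrow> j \<le> Jn"
  using j1(3) by (simp add: \<Delta>_def)

lemma coef_measurable: "(\<lambda>x. coef x j k) \<in> borel_measurable path_space"
  unfolding coef_def by (rule step_functional_measurable[OF D])

lemma sel_measurable: "sel \<in> path_space \<rightarrow>\<^sub>M count_space UNIV"
  unfolding sel_def by (intro select_level_measurable finite_Delta coef_measurable)

lemma enc_measurable: "enc \<in> path_space \<rightarrow>\<^sub>M count_space UNIV"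
  unfolding enc_def
proof (intro pack_measurable)
  show "(\<lambda>x. sel x - c0) \<in> path_space \<rightarrow>\<^sub>M count_space UNIV"
    by (rule measurable_compose[OF sel_measurable]) simp
  show "(\<lambda>x. quantize R p (coef x (fst (coef_pos t)) (snd (coef_pos t)))) \<in> path_space \<rightarrow>\<^sub>M count_space UNIV" for t
    unfolding quantize_def using coef_measurable by measurable
qed

lemma distributed_est: "distributed_estimator m est"
  unfolding distributed_estimator_def
proof (intro conjI ballI allI)
  fix i
  show "prob_space (seed est i)" by (simp add: est_def prob_space_return)
  show "sets (seed est i) = sets borel" by (simp add: est_def)
  show "encode est i \<in> path_space \<Otimes>\<^sub>M seed est i \<rightarrow>\<^sub>M count_space UNIV"
    unfolding est_def using enc_measurable by (simp add: measurable_compose[OF measurable_fst])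
next
  show "decode est y \<in> L2_unit" for y
    unfolding est_def using level_sums_L2[of "{..<dec_level y}" "dec_coef y"] by simp
qed

section \<open>Probability of the bad event\<close>

lemma prob_space_M: "prob_space M"
  using iw by (simp add: independent_wiener_def)

lemma emeasure_noise:
  assumes "k \<in> wavelet_index j" "i \<in> {1..m}"
  shows "{\<omega>\<in>space M. u \<le> \<bar>coef (\<lambda>t. W i t \<omega>) j k\<bar>} \<in> sets M"
    and "emeasure M {\<omega>\<in>space M. u \<le> \<bar>coef (\<lambda>t. W i t \<omega>) j k\<bar>} \<le> ennreal (2 * exp (- u\<^sup>2 / 8))"
proof -
  have "wiener_process M (W i)" using iw assms by (simp add: independent_wiener_def)
  then have sub: "subgaussian M 4 (\<lambda>\<omega>. coef (\<lambda>t. W i t \<omega>) j k)"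
    unfolding coef_def using D step_var[OF assms(1)]
    by (intro subgaussian_mono[OF subgaussian_step_functional])
  note [measurable] = subgaussian_measurable[OF sub]
  show "{\<omega>\<in>space M. u \<le> \<bar>coef (\<lambda>t. W i t \<omega>) j k\<bar>} \<in> sets M" by measurable
  show "emeasure M {\<omega>\<in>space M. u \<le> \<bar>coef (\<lambda>t. W i t \<omega>) j k\<bar>} \<le> ennreal (2 * exp (- u\<^sup>2 / 8))"
    using subgaussian_tail[OF sub, of u] n by (simp add: u_def)
qed

lemma emeasure_average_noise:
  assumes "k \<in> wavelet_index j"
  defines "X \<equiv> {\<omega>\<in>space M. u / sqrt (real m) \<le> \<bar>(\<Sum>i\<in>{1..m}. coef (\<lambda>t. W i t \<omega>) j k) / real m\<bar>}"
  shows "X \<in> sets M" "emeasure M X \<le> ennreal (2 * exp (- u\<^sup>2 / 8))"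
proof -
  have "subgaussian M ((\<Sum>l<D j k. (c j k l)\<^sup>2) / real (D j k) / real m)
      (\<lambda>\<omega>. (\<Sum>i\<in>{1..m}. coef (\<lambda>t. W i t \<omega>) j k) / real m)"
    unfolding coef_def using D m by (intro subgaussian_average[OF iw]) auto
  moreover have "(\<Sum>l<D j k. (c j k l)\<^sup>2) / real (D j k) / real m \<le> 4 / real m"
    using step_var[OF assms(1)] by (rule divide_right_mono) simp
  ultimately have sub: "subgaussian M (4 / real m) (\<lambda>\<omega>. (\<Sum>i\<in>{1..m}. coef (\<lambda>t. W i t \<omega>) j k) / real m)"
    by (rule subgaussian_mono)
  note [measurable] = subgaussian_measurable[OF sub]
  show "X \<in> sets M" unfolding X_def by measurable
  have "- (u / sqrt (real m))\<^sup>2 / (2 * (4 / real m)) = - u\<^sup>2 / 8"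
    using m by (simp add: power_divide)
  then show "emeasure M X \<le> ennreal (2 * exp (- u\<^sup>2 / 8))"
    unfolding X_def using subgaussian_tail[OF sub, of "u / sqrt (real m)"] m n by (simp add: u_def)
qed

lemma bad_sets: "bad \<in> sets M"
  unfolding bad_def
proof (rule sets.finite_UN)
  fix z assume "z \<in> Sigma {..Jn} wavelet_index"
  then obtain j k where z: "z = (j, k)" "k \<in> wavelet_index j" by blast
  show "(case z of (j, k) \<Rightarrow> (\<Union>i\<in>{1..m}. {\<omega>\<in>space M. u \<le> \<bar>coef (\<lambda>t. W i t \<omega>) j k\<bar>}) \<union>
     {\<omega>\<in>space M. u / sqrt (real m) \<le> \<bar>(\<Sum>i\<in>{1..m}. coef (\<lambda>t. W i t \<omega>) j k) / real m\<bar>}) \<in> sets M"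
    unfolding z(1) prod.case
    by (intro sets.Un sets.finite_UN finite_atLeastAtMost emeasure_noise(1)[OF z(2)] emeasure_average_noise(1)[OF z(2)])
qed simp

text \<open>Origin of the 32 in \<open>u\<close>: variance 4 gives the tail exp (-u^2 / 8), and the
  exponent 32/8 = 4 is large enough for a union over at most 2n coefficients with m + 1 <= n + 1
  events each.\<close>

lemma exp_u: "exp (- u\<^sup>2 / 8) = 1 / real n ^ 4"
proof -
  have "u\<^sup>2 = 32 * ln (real n)" unfolding u_def using n by (intro real_sqrt_pow2) auto
  then have "exp (- u\<^sup>2 / 8) = exp (- (real 4 * ln (real n)))" by simp
  also have "\<dots> = inverse (exp (ln (real n)) ^ 4)"
    unfolding exp_minus exp_of_nat_mult by simp
  also have "\<dots> = 1 / real n ^ 4" using n by (simp add: divide_inverse)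
  finally show ?thesis .
qed

lemma emeasure_bad: "emeasure M bad \<le> ennreal (1 / real n)"
proof -
  let ?q = "2 * exp (- u\<^sup>2 / 8)"
  let ?K = "Sigma {..Jn} wavelet_index"
  have q: "?q \<ge> 0" by simp
  define X where "X j k i = {\<omega>\<in>space M. u \<le> \<bar>coef (\<lambda>t. W i t \<omega>) j k\<bar>}" for j k i
  define Y where "Y j k = {\<omega>\<in>space M. u / sqrt (real m) \<le> \<bar>(\<Sum>i\<in>{1..m}. coef (\<lambda>t. W i t \<omega>) j k) / real m\<bar>}" for j k
  have X: "X j k i \<in> sets M" "emeasure M (X j k i) \<le> ennreal ?q"
    if "k \<in> wavelet_index j" "i \<in> {1..m}" for j k i
    unfolding X_def by (rule emeasure_noise[OF that])+
  have Y: "Y j k \<in> sets M" "emeasure M (Y j k) \<le> ennreal ?q" if "k \<in> wavelet_index j" for j k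
    unfolding Y_def by (rule emeasure_average_noise[OF that])+
  have XY: "(\<Union>i\<in>{1..m}. X j k i) \<union> Y j k \<in> sets M" if "k \<in> wavelet_index j" for j k
    by (intro sets.Un sets.finite_UN finite_atLeastAtMost X(1)[OF that] Y(1)[OF that])
  have each: "emeasure M ((\<Union>i\<in>{1..m}. X j k i) \<union> Y j k) \<le> ennreal ((real m + 1) * ?q)"
    if k: "k \<in> wavelet_index j" for j k
  proof -
    have "emeasure M ((\<Union>i\<in>{1..m}. X j k i) \<union> Y j k) \<le> emeasure M (\<Union>i\<in>{1..m}. X j k i) + emeasure M (Y j k)"
      by (intro emeasure_subadditive sets.finite_UN finite_atLeastAtMost X(1)[OF k] Y(1)[OF k])
    also have "\<dots> \<le> (\<Sum>i\<in>{1..m}. emeasure M (X j k i)) + emeasure M (Y j k)"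
      using X(1)[OF k] by (intro add_right_mono emeasure_subadditive_finite) auto
    also have "\<dots> \<le> (\<Sum>i\<in>{1..m}. ennreal ?q) + ennreal ?q"
      using X(2)[OF k] Y(2)[OF k] by (intro add_mono sum_mono)
    also have "\<dots> = ennreal (real m * ?q) + ennreal ?q"
      by (simp only: sum_ennreal[OF q] sum_constant card_atLeastAtMost diff_Suc_1 add_diff_cancel_right')
    also have "\<dots> = ennreal ((real m + 1) * ?q)"
      by (simp add: ennreal_plus[symmetric] distrib_right del: ennreal_plus)
    finally show ?thesis .
  qed
  have "bad = (\<Union>z\<in>?K. (\<Union>i\<in>{1..m}. X (fst z) (snd z) i) \<union> Y (fst z) (snd z))"
    unfolding bad_def X_def Y_def by (simp add: case_prod_beta)
  also have "emeasure M \<dots> \<le> (\<Sum>z\<in>?K. emeasure M ((\<Union>i\<in>{1..m}. X (fst z) (snd z) i) \<union> Y (fst z) (snd z)))"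
    using XY by (intro emeasure_subadditive_finite) auto
  also have "\<dots> \<le> (\<Sum>z\<in>?K. ennreal ((real m + 1) * ?q))"
    by (intro sum_mono each) auto
  also have "\<dots> = ennreal (real (card ?K) * ((real m + 1) * ?q))"
    by (subst sum_ennreal) auto
  also have "\<dots> \<le> ennreal (1 / real n)"
  proof (rule ennreal_leI)
    have "card ?K = 2 ^ Suc Jn"
      by (simp add: card_SigmaI sum_card_wavelet_index)
    moreover have "(2::real) ^ Jn \<le> real n"
      using Jm(4) powr_mono[of "real Jn" lg 2] by (simp add: powr_lg powr_realpow)
    ultimately have "real (card ?K) \<le> 2 * real n" by simp
    moreover have "(real m + 1) * ?q \<le> (real n + 1) * ?q" using m by (intro mult_right_mono) auto
    ultimately have "real (card ?K) * ((real m + 1) * ?q) \<le> 2 * real n * ((real n + 1) * ?q)"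
      by (intro mult_mono) auto
    also have "\<dots> = 4 * real n * (real n + 1) / real n ^ 4" unfolding exp_u by simp
    also have "\<dots> \<le> real n ^ 3 / real n ^ 4"
    proof (rule divide_right_mono)
      \<comment> \<open>The lower bound 8 on n is used here: the union bound totals 4 n (n + 1) /
        n^4, which has to stay below 1/n.\<close>
      have "4 * (real n + 1) \<le> real n * real n"
      proof -
        have "4 * (r + 1) \<le> r * r" if "8 \<le> r" for r :: real
        proof -
          have "8 * r \<le> r * r" by (rule mult_right_mono[OF that]) (use that in linarith)
          then show ?thesis by (rule order_trans[rotated]) (use that in simp)
        qed
        from this[of "real n"] show ?thesis using n by simp
      qed
      then have "real n * (4 * (real n + 1)) \<le> real n * (real n * real n)" by (rule mult_left_mono) simp
      then show "4 * real n * (real n + 1) \<le> real n ^ 3" by (simp add: power3_eq_cube algebra_simps)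
    qed simp
    also have "\<dots> = 1 / real n" using n by (simp add: power_numeral_reduce)
    finally show "real (card ?K) * ((real m + 1) * ?q) \<le> 1 / real n" .
  qed
  finally show ?thesis .
qed

end

context design
begin

lemma Kf_pos: "0 < Kf"
  unfolding Kf_def using L C_pos s by (auto simp: powr_less_one)

lemma besov_ball_smoother:
  assumes "f \<in> besov_ball \<psi> s L" "s1 \<le> s" "k \<in> wavelet_index j"
  shows "\<bar>L2_inner f (\<psi> j k)\<bar> \<le> L * 2 powr (- real j * (s1 + 1/2))" "\<bar>L2_inner f (\<psi> j k)\<bar> \<le> L"
proof -
  have "- real j * (s + 1/2) \<le> - real j * (s1 + 1/2)"
    using assms(2) by (intro mult_left_mono_neg) auto
  then have "2 powr (- real j * (s + 1/2)) \<le> 2 powr (- real j * (s1 + 1/2))"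
    by (intro powr_mono) auto
  then have "L * 2 powr (- real j * (s + 1/2)) \<le> L * 2 powr (- real j * (s1 + 1/2))"
    using L by (intro mult_left_mono) auto
  then show 1: "\<bar>L2_inner f (\<psi> j k)\<bar> \<le> L * 2 powr (- real j * (s1 + 1/2))"
    using besov_ball_coefficient[OF assms(1,3) L] by linarith
  have "- real j * (s1 + 1/2) \<le> 0" using s by (simp add: mult_nonneg_nonneg)
  then have "2 powr (- real j * (s1 + 1/2)) \<le> 2 powr 0" by (intro powr_mono) auto
  then have "L * 2 powr (- real j * (s1 + 1/2)) \<le> L * 1" using L by (intro mult_left_mono) auto
  then show "\<bar>L2_inner f (\<psi> j k)\<bar> \<le> L" using 1 by linarith
qed

text \<open>The step approximations of the wavelets are fixed without knowledge of s, so their error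
  bound needs one sup-norm constant for all s >= s1. The embedding into the class with s1 provides
  it.\<close>

lemma besov_ball_sup_bound:
  assumes "f \<in> besov_ball \<psi> s L" "s1 \<le> s"
  shows "AE x in unit_lebesgue. \<bar>f x\<bar> \<le> Kf"
  unfolding Kf_def
proof (rule besov_bounded)
  show "f \<in> L2_unit" using assms by (simp add: besov_ball_def)
  show "0 < s1" by (rule s)
qed (rule besov_ball_smoother(1)[OF assms])

definition sigma :: real where
  "sigma = sqrt (real m / real n)"

lemma coef_observation:
  "coef (observation n m f (W i) \<omega>) j k =
     step_functional (D j k) (c j k) (\<lambda>t. LINT x|lebesgue_on {0..t}. f x) + sigma * coef (\<lambda>t. W i t \<omega>) j k"
  unfolding coef_def observation_def step_functional_restrict[OF D] step_functional_linear sigma_def ..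

section \<open>Deterministic bounds outside the bad event\<close>

context
  fixes f s \<omega>
  assumes f: "f \<in> besov_ball \<psi> s L" and ss: "s1 \<le> s" "s \<le> s2"
    and \<omega>: "\<omega> \<in> space M" "\<omega> \<notin> bad"
begin

abbreviation Y where "Y i \<equiv> coef (observation n m f (W i) \<omega>)"

lemma approx: "k \<in> wavelet_index j \<Longrightarrow>
   \<bar>step_functional (D j k) (c j k) (\<lambda>t. LINT x|lebesgue_on {0..t}. f x) - L2_inner f (\<psi> j k)\<bar> \<le> 1 / real n"
  using f by (intro step_approx besov_ball_sup_bound[OF f ss(1)]) (auto simp: besov_ball_def)

lemma noise_machine:
  assumes "i \<in> {1..m}" "j \<le> Jn" "k \<in> wavelet_index j"
  shows "\<bar>coef (\<lambda>t. W i t \<omega>) j k\<bar> < u"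
proof (rule ccontr)
  assume "\<not> ?thesis"
  then have "\<omega> \<in> bad" unfolding bad_def using assms \<omega>(1) by (force simp: not_less)
  then show False using \<omega>(2) by simp
qed

lemma noise_average:
  assumes "j \<le> Jn" "k \<in> wavelet_index j"
  shows "\<bar>(\<Sum>i\<in>{1..m}. coef (\<lambda>t. W i t \<omega>) j k) / real m\<bar> < u / sqrt (real m)"
proof (rule ccontr)
  assume "\<not> ?thesis"
  then have "\<omega> \<in> bad" unfolding bad_def using assms \<omega>(1) by (force simp: not_less)
  then show False using \<omega>(2) by simp
qed

lemma machine_error:
  assumes "i \<in> {1..m}" "j \<le> Jn" "k \<in> wavelet_index j"
  shows "\<bar>Y i j k - L2_inner f (\<psi> j k)\<bar> \<le> 1 / real n + sigma * u"
proof -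
  have "\<bar>sigma * coef (\<lambda>t. W i t \<omega>) j k\<bar> \<le> sigma * u"
    unfolding abs_mult using noise_machine[OF assms] by (auto simp: sigma_def intro: mult_left_mono)
  then show ?thesis using approx[OF assms(3)] unfolding coef_observation by linarith
qed

lemma average_error:
  assumes "j \<le> Jn" "k \<in> wavelet_index j"
  shows "\<bar>(\<Sum>i\<in>{1..m}. Y i j k) / real m - L2_inner f (\<psi> j k)\<bar> \<le> 1 / real n + u / sqrt (real n)"
proof -
  let ?g = "step_functional (D j k) (c j k) (\<lambda>t. LINT x|lebesgue_on {0..t}. f x)"
  let ?Z = "(\<Sum>i\<in>{1..m}. coef (\<lambda>t. W i t \<omega>) j k) / real m"
  have "(\<Sum>i\<in>{1..m}. Y i j k) / real m = ?g + sigma * ?Z"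
    unfolding coef_observation sum.distrib sum_distrib_left[symmetric]
    using m by (simp add: add_divide_distrib)
  moreover have "\<bar>sigma * ?Z\<bar> \<le> sigma * (u / sqrt (real m))"
  proof -
    have s0: "0 \<le> sigma" by (simp add: sigma_def)
    show ?thesis
      unfolding abs_mult abs_of_nonneg[OF s0]
      by (rule mult_left_mono[OF less_imp_le[OF noise_average[OF assms]] s0])
  qed
  moreover have "sigma * (u / sqrt (real m)) = u / sqrt (real n)"
    using m by (simp add: sigma_def real_sqrt_divide)
  ultimately show ?thesis using approx[OF assms(2)] by linarith
qed

text \<open>The assumption \<open>noise\<close> is stated for the worst case, the top level \<rho>
  j1 of the block and the largest smoothness s2; all other levels and smoothness values only raise
  the right-hand side.\<close>

lemma sigma_u_Delta:
  assumes "j \<in> \<Delta>"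
  shows "1 / real n + sigma * u \<le> \<epsilon> * L / 4 * 2 powr (- real j * (s + 1/2))"
proof -
  have "real j * (s + 1/2) \<le> (\<rho> * real j1) * (s2 + 1/2)"
    using assms ss s by (intro mult_mono) (auto simp: \<Delta>_def)
  then have "2 powr (- \<rho> * real j1 * (s2 + 1/2)) \<le> 2 powr (- real j * (s + 1/2))"
    by (intro powr_mono) auto
  then have "\<epsilon> / 4 * L * 2 powr (- \<rho> * real j1 * (s2 + 1/2)) \<le> \<epsilon> / 4 * L * 2 powr (- real j * (s + 1/2))"
    using \<epsilon> L by (intro mult_left_mono) auto
  then show ?thesis using noise(1) unfolding sigma_def by simp
qed

lemma sel_le:
  assumes i: "i \<in> {1..m}"
  shows "real (sel (observation n m f (W i) \<omega>)) \<le> A / (1 + 2 * s) + 1"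
proof -
  let ?B = "A / (1 + 2 * s)"
  \<comment> \<open>The ideal level is A / (1 + 2 s), where 2^J is (n / log n)^(1/(1 + 2 s)).
    Rounding up costs at most 1, and the maximum respects the restriction J >= 1 in
    \<open>select_level\<close>.\<close>
  define J where "J = max 1 (nat \<lceil>?B\<rceil>)"
  have B: "0 \<le> ?B" using A_nonneg s ss by simp
  then have J: "?B \<le> real J" "real J \<le> ?B + 1" "1 \<le> J" unfolding J_def by linarith+
  have "sel (observation n m f (W i) \<omega>) \<le> J"
    unfolding sel_def
  proof (rule select_level_le[where f = "\<lambda>j k. L2_inner f (\<psi> j k)" and s = s])
    have "0 < 1 + 2 * s" using s ss by simp
    then show "A \<le> (1 + 2 * s) * real J" using J(1) by (simp add: pos_divide_le_eq mult.commute)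
    show "\<bar>L2_inner f (\<psi> j k)\<bar> \<le> L * 2 powr (- real j * (s + 1/2))" if "k \<in> wavelet_index j" for j k
      by (rule besov_ball_coefficient[OF f that L])
    fix j k assume jk: "j \<in> \<Delta>" "k \<in> wavelet_index j"
    have "\<bar>Y i j k - L2_inner f (\<psi> j k)\<bar> \<le> 1 / real n + sigma * u"
      by (rule machine_error[OF i Delta_le[OF jk(1)] jk(2)])
    also have "\<dots> \<le> \<epsilon> * L / 4 * 2 powr (- real j * (s + 1/2))" by (rule sigma_u_Delta[OF jk(1)])
    also have "\<dots> \<le> L * 2 powr (- real j * (s + 1/2))"
      using L \<epsilon> by (intro mult_right_mono) (auto simp: mult_le_cancel_right2)
    finally show "\<bar>Y i j k - L2_inner f (\<psi> j k)\<bar> \<le> L * 2 powr (- real j * (s + 1/2))" .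
  qed (use J L in auto)
  then have "real (sel (observation n m f (W i) \<omega>)) \<le> real J" by (rule of_nat_mono)
  then show ?thesis using J(2) by linarith
qed

text \<open>The defect in \<open>select_level_ge\<close> is proportional to J / j1. Here J <= log n
  while j1 is at least \<kappa> log n / 2, so the ratio is at most 2/\<kappa> and the defect is a
  constant. If the cap is reached, J is already at least A / (1 + 2 s1), which exceeds the ideal
  level.\<close>

lemma sel_ge:
  assumes i: "i \<in> {1..m}" and ssim: "f \<in> self_similar \<psi> s L \<epsilon> j0 \<rho>" and j0: "j0 \<le> j1"
  shows "A / (1 + 2 * s) - 4 * log 2 (8 / \<epsilon>) / \<kappa> \<le> real (sel (observation n m f (W i) \<omega>))"
proof -
  let ?J = "sel (observation n m f (W i) \<omega>)"
  let ?E = "log 2 (8 / \<epsilon>)"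
  have E: "0 \<le> ?E" using \<epsilon> by (simp add: zero_le_log_cancel_iff)
  have s': "0 < 1 + 2 * s" "1 \<le> 1 + 2 * s" using s ss by auto
  obtain j k where jk: "real j1 \<le> real j" "real j \<le> \<rho> * real j1" "k \<in> wavelet_index j"
    "\<epsilon> * L / 2 * 2 powr (- real j * (s + 1/2)) \<le> \<bar>L2_inner f (\<psi> j k)\<bar>"
    using self_similar_large_coefficient[OF ssim j0 L \<epsilon>(1)] by blast
  have j: "j \<in> \<Delta>" using jk by (simp add: \<Delta>_def)
  have "\<bar>Y i j k - L2_inner f (\<psi> j k)\<bar> \<le> \<epsilon> * L / 4 * 2 powr (- real j * (s + 1/2))"
    by (rule order_trans[OF machine_error[OF i Delta_le[OF j] jk(3)] sigma_u_Delta[OF j]])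
  then have "Jm \<le> ?J \<or> A \<le> real ?J * (1 + 2 * s) + 2 * ?E * (real ?J / real j1)"
    unfolding sel_def by (intro select_level_ge[where f = "\<lambda>j k. L2_inner f (\<psi> j k)", OF Jm_ge L \<epsilon> j jk(3,1) j1(1) jk(4)])
  then show ?thesis
  proof
    assume "Jm \<le> ?J"
    have "A / (1 + 2 * s) \<le> A / (1 + 2 * s1)"
      using A_nonneg s ss by (intro divide_left_mono) auto
    also have "\<dots> \<le> real ?J" using Jm(1) \<open>Jm \<le> ?J\<close> by linarith
    finally show ?thesis using E \<kappa> by (smt (verit) divide_nonneg_pos)
  next
    assume A: "A \<le> real ?J * (1 + 2 * s) + 2 * ?E * (real ?J / real j1)"
    have "?J \<le> Jm" unfolding sel_def by (rule select_level_props(2)[OF Jm_ge])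
    then have "real ?J \<le> lg" using Jm(3,4) by linarith
    also have "\<dots> \<le> 2 * real j1 / \<kappa>" using j1(2) \<kappa> by (simp add: pos_le_divide_eq mult.commute)
    finally have "real ?J / real j1 \<le> 2 / \<kappa>" using j1(1) by (simp add: pos_divide_le_eq)
    then have "2 * ?E * (real ?J / real j1) \<le> 2 * ?E * (2 / \<kappa>)" using E by (intro mult_left_mono) auto
    then have "A \<le> real ?J * (1 + 2 * s) + 4 * ?E / \<kappa>" using A by simp
    then have "A / (1 + 2 * s) \<le> (real ?J * (1 + 2 * s) + 4 * ?E / \<kappa>) / (1 + 2 * s)"
      using s' by (intro divide_right_mono) auto
    also have "\<dots> = real ?J + 4 * ?E / \<kappa> / (1 + 2 * s)" using s' by (simp add: add_divide_distrib)
    also have "4 * ?E / \<kappa> / (1 + 2 * s) \<le> 4 * ?E / \<kappa> / 1"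
      using s' E \<kappa> by (intro divide_left_mono) auto
    finally show ?thesis by simp
  qed
qed

end

section \<open>Communication cost\<close>

lemma width_le: "real width \<le> (real R + 3) * lg"
proof -
  have "real width = real R + 1 + real p" by (simp add: width_def)
  also have "\<dots> \<le> (real R + 2) + lg" using p(2) by simp
  also have "\<dots> \<le> (real R + 2) * lg + lg"
    using lg_ge mult_left_mono[of 1 lg "real R + 2"] by simp
  finally show ?thesis by (simp add: algebra_simps)
qed

lemma message_length:
  assumes "real (sel x) \<le> X + 1" "A / (1 + 2 * s2) \<le> X"
  shows "real (length (enc x)) \<le> lg * 2 powr X"
proof -
  \<comment> \<open>If the truncated subtraction gives 0, one word is still sent; then 0 <= X + 1 -
    c0 is needed, which follows from c0 <= A / (1 + 2 s2) <= X. Below, 2^c0 absorbs both the word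
    length (R + 3) log n and the factor 2 from rounding the level up.\<close>
  have "real (sel x - c0) \<le> X + 1 - real c0"
    using assms c0(2) by (cases "c0 \<le> sel x") (auto simp: of_nat_diff)
  then have "2 powr real (sel x - c0) \<le> 2 powr (X + 1 - real c0)" by (intro powr_mono) auto
  also have "\<dots> = 2 * 2 powr X / 2 ^ c0"
    by (simp add: powr_diff powr_add powr_realpow)
  finally have "2 ^ (sel x - c0) \<le> 2 * 2 powr X / 2 ^ c0" by (simp add: powr_realpow)
  then have "real width * 2 ^ (sel x - c0) \<le> ((real R + 3) * lg) * (2 * 2 powr X / 2 ^ c0)"
    using width_le lg_ge by (intro mult_mono) auto
  also have "\<dots> = (2 * (real R + 3) / 2 ^ c0) * (lg * 2 powr X)" by simp
  also have "\<dots> \<le> 1 * (lg * 2 powr X)"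
    using c0(1) lg_ge by (intro mult_right_mono) (auto simp: pos_divide_le_eq)
  finally show ?thesis by (simp add: enc_def)
qed

lemma sel_le_Jm: "sel x \<le> Jm"
  unfolding sel_def by (rule select_level_props(2)[OF Jm_ge])

lemma bits_bound: "real (bits n m W est f i \<omega> v) \<le> lg * 2 powr (A / (1 + 2 * s1))"
proof -
  have "A / (1 + 2 * s2) \<le> A / (1 + 2 * s1)"
    using A_nonneg s by (intro divide_left_mono) auto
  moreover have "real (sel x) \<le> A / (1 + 2 * s1) + 1" for x
    using sel_le_Jm[of x] Jm(2) by linarith
  ultimately show ?thesis
    unfolding bits_def message_def est_def by (simp add: message_length)
qed

lemma max_bits_le_n: "lg * 2 powr (A / (1 + 2 * s1)) \<le> real n"
proof -
  have "A / (1 + 2 * s1) \<le> A / 1" using A_nonneg s by (intro divide_left_mono) auto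
  then have "2 powr (A / (1 + 2 * s1)) \<le> 2 powr A" by (intro powr_mono) auto
  then have "lg * 2 powr (A / (1 + 2 * s1)) \<le> lg * 2 powr A"
    using lg_ge by (intro mult_left_mono) auto
  also have "\<dots> = real n" using lg_ge by (simp add: powr_A)
  finally show ?thesis .
qed

lemma expected_bits_bound:
  assumes f: "f \<in> besov_ball \<psi> s L" and ss: "s1 \<le> s" "s \<le> s2" and i: "i \<in> {1..m}"
  shows "expected_bits n m M W est f i \<le> ennreal (2 * (lg * 2 powr (A / (1 + 2 * s))))"
proof -
  let ?r = "lg * 2 powr (A / (1 + 2 * s))"
  let ?S = "return borel 0 :: real measure"
  interpret M: prob_space M by (rule prob_space_M)
  interpret S: prob_space ?S by (rule prob_space_return) simp
  interpret P: pair_prob_space M ?S ..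
  have A0: "0 \<le> A / (1 + 2 * s)" using A_nonneg s ss by simp
  \<comment> \<open>On the bad event the length is at most n and the probability at most 1/n, so the
    event adds one bit on average; 1 <= r absorbs it into the constant 2.\<close>
  have r: "1 \<le> ?r" using lg_ge ge_one_powr_ge_zero[of 2, OF _ A0] mult_mono[of 1 lg 1 "2 powr (A / (1 + 2 * s))"] by simp
  have "expected_bits n m M W est f i \<le>
      (\<integral>\<^sup>+ z. ennreal ?r + ennreal (real n) * indicator (bad \<times> space ?S) z \<partial>(M \<Otimes>\<^sub>M ?S))"
    unfolding expected_bits_def est_def dist_estimator.simps
  proof (intro nn_integral_mono, clarify)
    fix \<omega> v assume z: "(\<omega>, v) \<in> space (M \<Otimes>\<^sub>M ?S)"
    then have \<omega>: "\<omega> \<in> space M" by (simp add: space_pair_measure)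
    show "ennreal (real (bits n m W \<lparr>seed = \<lambda>_. return borel 0, encode = \<lambda>_ z. enc (fst z),
            decode = \<lambda>y x. \<Sum>j<dec_level y. level_sum (dec_coef y) j x\<rparr> f i \<omega> v))
      \<le> ennreal ?r + ennreal (real n) * indicator (bad \<times> space ?S) (\<omega>, v)"
      unfolding est_def[symmetric]
    proof (cases "\<omega> \<in> bad")
      case True
      have "ennreal (real (bits n m W est f i \<omega> v)) \<le> ennreal (real n)"
        by (intro ennreal_leI order_trans[OF bits_bound max_bits_le_n])
      also have "\<dots> = ennreal (real n) * indicator (bad \<times> space ?S) (\<omega>, v)"
        using True z by (simp add: space_pair_measure)
      also have "\<dots> \<le> ennreal ?r + ennreal (real n) * indicator (bad \<times> space ?S) (\<omega>, v)" by simp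
      finally show "ennreal (real (bits n m W est f i \<omega> v)) \<le> \<dots>" .
    next
      case False
      have "A / (1 + 2 * s2) \<le> A / (1 + 2 * s)"
        using A_nonneg s ss by (intro divide_left_mono) auto
      then have "real (bits n m W est f i \<omega> v) \<le> ?r"
        unfolding bits_def message_def using message_length[OF sel_le[OF f ss \<omega> False i]]
        by (simp add: est_def)
      then have "ennreal (real (bits n m W est f i \<omega> v)) \<le> ennreal ?r" by (rule ennreal_leI)
      then show "ennreal (real (bits n m W est f i \<omega> v)) \<le>
         ennreal ?r + ennreal (real n) * indicator (bad \<times> space ?S) (\<omega>, v)"
        by (rule order_trans) simp
    qed
  qed
  also have "\<dots> = ennreal ?r + ennreal (real n) * emeasure (M \<Otimes>\<^sub>M ?S) (bad \<times> space ?S)"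
  proof -
    have B: "bad \<times> space ?S \<in> sets (M \<Otimes>\<^sub>M ?S)" by (intro pair_measureI bad_sets sets.top)
    have "(\<integral>\<^sup>+ z. ennreal ?r + ennreal (real n) * indicator (bad \<times> space ?S) z \<partial>(M \<Otimes>\<^sub>M ?S)) =
        (\<integral>\<^sup>+ z. ennreal ?r \<partial>(M \<Otimes>\<^sub>M ?S)) + (\<integral>\<^sup>+ z. ennreal (real n) * indicator (bad \<times> space ?S) z \<partial>(M \<Otimes>\<^sub>M ?S))"
    proof -
      note [measurable] = B
      show ?thesis by (rule nn_integral_add) measurable
    qed
    then show ?thesis
      by (simp only: nn_integral_cmult_indicator[OF B] nn_integral_const P.emeasure_space_1 mult_1_right)
  qed
  also have "emeasure (M \<Otimes>\<^sub>M ?S) (bad \<times> space ?S) = emeasure M bad"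
    by (simp only: S.emeasure_pair_measure_Times[OF bad_sets sets.top] S.emeasure_space_1 mult_1_right)
  also have "ennreal ?r + ennreal (real n) * emeasure M bad \<le> ennreal ?r + ennreal (real n) * ennreal (1 / real n)"
    by (intro add_left_mono mult_left_mono emeasure_bad) simp
  also have "\<dots> = ennreal (?r + 1)"
    using n r by (subst ennreal_plus) (auto simp: ennreal_mult[symmetric])
  also have "\<dots> \<le> ennreal (2 * ?r)" using r by (intro ennreal_leI) simp
  finally show ?thesis .
qed

section \<open>Decoding and the sup-norm loss\<close>

lemma dec_level_eq:
  "dec_level (\<lambda>i\<in>{1..m}. enc (x i)) = Min ((\<lambda>i. sel (x i) - c0) ` {1..m})"
proof -
  have "(\<lambda>i. floor_log (length ((\<lambda>i\<in>{1..m}. enc (x i)) i) div width)) ` {1..m} = (\<lambda>i. sel (x i) - c0) ` {1..m}"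
    using width_pos by (intro image_cong refl) (simp add: enc_def)
  then show ?thesis by (simp only: dec_level_def)
qed

text \<open>Below the minimal level every machine has sent the coefficient, so \<open>unpack\<close>
  stays inside each message and the words are recovered exactly.\<close>

lemma dec_coef_eq:
  assumes "j < dec_level (\<lambda>i\<in>{1..m}. enc (x i))" "k \<in> wavelet_index j"
  shows "dec_coef (\<lambda>i\<in>{1..m}. enc (x i)) j k =
    (\<Sum>i\<in>{1..m}. dequantize R p (take_bit (R + 1 + p) (quantize R p (coef (x i) j k)))) / real m"
  unfolding dec_coef_def
proof (intro arg_cong[where f = "\<lambda>a. a / real m"] sum.cong refl)
  fix i assume i: "i \<in> {1..m}"
  have "dec_level (\<lambda>i\<in>{1..m}. enc (x i)) \<le> sel (x i) - c0"
    unfolding dec_level_eq using i by (intro Min_le) auto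
  then have "j < sel (x i) - c0" using assms(1) by simp
  then have "coef_index j k < 2 ^ (sel (x i) - c0)" by (rule coef_index_less[OF assms(2)])
  then show "dequantize R p (unpack width ((\<lambda>i\<in>{1..m}. enc (x i)) i) (coef_index j k)) =
      dequantize R p (take_bit (R + 1 + p) (quantize R p (coef (x i) j k)))"
    using i by (simp add: enc_def unpack_pack coef_pos_index[OF assms(2)] width_def)
qed

lemma average_le:
  assumes "\<And>i. i \<in> {1..m} \<Longrightarrow> \<bar>a i\<bar> \<le> b"
  shows "\<bar>(\<Sum>i\<in>{1..m}. a i) / real m\<bar> \<le> b"
proof -
  have "\<bar>\<Sum>i\<in>{1..m}. a i\<bar> \<le> (\<Sum>i\<in>{1..m}. b)"
    by (rule order_trans[OF sum_abs sum_mono]) (rule assms)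
  then show ?thesis using m by (simp add: abs_divide pos_divide_le_eq mult.commute)
qed

lemma dec_level_le: "dec_level (\<lambda>i\<in>{1..m}. enc (x i)) \<le> Jm"
proof -
  have "dec_level (\<lambda>i\<in>{1..m}. enc (x i)) \<le> sel (x 1) - c0"
    unfolding dec_level_eq using m by (intro Min_le) auto
  then show ?thesis using sel_le_Jm[of "x 1"] by linarith
qed

lemma estimate_eq:
  "estimate n m W est f z = (\<lambda>x. \<Sum>j<dec_level (\<lambda>i\<in>{1..m}. enc (observation n m f (W i) (fst z))).
     level_sum (dec_coef (\<lambda>i\<in>{1..m}. enc (observation n m f (W i) (fst z)))) j x)"
  by (simp add: estimate_def message_def est_def)

definition crude_const :: real where
  "crude_const = 4 * (2 ^ R + L) * C + Kf"

lemma crude_const_pos: "0 < crude_const"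
  unfolding crude_const_def using L C_pos Kf_pos by (intro add_pos_pos mult_pos_pos) auto

lemma decay_const_mono:
  assumes "s1 \<le> s" "0 \<le> b"
  shows "L * C * b / (1 - 2 powr (- s)) \<le> Kf * b"
proof -
  have "2 powr (- s) \<le> 2 powr (- s1)" using assms by (intro powr_mono) auto
  moreover have "2 powr (- s1) < 1" "2 powr (- s) < 1" using s assms(1) by (simp_all add: powr_less_one)
  ultimately have "L * C * b / (1 - 2 powr (- s)) \<le> L * C * b / (1 - 2 powr (- s1))"
    using L C_pos assms(2) by (intro divide_left_mono mult_nonneg_nonneg mult_pos_pos) auto
  then show ?thesis by (simp add: Kf_def)
qed

text \<open>Holds for every outcome: decoded coefficients are bounded by 2^R even after overflow,
  and at most log n levels are used, so localization costs no more than 2^(log n / 2) = sqrt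
  n.\<close>

lemma loss_bound_crude:
  assumes f: "f \<in> besov_ball \<psi> s L" and ss: "s1 \<le> s"
  shows "Linf_norm (\<lambda>x. estimate n m W est f z x - f x) \<le> ennreal (crude_const * sqrt (real n))"
proof -
  define y where "y = (\<lambda>i\<in>{1..m}. enc (observation n m f (W i) (fst z)))"
  have s': "0 < s" using s ss by simp
  have "Linf_norm (\<lambda>x. (\<Sum>j<dec_level y. level_sum (dec_coef y) j x) - f x) \<le>
    ennreal (4 * (2 ^ R + L) * C * 2 powr (real (dec_level y) / 2)
      + L * C * 2 powr (- real (dec_level y) * s) / (1 - 2 powr (- s)))"
  proof (rule Linf_norm_truncated_series[OF _ s'])
    show "f \<in> L2_unit" using f by (simp add: besov_ball_def)
    show "\<bar>L2_inner f (\<psi> j k)\<bar> \<le> L * 2 powr (- real j * (s + 1/2))" if "k \<in> wavelet_index j" for j k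
      by (rule besov_ball_coefficient[OF f that L])
    show "0 \<le> 2 ^ R + L" using L by simp
    fix j k assume jk: "j < dec_level y" "k \<in> wavelet_index j"
    have "\<bar>dec_coef y j k\<bar> \<le> 2 ^ R"
      unfolding y_def dec_coef_eq[OF jk(1)[unfolded y_def] jk(2)]
      by (rule average_le) (rule dequantize_bound)
    then show "\<bar>dec_coef y j k - L2_inner f (\<psi> j k)\<bar> \<le> 2 ^ R + L"
      using besov_ball_smoother(2)[OF f ss jk(2)] by linarith
  qed
  also have "\<dots> \<le> ennreal (crude_const * sqrt (real n))"
  proof (rule ennreal_leI)
    have "real (dec_level y) \<le> lg"
      using dec_level_le[of "\<lambda>i. observation n m f (W i) (fst z)"] Jm(3,4) unfolding y_def by linarith
    then have "2 powr (real (dec_level y) / 2) \<le> 2 powr (lg / 2)" by (intro powr_mono) auto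
    also have "\<dots> = sqrt (real n)"
      unfolding powr_lg[symmetric] by (simp add: powr_half_sqrt[symmetric] powr_powr)
    finally have 1: "4 * (2 ^ R + L) * C * 2 powr (real (dec_level y) / 2) \<le> 4 * (2 ^ R + L) * C * sqrt (real n)"
      using L C_pos by (intro mult_left_mono) auto
    have "2 powr (- real (dec_level y) * s) \<le> 2 powr 0" using s' by (intro powr_mono) auto
    then have b: "2 powr (- real (dec_level y) * s) \<le> 1" by simp
    have "L * C * 2 powr (- real (dec_level y) * s) / (1 - 2 powr (- s)) \<le> Kf * 2 powr (- real (dec_level y) * s)"
      by (rule decay_const_mono[OF ss]) simp
    also have "\<dots> \<le> Kf * sqrt (real n)"
      using b n Kf_pos by (intro mult_left_mono order_trans[OF b]) auto
    finally show "4 * (2 ^ R + L) * C * 2 powr (real (dec_level y) / 2)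
      + L * C * 2 powr (- real (dec_level y) * s) / (1 - 2 powr (- s)) \<le> crude_const * sqrt (real n)"
      using 1 by (simp add: crude_const_def distrib_right)
  qed
  finally show ?thesis unfolding estimate_eq y_def .
qed

text \<open>64 = 4 * 8 * 2: the level sum bound, the coefficient error in
  \<open>average_error_rate\<close>, and the rounding of T by at most one level, bounded by a factor
  2. The second term is the bias when T falls short of the ideal level by the selection defect and
  c0, evaluated at the worst case s2.\<close>

definition good_const :: real where
  "good_const = 64 * C + Kf * 2 powr ((4 * log 2 (8 / \<epsilon>) / \<kappa> + real c0) * s2)"

lemma good_const_pos: "0 < good_const"
  unfolding good_const_def using C_pos Kf_pos by (intro add_pos_pos mult_pos_pos) auto

lemma sqrt_noise: "sqrt (lg / real n) = 2 powr (- A / 2)"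
proof -
  have "lg / real n = 2 powr (- A)" using lg_ge by (simp add: powr_minus powr_A)
  then show ?thesis by (simp add: powr_half_sqrt[symmetric] powr_powr)
qed

text \<open>The two terms 1/n are the step approximation and the quantization. With ln n <= log n
  they and the noise are at most 2 and 6 times sqrt (log n / n), which is 2^(-A/2).\<close>

lemma average_error_rate: "2 / real n + u / sqrt (real n) \<le> 8 * 2 powr (- A / 2)"
proof -
  have "ln (real n) \<le> lg"
  proof -
    have "lg * ln 2 = ln (real n)" by (simp add: lg_def log_def)
    moreover have "lg * ln 2 \<le> lg * 1" using lg_ge ln_2_less_1 by (intro mult_left_mono) auto
    ultimately show ?thesis by simp
  qed
  then have "u \<le> sqrt (36 * lg)" unfolding u_def using lg_ge by (intro real_sqrt_le_mono) auto
  also have "\<dots> = 6 * sqrt lg" by (simp add: real_sqrt_mult)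
  finally have "u / sqrt (real n) \<le> 6 * sqrt lg / sqrt (real n)" by (rule divide_right_mono) simp
  then have 1: "u / sqrt (real n) \<le> 6 * sqrt (lg / real n)" by (simp add: real_sqrt_divide)
  have "1 / real n \<le> sqrt (lg / real n)"
  proof (rule real_le_rsqrt)
    have "(1 / real n)\<^sup>2 = (1 / real n) * (1 / real n)" by (simp add: power2_eq_square)
    also have "\<dots> \<le> lg * (1 / real n)" using n lg_ge by (intro mult_right_mono) (auto intro: order_trans[of _ 1])
    finally show "(1 / real n)\<^sup>2 \<le> lg / real n" by simp
  qed
  then have "2 / real n \<le> 2 * sqrt (lg / real n)" by simp
  then show ?thesis using 1 by (simp add: sqrt_noise)
qed

lemma loss_bound_good:
  assumes ssim: "f \<in> self_similar \<psi> s L \<epsilon> j0 \<rho>" and j0: "j0 \<le> j1" and ss: "s1 \<le> s" "s \<le> s2"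
    and \<omega>: "fst z \<in> space M" "fst z \<notin> bad"
  shows "Linf_norm (\<lambda>x. estimate n m W est f z x - f x) \<le> ennreal (good_const * 2 powr (- (A * s / (1 + 2 * s))))"
proof -
  let ?x = "\<lambda>i. observation n m f (W i) (fst z)"
  define y where "y = (\<lambda>i\<in>{1..m}. enc (?x i))"
  define T where "T = dec_level y"
  let ?b = "8 * 2 powr (- A / 2)"
  let ?B = "A / (1 + 2 * s)"
  let ?G = "4 * log 2 (8 / \<epsilon>) / \<kappa> + real c0"
  let ?r = "2 powr (- (A * s / (1 + 2 * s)))"
  have f: "f \<in> besov_ball \<psi> s L" using ssim by (simp add: self_similar_def)
  have s': "0 < s" "0 < 1 + 2 * s" using s ss by auto
  \<comment> \<open>The minimum is attained by some machine, so the two-sided bound for the level of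
    one machine carries over to T.\<close>
  have "dec_level y \<in> (\<lambda>i. sel (?x i) - c0) ` {1..m}"
    unfolding y_def dec_level_eq using m by (intro Min_in) auto
  then obtain i where i: "i \<in> {1..m}" "T = sel (?x i) - c0" unfolding T_def by blast
  have T_le: "real T \<le> ?B + 1" using sel_le[OF f ss \<omega> i(1)] i(2) by linarith
  have T_ge: "?B - ?G \<le> real T" using sel_ge[OF f ss \<omega> i(1) ssim j0] i(2) by linarith
  have TJ: "T \<le> Jm" unfolding T_def y_def by (rule dec_level_le)
  have "Linf_norm (\<lambda>x. (\<Sum>j<T. level_sum (dec_coef y) j x) - f x) \<le>
    ennreal (4 * ?b * C * 2 powr (real T / 2) + L * C * 2 powr (- real T * s) / (1 - 2 powr (- s)))"
  proof (rule Linf_norm_truncated_series[OF _ s'(1)])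
    show "f \<in> L2_unit" using f by (simp add: besov_ball_def)
    show "\<bar>L2_inner f (\<psi> j k)\<bar> \<le> L * 2 powr (- real j * (s + 1/2))" if "k \<in> wavelet_index j" for j k
      by (rule besov_ball_coefficient[OF f that L])
    show "0 \<le> ?b" by simp
    fix j k assume jk: "j < T" "k \<in> wavelet_index j"
    have jn: "j \<le> Jn" using jk(1) TJ Jm(3) by linarith
    let ?d = "\<lambda>i. dequantize R p (take_bit (R + 1 + p) (quantize R p (coef (?x i) j k)))"
    have dq: "\<bar>?d i - coef (?x i) j k\<bar> \<le> 1 / real n" if i: "i \<in> {1..m}" for i
    proof -
      \<comment> \<open>No overflow: the true coefficient is at most L and the local error at most
        1, whereas the range leaves L + 2.\<close>
      have "\<bar>coef (?x i) j k\<bar> < 2 ^ R"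
        using machine_error[OF f ss \<omega> i jn jk(2)] noise(2) besov_ball_smoother(2)[OF f ss(1) jk(2)] R
        unfolding sigma_def by linarith
      then have "\<bar>?d i - coef (?x i) j k\<bar> \<le> 1 / 2 ^ p" by (rule dequantize_quantize)
      also have "\<dots> \<le> 1 / real n" using p(1) n by (intro divide_left_mono) auto
      finally show ?thesis .
    qed
    have "dec_coef y j k - (\<Sum>i\<in>{1..m}. coef (?x i) j k) / real m = (\<Sum>i\<in>{1..m}. ?d i - coef (?x i) j k) / real m"
      unfolding y_def dec_coef_eq[OF jk(1)[unfolded T_def y_def] jk(2)]
      by (simp add: sum_subtractf diff_divide_distrib)
    also have "\<bar>\<dots>\<bar> \<le> 1 / real n" by (rule average_le) (rule dq)
    finally have "\<bar>dec_coef y j k - (\<Sum>i\<in>{1..m}. coef (?x i) j k) / real m\<bar> \<le> 1 / real n" .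
    then have "\<bar>dec_coef y j k - L2_inner f (\<psi> j k)\<bar> \<le> 2 / real n + u / sqrt (real n)"
      using average_error[OF f ss \<omega> jn jk(2)] by linarith
    then show "\<bar>dec_coef y j k - L2_inner f (\<psi> j k)\<bar> \<le> ?b" using average_error_rate by linarith
  qed
  also have "\<dots> \<le> ennreal (good_const * ?r)"
  proof (rule ennreal_leI)
    have "?b * 2 powr (real T / 2) \<le> ?b * 2 powr (?B / 2 + 1)"
    proof (intro mult_left_mono powr_mono)
      have "t / 2 \<le> b / 2 + 1" if "t \<le> b + 1" for t b :: real using that by simp
      from this[OF T_le] show "real T / 2 \<le> ?B / 2 + 1" .
    qed auto
    also have "\<dots> = 16 * 2 powr (- A / 2 + ?B / 2)"
      by (simp only: powr_add) simp
    \<comment> \<open>The balance that defines the ideal level B = A / (1 + 2 s): the noise 2^(-A/2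
      + B/2) and the bias 2^(-B s) have the same exponent.\<close>
    also have "- A / 2 + ?B / 2 = - (A * s / (1 + 2 * s))"
      using s'(2) by (simp add: field_simps)
    finally have "4 * C * (?b * 2 powr (real T / 2)) \<le> 4 * C * (16 * ?r)"
      using C_pos by (intro mult_left_mono) auto
    then have 1: "4 * ?b * C * 2 powr (real T / 2) \<le> 64 * C * ?r" by (simp add: mult_ac)
    have E: "0 \<le> log 2 (8 / \<epsilon>)" using \<epsilon> by (simp add: zero_le_log_cancel_iff)
    have G: "0 \<le> ?G" using E \<kappa> by (intro add_nonneg_nonneg divide_nonneg_pos mult_nonneg_nonneg) auto
    have "(?B - ?G) * s \<le> real T * s" using T_ge s' by (intro mult_right_mono) auto
    moreover have "?G * s \<le> ?G * s2" using G ss by (intro mult_left_mono) auto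
    moreover have "?B * s = A * s / (1 + 2 * s)" by simp
    ultimately have "- real T * s \<le> ?G * s2 + - (A * s / (1 + 2 * s))"
      unfolding left_diff_distrib by linarith
    then have "2 powr (- real T * s) \<le> 2 powr (?G * s2) * ?r"
      unfolding powr_add[symmetric] by (intro powr_mono) auto
    then have "Kf * 2 powr (- real T * s) \<le> Kf * (2 powr (?G * s2) * ?r)"
      using Kf_pos by (intro mult_left_mono) auto
    moreover have "L * C * 2 powr (- real T * s) / (1 - 2 powr (- s)) \<le> Kf * 2 powr (- real T * s)"
      by (rule decay_const_mono[OF ss(1)]) simp
    ultimately show "4 * ?b * C * 2 powr (real T / 2) + L * C * 2 powr (- real T * s) / (1 - 2 powr (- s)) \<le> good_const * ?r"
      using 1 unfolding good_const_def distrib_right mult.assoc by linarith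
  qed
  finally show ?thesis unfolding estimate_eq y_def T_def .
qed

lemma sup_risk_bound:
  assumes ssim: "f \<in> self_similar \<psi> s L \<epsilon> j0 \<rho>" and j0: "j0 \<le> j1" and ss: "s1 \<le> s" "s \<le> s2"
  shows "sup_risk n m M W est f \<le> ennreal ((good_const + crude_const) * 2 powr (- (A * s / (1 + 2 * s))))"
proof -
  let ?r = "2 powr (- (A * s / (1 + 2 * s)))"
  let ?b = "crude_const * sqrt (real n)"
  let ?S = "\<Pi>\<^sub>M i\<in>{1..m}. seed est i"
  have f: "f \<in> besov_ball \<psi> s L" using ssim by (simp add: self_similar_def)
  interpret M: prob_space M by (rule prob_space_M)
  interpret S: prob_space ?S
    by (rule prob_space_PiM) (simp add: est_def prob_space_return)
  interpret P: pair_prob_space M ?S ..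
  have B: "bad \<times> space ?S \<in> sets (M \<Otimes>\<^sub>M ?S)" by (intro pair_measureI bad_sets sets.top)
  have "sup_risk n m M W est f \<le>
      (\<integral>\<^sup>+ z. ennreal (good_const * ?r) + ennreal ?b * indicator (bad \<times> space ?S) z \<partial>(M \<Otimes>\<^sub>M ?S))"
    unfolding sup_risk_def joint_space_def
  proof (intro nn_integral_mono)
    fix z assume z: "z \<in> space (M \<Otimes>\<^sub>M ?S)"
    show "Linf_norm (\<lambda>x. estimate n m W est f z x - f x) \<le>
      ennreal (good_const * ?r) + ennreal ?b * indicator (bad \<times> space ?S) z"
    proof (cases "fst z \<in> bad")
      case True
      then have "z \<in> bad \<times> space ?S" using z by (auto simp: space_pair_measure)
      then have "ennreal ?b \<le> ennreal (good_const * ?r) + ennreal ?b * indicator (bad \<times> space ?S) z"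
        by simp
      then show ?thesis by (rule order_trans[OF loss_bound_crude[OF f ss(1)]])
    next
      case False
      have "fst z \<in> space M" using z by (auto simp: space_pair_measure)
      from loss_bound_good[OF ssim j0 ss this False] show ?thesis
        by (rule order_trans) simp
    qed
  qed
  also have "\<dots> = ennreal (good_const * ?r) + ennreal ?b * emeasure (M \<Otimes>\<^sub>M ?S) (bad \<times> space ?S)"
  proof -
    note [measurable] = B
    have "(\<integral>\<^sup>+ z. ennreal (good_const * ?r) + ennreal ?b * indicator (bad \<times> space ?S) z \<partial>(M \<Otimes>\<^sub>M ?S)) =
        (\<integral>\<^sup>+ z. ennreal (good_const * ?r) \<partial>(M \<Otimes>\<^sub>M ?S)) + (\<integral>\<^sup>+ z. ennreal ?b * indicator (bad \<times> space ?S) z \<partial>(M \<Otimes>\<^sub>M ?S))"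
      by (rule nn_integral_add) measurable
    then show ?thesis
      by (simp only: nn_integral_cmult_indicator[OF B] nn_integral_const P.emeasure_space_1 mult_1_right)
  qed
  also have "emeasure (M \<Otimes>\<^sub>M ?S) (bad \<times> space ?S) = emeasure M bad"
    by (simp only: S.emeasure_pair_measure_Times[OF bad_sets sets.top] S.emeasure_space_1 mult_1_right)
  also have "ennreal (good_const * ?r) + ennreal ?b * emeasure M bad \<le>
      ennreal (good_const * ?r) + ennreal ?b * ennreal (1 / real n)"
    by (intro add_left_mono mult_left_mono emeasure_bad) simp
  also have "\<dots> = ennreal (good_const * ?r + ?b * (1 / real n))"
    using good_const_pos crude_const_pos by (subst ennreal_plus) (auto simp: ennreal_mult[symmetric])
  also have "\<dots> \<le> ennreal ((good_const + crude_const) * ?r)"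
  proof (rule ennreal_leI)
    \<comment> \<open>The bad event contributes sqrt n * (1/n) = n^(-1/2), which is below the rate
      because s / (1 + 2 s) < 1/2 and A <= log n.\<close>
    have "A * s / (1 + 2 * s) \<le> A / 2"
      using s ss A_nonneg by (simp add: pos_divide_le_eq algebra_simps)
    then have "A * s / (1 + 2 * s) \<le> lg / 2" using A_le_lg by linarith
    then have "2 powr (- (lg / 2)) \<le> ?r" by (intro powr_mono) auto
    moreover have "2 powr (- (lg / 2)) = 1 / sqrt (2 powr lg)"
      by (simp add: powr_minus_divide powr_half_sqrt[symmetric] powr_powr)
    moreover have "sqrt (real n) * (1 / real n) = 1 / sqrt (real n)"
      using n by (simp add: field_simps real_sqrt_mult_self)
    ultimately have "sqrt (real n) * (1 / real n) \<le> ?r" by (simp add: powr_lg)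
    then have "crude_const * (sqrt (real n) * (1 / real n)) \<le> crude_const * ?r"
      using crude_const_pos by (intro mult_left_mono) auto
    then show "good_const * ?r + ?b * (1 / real n) \<le> (good_const + crude_const) * ?r"
      by (simp add: algebra_simps)
  qed
  finally show ?thesis .
qed

end

section \<open>Choice of the parameters\<close>

text \<open>The distance between the noise exponent \<gamma>/2 and the signal exponent \<gamma>/4
  absorbs the factor sqrt (log n) of the union bound and the constant a.\<close>

lemma eventually_noise_small:
  fixes \<gamma> a :: real
  assumes "0 < \<gamma>" "\<gamma> < 1" "0 < a"
  shows "\<forall>\<^sub>F n::nat in sequentially.
    1 / real n + real n powr (- \<gamma> / 2) * sqrt (32 * ln (real n)) \<le> a * real n powr (- \<gamma> / 4)"
proof -
  have "\<forall>\<^sub>F n::nat in sequentially. 1 / real n \<le> a / 2 * real n powr (- \<gamma> / 4)"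
    using assms by real_asymp
  moreover have "\<forall>\<^sub>F n::nat in sequentially.
     real n powr (- \<gamma> / 2) * sqrt (32 * ln (real n)) \<le> a / 2 * real n powr (- \<gamma> / 4)"
    using assms by real_asymp
  ultimately show ?thesis
    by eventually_elim (simp add: field_simps)
qed

text \<open>The claim for a single n, with the ratios multiplied out. The constant K is an argument,
  so that one value can be fixed before n, the number of machines and the probability space.\<close>

definition rate_optimal ::
  "(nat \<Rightarrow> nat \<Rightarrow> real \<Rightarrow> real) \<Rightarrow> real \<Rightarrow> real \<Rightarrow> real \<Rightarrow> real \<Rightarrow> nat \<Rightarrow> real \<Rightarrow> real \<Rightarrow>
    nat \<Rightarrow> nat \<Rightarrow> 'w measure \<Rightarrow> (nat \<Rightarrow> real \<Rightarrow> 'w \<Rightarrow> real) \<Rightarrow> dist_estimator \<Rightarrow> bool" where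
  "rate_optimal \<psi> s1 s2 L \<epsilon> j0 \<rho> K n m M W e \<longleftrightarrow>
     distributed_estimator m e \<and>
     (\<forall>f i \<omega> u. real (bits n m W e f i \<omega> u)
        \<le> (real n / log 2 (real n)) powr (1 / (1 + 2 * s1)) * log 2 (real n)) \<and>
     (\<forall>s\<in>{s1..s2}. \<forall>f\<in>self_similar \<psi> s L \<epsilon> j0 \<rho>.
        (\<forall>i\<in>{1..m}. expected_bits n m M W e f i \<le>
           ennreal (K * (real n powr (1 / (1 + 2 * s)) * log 2 (real n) powr (2 * s / (1 + 2 * s))))) \<and>
        sup_risk n m M W e f \<le> ennreal (K * (real n / log 2 (real n)) powr (- s / (1 + 2 * s))))"

lemma (in design) rate_optimal_est:
  assumes "j0 \<le> j1" "\<epsilon> \<le> \<epsilon>'"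
  shows "rate_optimal \<psi> s1 s2 L \<epsilon>' j0 \<rho> (2 + good_const + crude_const) n m M W est"
  unfolding rate_optimal_def
proof (intro conjI allI ballI)
  have n0: "0 < real n / lg" using n lg_ge by simp
  have pA: "(real n / log 2 (real n)) powr t = 2 powr (A * t)" for t
    unfolding powr_powr[symmetric] powr_A lg_def ..
  show "distributed_estimator m est" by (rule distributed_est)
  show "real (bits n m W est f i \<omega> v) \<le> (real n / log 2 (real n)) powr (1 / (1 + 2 * s1)) * log 2 (real n)"
    for f i \<omega> v
    using bits_bound[of f i \<omega> v] unfolding pA by (simp add: lg_def mult.commute)
  fix s f assume s': "s \<in> {s1..s2}" and f': "f \<in> self_similar \<psi> s L \<epsilon>' j0 \<rho>"
  have ss: "s1 \<le> s" "s \<le> s2" using s' by auto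
  \<comment> \<open>The analysis runs with a parameter at most 1; lowering \<epsilon> only enlarges
    the self-similar class.\<close>
  have f: "f \<in> self_similar \<psi> s L \<epsilon> j0 \<rho>"
    using self_similar_mono[OF assms(2) less_imp_le[OF L]] f' by blast
  then have fb: "f \<in> besov_ball \<psi> s L" by (simp add: self_similar_def)
  have pos: "0 < 1 + 2 * s" using s ss by simp
  \<comment> \<open>Rewrites n^(1/(1+2s)) (log n)^(2s/(1+2s)) as 2^(A/(1+2s)) coefficients times log
    n bits each.\<close>
  have "2 * s / (1 + 2 * s) = 1 - 1 / (1 + 2 * s)" using pos by (simp add: field_simps)
  then have "real n powr (1 / (1 + 2 * s)) * log 2 (real n) powr (2 * s / (1 + 2 * s)) =
      (real n / log 2 (real n)) powr (1 / (1 + 2 * s)) * log 2 (real n)"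
    using lg_ge n by (simp add: powr_diff powr_divide lg_def)
  then have rate: "real n powr (1 / (1 + 2 * s)) * log 2 (real n) powr (2 * s / (1 + 2 * s)) = lg * 2 powr (A / (1 + 2 * s))"
    unfolding pA by (simp add: lg_def)
  show "expected_bits n m M W est f i \<le> ennreal ((2 + good_const + crude_const) *
      (real n powr (1 / (1 + 2 * s)) * log 2 (real n) powr (2 * s / (1 + 2 * s))))" if i: "i \<in> {1..m}" for i
    unfolding rate
    by (rule order_trans[OF expected_bits_bound[OF fb ss i] ennreal_leI])
      (use good_const_pos crude_const_pos lg_ge in \<open>auto intro!: mult_right_mono\<close>)
  have "- s / (1 + 2 * s) * A = - (A * s / (1 + 2 * s))" by simp
  then have risk: "(real n / log 2 (real n)) powr (- s / (1 + 2 * s)) = 2 powr (- (A * s / (1 + 2 * s)))"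
    unfolding pA by (simp add: mult.commute)
  show "sup_risk n m M W est f \<le> ennreal ((2 + good_const + crude_const) * (real n / log 2 (real n)) powr (- s / (1 + 2 * s)))"
    unfolding risk
    by (rule order_trans[OF sup_risk_bound[OF f assms(1) ss] ennreal_leI])
      (auto intro!: mult_right_mono)
qed

lemma (in wavelet_system) step_coefficients:
  assumes "0 < K" "0 < n"
  obtains D c where "\<And>j k. 0 < D j k"
    "\<And>j k. k \<in> wavelet_index j \<Longrightarrow> (\<Sum>l<D j k. (c j k l)\<^sup>2) / real (D j k) \<le> 4"
    "\<And>j k f. k \<in> wavelet_index j \<Longrightarrow> f \<in> L2_unit \<Longrightarrow> AE x in unit_lebesgue. \<bar>f x\<bar> \<le> K \<Longrightarrow>
       \<bar>step_functional (D j k) (c j k) (\<lambda>t. LINT x|lebesgue_on {0..t}. f x) - L2_inner f (\<psi> j k)\<bar> \<le> 1 / real n"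
proof -
  define \<eta> where "\<eta> = min 1 (1 / (real n * K))"
  have \<eta>: "0 < \<eta>" "\<eta> \<le> 1" using assms by (auto simp: \<eta>_def)
  have "K * \<eta> \<le> K * (1 / (real n * K))" using assms by (intro mult_left_mono) (auto simp: \<eta>_def)
  then have K\<eta>: "K * \<eta> \<le> 1 / real n" using assms by simp
  define good where "good j k d \<longleftrightarrow> 0 < fst d \<and> (k \<in> wavelet_index j \<longrightarrow>
      (\<Sum>l<fst d. (snd d l)\<^sup>2) / real (fst d) \<le> 4 \<and>
      (\<forall>f. f \<in> L2_unit \<longrightarrow> (AE x in unit_lebesgue. \<bar>f x\<bar> \<le> K) \<longrightarrow>
       \<bar>step_functional (fst d) (snd d) (\<lambda>t. LINT x|lebesgue_on {0..t}. f x) - L2_inner f (\<psi> j k)\<bar> \<le> 1 / real n))"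
    for j k and d :: "nat \<times> (nat \<Rightarrow> real)"
  have "\<exists>d. good j k d" for j k
  proof (cases "k \<in> wavelet_index j")
    case True
    have "L2_inner (\<psi> j k) (\<psi> j k) = 1" using psi_orthonormal[OF True True] by simp
    from step_functional_approx[OF psi_measurable[OF True] psi_bound[OF True] this \<eta>]
    obtain d c where dc: "0 < d" "(\<Sum>l<d. (c l)\<^sup>2) / real d \<le> 4"
      "\<And>f K. f \<in> L2_unit \<Longrightarrow> AE x in unit_lebesgue. \<bar>f x\<bar> \<le> K \<Longrightarrow>
       \<bar>step_functional d c (\<lambda>t. LINT x|lebesgue_on {0..t}. f x) - L2_inner f (\<psi> j k)\<bar> \<le> K * \<eta>"
      by metis
    then have "good j k (d, c)"
      unfolding good_def fst_conv snd_conv using order_trans[OF dc(3) K\<eta>] by blast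
    then show ?thesis by blast
  next
    case False
    then have "good j k (1, \<lambda>_. 0)" by (simp add: good_def)
    then show ?thesis by blast
  qed
  then have "\<forall>j. \<exists>h. \<forall>k. good j k (h k)" by metis
  then obtain h where "\<And>j k. good j k (h j k)" by metis
  then show thesis
    by (intro that[of "\<lambda>j k. fst (h j k)" "\<lambda>j k. snd (h j k)"]) (auto simp: good_def)
qed

lemma (in wavelet_system) eventually_rate_optimal:
  fixes s1 s2 L \<epsilon> \<rho> \<delta> :: real
  assumes s: "0 < s1" "s1 < s2" and L: "0 < L" and \<epsilon>: "0 < \<epsilon>" and \<rho>: "1 < \<rho>" and \<delta>: "0 < \<delta>" "\<delta> < 1"
  obtains K where "0 < K" "\<forall>\<^sub>F n in sequentially. \<forall>m (M :: 'w measure) W.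
     independent_wiener M m W \<longrightarrow> 1 \<le> m \<longrightarrow> real m \<le> real n powr \<delta> \<longrightarrow>
       (\<exists>e. rate_optimal \<psi> s1 s2 L \<epsilon> j0 \<rho> K n m M W e)"
proof -
  define \<epsilon>' where "\<epsilon>' = min \<epsilon> 1"
  define \<gamma> where "\<gamma> = 1 - \<delta>"
  \<comment> \<open>Chosen so that \<rho> \<kappa> (s2 + 1/2) = \<gamma>/4: at the top of the
    detection block the decay factor 2^(-j (s + 1/2)) is at least n^(-\<gamma>/4), against noise
    n^(-\<gamma>/2) up to a logarithm. It also gives \<rho> \<kappa> <= 1/2, which keeps the block
    below \<open>Jn\<close>.\<close>
  define \<kappa> where "\<kappa> = \<gamma> / (4 * \<rho> * (s2 + 1/2))"
  \<comment> \<open>The two entries of the minimum serve the two \<open>noise\<close> conditions of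
    \<open>design\<close>.\<close>
  define a where "a = min (\<epsilon>' / 4 * L) 1"
  define Kf where "Kf = L * C / (1 - 2 powr (- s1))"
  obtain R where R: "L + 2 \<le> 2 ^ R" using real_arch_pow[of 2 "L + 2"] by (auto intro: less_imp_le)
  obtain c0 where c0: "2 * (real R + 3) \<le> 2 ^ c0"
    using real_arch_pow[of 2 "2 * (real R + 3)"] by (auto intro: less_imp_le)
  \<comment> \<open>Equal to 2 + \<open>good_const\<close> + \<open>crude_const\<close>, written out
    before n is fixed; R, c0 and \<kappa> depend on the class parameters and \<delta> only.\<close>
  define K where "K = 2 + (64 * C + Kf * 2 powr ((4 * log 2 (8 / \<epsilon>') / \<kappa> + real c0) * s2)) + (4 * (2 ^ R + L) * C + Kf)"
  have \<epsilon>': "0 < \<epsilon>'" "\<epsilon>' \<le> 1" "\<epsilon>' \<le> \<epsilon>" using \<epsilon> by (auto simp: \<epsilon>'_def)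
  have \<gamma>: "0 < \<gamma>" "\<gamma> < 1" using \<delta> by (auto simp: \<gamma>_def)
  have \<kappa>: "0 < \<kappa>" using \<gamma> \<rho> s by (simp add: \<kappa>_def)
  have \<rho>\<kappa>: "\<rho> * \<kappa> * (s2 + 1/2) = \<gamma> / 4"
  proof -
    have "r * (\<gamma> / (4 * r * q)) * q = \<gamma> / 4" if "0 < r" "0 < q" for r q :: real
      using that by (simp add: field_simps)
    from this[of \<rho> "s2 + 1/2"] show ?thesis using \<rho> s by (simp only: \<kappa>_def)
  qed
  have \<rho>\<kappa>_half: "\<rho> * \<kappa> \<le> 1 / 2"
  proof -
    have "\<rho> * \<kappa> * (1 / 2) \<le> \<rho> * \<kappa> * (s2 + 1/2)" using \<rho> \<kappa> s by (intro mult_left_mono) auto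
    also have "\<dots> = \<gamma> / 4" by (rule \<rho>\<kappa>)
    finally have "\<rho> * \<kappa> * (1 / 2) \<le> \<gamma> / 4" .
    then show ?thesis using \<gamma> by (simp add: mult_ac)
  qed
  have a: "0 < a" using \<epsilon>' L by (simp add: a_def)
  have Kf: "0 < Kf" unfolding Kf_def using L C_pos s by (auto simp: powr_less_one)
  have K: "0 < K" unfolding K_def using C_pos Kf L by (intro add_pos_pos mult_pos_pos) auto
  \<comment> \<open>The third condition leaves room for rounding Jm up and Jn down in Jm <= Jn. The
    fourth makes the rounded j1 at least max 1 j0 and at least \<kappa> log n / 2.\<close>
  define good where "good n \<longleftrightarrow> 8 \<le> n \<and> real c0 * (1 + 2 * s2) \<le> log 2 (real n / log 2 (real n)) \<and>
     log 2 (real n) * (1 - 1 / (1 + 2 * s1)) \<ge> 2 \<and> \<kappa> * log 2 (real n) \<ge> real j0 + 2 \<and>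
     1 / real n + real n powr (- \<gamma> / 2) * sqrt (32 * ln (real n)) \<le> a * real n powr (- \<gamma> / 4)" for n :: nat
  have ev: "\<forall>\<^sub>F n in sequentially. good n"
    unfolding good_def
  proof (intro eventually_conj)
    show "\<forall>\<^sub>F n::nat in sequentially. 8 \<le> n" by (rule eventually_ge_at_top)
    have "filterlim (\<lambda>n::nat. log 2 (real n / log 2 (real n))) at_top sequentially" by real_asymp
    then show "\<forall>\<^sub>F n::nat in sequentially. real c0 * (1 + 2 * s2) \<le> log 2 (real n / log 2 (real n))"
      by (simp add: filterlim_at_top)
    have "0 < 1 - 1 / (1 + 2 * s1)" using s by simp
    then have "filterlim (\<lambda>n::nat. log 2 (real n) * (1 - 1 / (1 + 2 * s1))) at_top sequentially" by real_asymp
    then show "\<forall>\<^sub>F n::nat in sequentially. 2 \<le> log 2 (real n) * (1 - 1 / (1 + 2 * s1))"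
      by (simp add: filterlim_at_top)
    have "filterlim (\<lambda>n::nat. \<kappa> * log 2 (real n)) at_top sequentially" using \<kappa> by real_asymp
    then show "\<forall>\<^sub>F n::nat in sequentially. real j0 + 2 \<le> \<kappa> * log 2 (real n)"
      by (simp add: filterlim_at_top)
    show "\<forall>\<^sub>F n::nat in sequentially.
      1 / real n + real n powr (- \<gamma> / 2) * sqrt (32 * ln (real n)) \<le> a * real n powr (- \<gamma> / 4)"
      by (rule eventually_noise_small[OF \<gamma> a])
  qed
  have main: "\<exists>e. rate_optimal \<psi> s1 s2 L \<epsilon> j0 \<rho> K n m M W e"
    if gn: "good n" and iw: "independent_wiener M m W" and m: "1 \<le> m" "real m \<le> real n powr \<delta>"
    for n m and M :: "'w measure" and W
  proof -
    let ?lg = "log 2 (real n)"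
    let ?A = "log 2 (real n / log 2 (real n))"
    let ?u = "sqrt (32 * ln (real n))"
    have n: "8 \<le> n" "0 < n" and g2: "real c0 * (1 + 2 * s2) \<le> ?A" and g3: "2 \<le> ?lg * (1 - 1 / (1 + 2 * s1))"
      and g4: "real j0 + 2 \<le> \<kappa> * ?lg"
      and g5: "1 / real n + real n powr (- \<gamma> / 2) * ?u \<le> a * real n powr (- \<gamma> / 4)"
      using gn by (auto simp: good_def)
    have lg: "3 \<le> ?lg"
    proof -
      have "log 2 8 \<le> ?lg" using n by (subst log_le_cancel_iff) auto
      moreover have "log 2 8 = (3::real)" using log_pow_cancel[of 2 3] by simp
      ultimately show ?thesis by simp
    qed
    have A: "0 \<le> ?A" using g2 s by (intro order_trans[OF _ g2]) auto
    have Alg: "?A \<le> ?lg"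
    proof -
      have "?A = ?lg - log 2 ?lg" using n lg by (subst log_divide) auto
      moreover have "0 \<le> log 2 ?lg" using lg by (subst zero_le_log_cancel_iff) auto
      ultimately show ?thesis by simp
    qed
    have plg: "2 powr ?lg = real n" using n by (intro powr_log_cancel) auto
    define Jn where "Jn = nat \<lfloor>?lg\<rfloor>"
    define Jm where "Jm = nat \<lceil>?A / (1 + 2 * s1)\<rceil>"
    define j1 where "j1 = nat \<lfloor>\<kappa> * ?lg\<rfloor>"
    define p where "p = nat \<lceil>?lg\<rceil>"
    have Jn: "real Jn \<le> ?lg" "?lg - 1 \<le> real Jn" using lg unfolding Jn_def by linarith+
    have A1: "0 \<le> ?A / (1 + 2 * s1)" using A s by simp
    have Jm: "?A / (1 + 2 * s1) \<le> real Jm" "real Jm \<le> ?A / (1 + 2 * s1) + 1"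
      using A1 unfolding Jm_def by linarith+
    have "?A / (1 + 2 * s1) \<le> ?lg / (1 + 2 * s1)" using Alg s by (intro divide_right_mono) auto
    also have "\<dots> = ?lg - ?lg * (1 - 1 / (1 + 2 * s1))" by (simp add: algebra_simps)
    also have "\<dots> \<le> ?lg - 2" using g3 by linarith
    finally have JmJn: "Jm \<le> Jn" using Jm(2) Jn(2) by linarith
    have j1: "real j1 \<le> \<kappa> * ?lg" "\<kappa> * ?lg - 1 \<le> real j1"
      using g4 unfolding j1_def by linarith+
    have j1': "1 \<le> j1" "j0 \<le> j1" "\<kappa> * ?lg \<le> 2 * real j1" using j1(2) g4 by linarith+
    have "\<rho> * real j1 \<le> \<rho> * (\<kappa> * ?lg)" using j1(1) \<rho> by (intro mult_left_mono) auto
    also have "\<dots> = \<rho> * \<kappa> * ?lg" by simp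
    also have "\<dots> \<le> 1 / 2 * ?lg" using \<rho>\<kappa>_half lg by (intro mult_right_mono) auto
    also have "\<dots> \<le> real Jn" using Jn(2) lg by linarith
    finally have \<rho>j1: "\<rho> * real j1 \<le> real Jn" .
    have p: "?lg \<le> real p" "real p \<le> ?lg + 1" using lg unfolding p_def by linarith+
    have "2 powr ?lg \<le> 2 powr real p" using p(1) by (intro powr_mono) auto
    then have np: "real n \<le> 2 ^ p" by (simp add: plg powr_realpow)
    have c0A: "real c0 \<le> ?A / (1 + 2 * s2)" using g2 s by (simp add: pos_le_divide_eq)
    have u0: "0 \<le> ?u" using n by simp
    have "sqrt (real m / real n) \<le> sqrt (real n powr \<delta> / real n)"
      using m by (intro real_sqrt_le_mono divide_right_mono) auto
    also have "real n powr \<delta> / real n = real n powr (- \<gamma>)"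
      using n powr_diff[of "real n" \<delta> 1] by (simp add: \<gamma>_def)
    also have "sqrt (real n powr (- \<gamma>)) = real n powr (- \<gamma> / 2)"
      using n by (simp add: powr_half_sqrt[symmetric] powr_powr)
    finally have "sqrt (real m / real n) * ?u \<le> real n powr (- \<gamma> / 2) * ?u"
      using u0 by (rule mult_right_mono)
    then have noise: "1 / real n + sqrt (real m / real n) * ?u \<le> a * real n powr (- \<gamma> / 4)"
      using g5 by linarith
    have n1: "real n powr (- \<gamma> / 4) \<le> 1"
      using n \<gamma> powr_mono[of "- \<gamma> / 4" 0 "real n"] by simp
    have noise2: "1 / real n + sqrt (real m / real n) * ?u \<le> 1"
    proof -
      have "a * real n powr (- \<gamma> / 4) \<le> 1 * 1" using a n1 by (intro mult_mono) (auto simp: a_def)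
      then show ?thesis using noise by linarith
    qed
    have noise1: "1 / real n + sqrt (real m / real n) * ?u \<le> \<epsilon>' / 4 * L * 2 powr (- \<rho> * real j1 * (s2 + 1/2))"
    proof -
      have "\<rho> * real j1 * (s2 + 1/2) \<le> \<rho> * (\<kappa> * ?lg) * (s2 + 1/2)"
        using j1(1) \<rho> s by (intro mult_right_mono mult_left_mono) auto
      also have "\<dots> = \<rho> * \<kappa> * (s2 + 1/2) * ?lg" by simp
      also have "\<dots> = \<gamma> / 4 * ?lg" by (simp only: \<rho>\<kappa>)
      finally have "?lg * (- \<gamma> / 4) \<le> - \<rho> * real j1 * (s2 + 1/2)" by (simp add: algebra_simps)
      then have "2 powr (?lg * (- \<gamma> / 4)) \<le> 2 powr (- \<rho> * real j1 * (s2 + 1/2))"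
        by (intro powr_mono) auto
      then have "real n powr (- \<gamma> / 4) \<le> 2 powr (- \<rho> * real j1 * (s2 + 1/2))"
        by (simp only: powr_powr[symmetric] plg)
      then have "a * real n powr (- \<gamma> / 4) \<le> \<epsilon>' / 4 * L * 2 powr (- \<rho> * real j1 * (s2 + 1/2))"
        using \<epsilon>' L by (intro mult_mono) (auto simp: a_def)
      then show ?thesis using noise by linarith
    qed
    have mn: "m \<le> n"
    proof -
      have "real n powr \<delta> \<le> real n powr 1" using n \<delta> by (intro powr_mono) auto
      then show ?thesis using m n by simp
    qed
    obtain D c where D: "\<And>j k. 0 < D j k"
      "\<And>j k. k \<in> wavelet_index j \<Longrightarrow> (\<Sum>l<D j k. (c j k l)\<^sup>2) / real (D j k) \<le> 4"
      "\<And>j k f. k \<in> wavelet_index j \<Longrightarrow> f \<in> L2_unit \<Longrightarrow> AE x in unit_lebesgue. \<bar>f x\<bar> \<le> Kf \<Longrightarrow>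
       \<bar>step_functional (D j k) (c j k) (\<lambda>t. LINT x|lebesgue_on {0..t}. f x) - L2_inner f (\<psi> j k)\<bar> \<le> 1 / real n"
      using step_coefficients[OF Kf n(2)] by metis
    have ax: "design \<psi> C n m j1 Jm Jn p R c0 s1 s2 L \<epsilon>' \<rho> \<kappa> D c M W"
      by (intro design.intro design_axioms.intro wavelet_system_axioms)
        (fact iw n(1) m(1) mn s L \<epsilon>'(1,2) \<rho> \<kappa> Jm JmJn Jn(1) j1'(1,3) \<rho>j1 np p(2) R c0 c0A noise1 noise2
          D(1) D(2) D(3)[unfolded Kf_def])+
    interpret d: design \<psi> C n m j1 Jm Jn p R c0 s1 s2 L \<epsilon>' \<rho> \<kappa> D c M W ?lg ?A ?u "L * C / (1 - 2 powr (- s1))"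
      by (rule ax)
    have "2 + d.good_const + d.crude_const = K"
      by (simp add: K_def Kf_def d.good_const_def d.crude_const_def)
    then show ?thesis
      using d.rate_optimal_est[OF j1'(2) \<epsilon>'(3)] by metis
  qed
  show thesis
    by (rule that[OF K]) (rule eventually_mono[OF ev], use main in blast)
qed

section \<open>From fixed n to the asymptotic statement\<close>

lemma rate_optimal_imp:
  assumes "rate_optimal \<psi> s1 s2 L \<epsilon> j0 \<rho> K n m M W e" "2 \<le> n" "1 \<le> m"
  shows "(MAX i\<in>{1..m}. SUP s\<in>{s1..s2}. SUP f0\<in>self_similar \<psi> s L \<epsilon> j0 \<rho>.
          expected_bits n m M W e f0 i /
          ennreal (real n powr (1 / (1 + 2 * s)) * log 2 (real n) powr (2 * s / (1 + 2 * s)))) \<le> ennreal K"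
    and "(SUP s\<in>{s1..s2}. SUP f0\<in>self_similar \<psi> s L \<epsilon> j0 \<rho>.
          sup_risk n m M W e f0 / ennreal ((real n / log 2 (real n)) powr (- s / (1 + 2 * s)))) \<le> ennreal K"
proof -
  have lg: "0 < log 2 (real n)" using assms(2) by (subst zero_less_log_cancel_iff) auto
  have n0: "real n \<noteq> 0" using assms(2) by simp
  have lg0: "log 2 (real n) \<noteq> 0" using lg by (rule less_imp_neq[symmetric])
  have div: "x / ennreal r \<le> ennreal K" if "0 < r" "x \<le> ennreal (K * r)" for x r
    using that by (intro divide_le_posI_ennreal) (auto simp: ennreal_mult'' mult.commute)
  show "(SUP s\<in>{s1..s2}. SUP f0\<in>self_similar \<psi> s L \<epsilon> j0 \<rho>.
          sup_risk n m M W e f0 / ennreal ((real n / log 2 (real n)) powr (- s / (1 + 2 * s)))) \<le> ennreal K"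
  proof (intro SUP_least div)
    fix s f assume "s \<in> {s1..s2}" "f \<in> self_similar \<psi> s L \<epsilon> j0 \<rho>"
    then show "sup_risk n m M W e f \<le> ennreal (K * (real n / log 2 (real n)) powr (- s / (1 + 2 * s)))"
      using assms(1) unfolding rate_optimal_def by blast
    show "0 < (real n / log 2 (real n)) powr (- s / (1 + 2 * s))" by (simp only: powr_gt_zero divide_eq_0_iff n0 lg0 simp_thms)
  qed
  have "(SUP s\<in>{s1..s2}. SUP f0\<in>self_similar \<psi> s L \<epsilon> j0 \<rho>.
          expected_bits n m M W e f0 i /
          ennreal (real n powr (1 / (1 + 2 * s)) * log 2 (real n) powr (2 * s / (1 + 2 * s)))) \<le> ennreal K"
    if "i \<in> {1..m}" for i
  proof (intro SUP_least div)
    fix s f assume "s \<in> {s1..s2}" "f \<in> self_similar \<psi> s L \<epsilon> j0 \<rho>"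
    then show "expected_bits n m M W e f i \<le>
        ennreal (K * (real n powr (1 / (1 + 2 * s)) * log 2 (real n) powr (2 * s / (1 + 2 * s))))"
      using assms(1) that unfolding rate_optimal_def by blast
    show "0 < real n powr (1 / (1 + 2 * s)) * log 2 (real n) powr (2 * s / (1 + 2 * s))"
      by (intro mult_pos_pos) (simp_all only: powr_gt_zero n0 lg0 simp_thms)
  qed
  then show "(MAX i\<in>{1..m}. SUP s\<in>{s1..s2}. SUP f0\<in>self_similar \<psi> s L \<epsilon> j0 \<rho>.
          expected_bits n m M W e f0 i /
          ennreal (real n powr (1 / (1 + 2 * s)) * log 2 (real n) powr (2 * s / (1 + 2 * s)))) \<le> ennreal K"
    using assms(3) by (intro Max.boundedI) auto
qed

theorem theorem2p8:
  fixes M :: "nat \<Rightarrow> 'w measure"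
    and W :: "nat \<Rightarrow> nat \<Rightarrow> real \<Rightarrow> 'w \<Rightarrow> real"
    and m :: "nat \<Rightarrow> nat"
    and \<psi> :: "nat \<Rightarrow> nat \<Rightarrow> real \<Rightarrow> real"
    and N j0 :: nat
    and \<delta> s1 s2 L \<epsilon> \<rho> :: real
  assumes model: "\<And>n. n \<ge> 1 \<Longrightarrow> independent_wiener (M n) (m n) (W n)"
    and \<delta>: "0 < \<delta>" "\<delta> < 1"
    and machines: "\<And>n. n \<ge> 1 \<Longrightarrow> 1 \<le> m n \<and> real (m n) \<le> real n powr \<delta>"
    and s: "0 < s1" "s1 < s2"
    and params: "L > 0" "\<epsilon> > 0" "\<rho> > 1"
    and basis: "cdv_wavelet_basis N \<psi>" "real N > s2"
  shows "\<exists>e :: nat \<Rightarrow> dist_estimator.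
    (\<forall>n\<ge>1. distributed_estimator (m n) (e n)) \<and>
    (\<forall>n\<ge>2. \<forall>s\<in>{s1..s2}. \<forall>f0\<in>besov_ball \<psi> s L. \<forall>i\<in>{1..m n}.
       \<forall>(\<omega>, u)\<in>space (M n \<Otimes>\<^sub>M seed (e n) i).
         real (bits n (m n) (W n) (e n) f0 i \<omega> u)
           \<le> (real n / log 2 (real n)) powr (1 / (1 + 2 * s1)) * log 2 (real n)) \<and>
    (\<exists>C>0. \<forall>\<^sub>F n in sequentially.
       (MAX i\<in>{1..m n}. SUP s\<in>{s1..s2}. SUP f0\<in>self_similar \<psi> s L \<epsilon> j0 \<rho>.
          expected_bits n (m n) (M n) (W n) (e n) f0 i /
          ennreal (real n powr (1 / (1 + 2 * s)) * log 2 (real n) powr (2 * s / (1 + 2 * s))))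
       \<le> ennreal C) \<and>
    (\<exists>C>0. \<forall>\<^sub>F n in sequentially.
       (SUP s\<in>{s1..s2}. SUP f0\<in>self_similar \<psi> s L \<epsilon> j0 \<rho>.
          sup_risk n (m n) (M n) (W n) (e n) f0 /
          ennreal ((real n / log 2 (real n)) powr (- s / (1 + 2 * s))))
       \<le> ennreal C)"
proof -
  obtain C where ws: "wavelet_system \<psi> C" using cdv_wavelet_system[OF basis(1)] by blast
  obtain K where K: "0 < K" and ev: "\<forall>\<^sub>F n in sequentially. \<forall>m (M :: 'w measure) W.
     independent_wiener M m W \<longrightarrow> 1 \<le> m \<longrightarrow> real m \<le> real n powr \<delta> \<longrightarrow>
       (\<exists>e. rate_optimal \<psi> s1 s2 L \<epsilon> j0 \<rho> K n m M W e)"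
    by (rule wavelet_system.eventually_rate_optimal[OF ws s params \<delta>]) (rule that)
  let ?opt = "\<lambda>n e. rate_optimal \<psi> s1 s2 L \<epsilon> j0 \<rho> K n (m n) (M n) (W n) e"
  \<comment> \<open>Default for those n for which no rate-optimal procedure exists. Sending nothing
    meets the bit budget as soon as log n >= 0, so the nonasymptotic claims hold for all n in their
    range.\<close>
  define silent :: dist_estimator where
    "silent = \<lparr>seed = \<lambda>_. return borel 0, encode = \<lambda>_ _. [], decode = \<lambda>_ _. 0\<rparr>"
  define e where "e n = (if \<exists>e. ?opt n e then SOME e. ?opt n e else silent)" for n
  have e: "?opt n (e n)" if "\<exists>e. ?opt n e" for n
    unfolding e_def if_P[OF that] by (rule someI_ex[OF that])
  have silent: "distributed_estimator k silent" for k
    by (simp add: distributed_estimator_def silent_def prob_space_return L2_unit_def)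
  have "\<forall>\<^sub>F n in sequentially. ?opt n (e n)"
    using ev eventually_ge_at_top[of 1]
  proof eventually_elim
    case (elim n)
    have "\<exists>e. ?opt n e"
      using machines[OF elim(2)] by (intro elim(1)[rule_format, OF model[OF elim(2)]]) auto
    then show ?case by (rule e)
  qed
  then have opt: "\<forall>\<^sub>F n in sequentially. 2 \<le> n \<and> 1 \<le> m n \<and> ?opt n (e n)"
    using eventually_ge_at_top[of 2] by eventually_elim (use machines in auto)
  have bits: "real (bits n (m n) (W n) (e n) f0 i \<omega> u)
      \<le> (real n / log 2 (real n)) powr (1 / (1 + 2 * s1)) * log 2 (real n)"
    if n: "2 \<le> n" for n f0 i \<omega> u
  proof (cases "\<exists>e. ?opt n e")
    case True
    show ?thesis
      by (rule e[OF True, unfolded rate_optimal_def, THEN conjunct2, THEN conjunct1, THEN spec, THEN spec, THEN spec, THEN spec])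
  next
    case False
    then have "e n = silent" unfolding e_def by (rule if_not_P)
    moreover have "0 \<le> log 2 (real n)" using n by (subst zero_le_log_cancel_iff) auto
    ultimately show ?thesis by (simp add: silent_def bits_def message_def)
  qed
  show ?thesis
  proof (intro exI[of _ e] conjI)
    show "\<forall>n\<ge>1. distributed_estimator (m n) (e n)"
    proof (intro allI impI)
      fix n
      show "distributed_estimator (m n) (e n)"
      proof (cases "\<exists>e. ?opt n e")
        case True
        show ?thesis by (rule e[OF True, unfolded rate_optimal_def, THEN conjunct1])
      next
        case False
        then have "e n = silent" unfolding e_def by (rule if_not_P)
        then show ?thesis by (simp only: silent)
      qed
    qed
    show "\<forall>n\<ge>2. \<forall>s\<in>{s1..s2}. \<forall>f0\<in>besov_ball \<psi> s L. \<forall>i\<in>{1..m n}.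
       \<forall>(\<omega>, u)\<in>space (M n \<Otimes>\<^sub>M seed (e n) i).
         real (bits n (m n) (W n) (e n) f0 i \<omega> u)
           \<le> (real n / log 2 (real n)) powr (1 / (1 + 2 * s1)) * log 2 (real n)"
      by (intro allI impI ballI) (simp only: case_prod_beta bits)
    show "\<exists>C>0. \<forall>\<^sub>F n in sequentially.
       (MAX i\<in>{1..m n}. SUP s\<in>{s1..s2}. SUP f0\<in>self_similar \<psi> s L \<epsilon> j0 \<rho>.
          expected_bits n (m n) (M n) (W n) (e n) f0 i /
          ennreal (real n powr (1 / (1 + 2 * s)) * log 2 (real n) powr (2 * s / (1 + 2 * s))))
       \<le> ennreal C"
      by (intro exI[of _ K] conjI K eventually_mono[OF opt]) (elim conjE, rule rate_optimal_imp(1); assumption)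
    show "\<exists>C>0. \<forall>\<^sub>F n in sequentially.
       (SUP s\<in>{s1..s2}. SUP f0\<in>self_similar \<psi> s L \<epsilon> j0 \<rho>.
          sup_risk n (m n) (M n) (W n) (e n) f0 /
          ennreal ((real n / log 2 (real n)) powr (- s / (1 + 2 * s))))
       \<le> ennreal C"
      by (intro exI[of _ K] conjI K eventually_mono[OF opt]) (elim conjE, rule rate_optimal_imp(2); assumption)
  qed
qed

end
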